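(* Let $2<p<\infty$, let $\Omega\subset\mathbb{H}$ be a bounded domain, and let $\Omega'\subset\mathbb{H}$ be an open set containing $\overline\Omega$. Let $U$ be a smooth function in $\Omega'$ such that $\Delta^N_{\mathbb{H},p}U=0$ and $\nabla_{\mathbb{H}}U\ne0$ in $\Omega'$. Then there exist $\hat\varepsilon\in(0,1)$ (with $\Omega_\varepsilon\subset\Omega'$ for all $0<\varepsilon<\hat\varepsilon$), $s\ge4$ and $q_0\in\mathbb{H}$ such that, denoting $v(x)=|q_0^{-1}*x|_{\mathbb{H}}^s$, for all $0<\varepsilon<\hat\varepsilon$ the function $U+\varepsilon v$ is a subsolution and the function $U-\varepsilon v$ is a supersolution in $\Omega_\varepsilon$ of the dynamic programming principle with their own values on $\Gamma^{\mathbb{H}}_\varepsilon$ as boundary data; that is, $$(U+\varepsilon v)(x)\le\mu^{\mathbb{H}}_p(U+\varepsilon v,\varepsilon)(x)\quad\text{and}\quad (U-\varepsilon v)(x)\ge\mu^{\mathbb{H}}_p(U-\varepsilon v,\varepsilon)(x)\qquad\text{for all }x\in\Omega .$$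
   Context: Heisenberg group: $\mathbb{H}=(\mathbb{R}^3,* )$ with $(x_1,x_2,x_3)*(y_1,y_2,y_3)=(x_1+y_1,\,x_2+y_2,\,x_3+y_3+\tfrac12(x_1y_2-x_2y_1))$. The Korányi gauge is $|x|_{\mathbb{H}}=((x_1^2+x_2^2)^2+16x_3^2)^{1/4}$, the metric is $d_{\mathbb{H}}(x,y)=|x^{-1}*y|_{\mathbb{H}}$, and $B^{\mathbb{H}}_r(x_0)=\{x\in\mathbb{H}: d_{\mathbb{H}}(x_0,x)<r\}$. Horizontal operators: $X_1=\partial_{x_1}-\tfrac{x_2}{2}\partial_{x_3}$, $X_2=\partial_{x_2}+\tfrac{x_1}{2}\partial_{x_3}$; $\nabla_{\mathbb{H}}u=(X_1u,X_2u)$; $\Delta_{\mathbb{H}}u=X_1^2u+X_2^2u$; $D^{2,*}_{\mathbb{H}}u$ is the $2\times2$ matrix with entries $\tfrac12(X_iX_ju+X_jX_iu)$. Where $\nabla_{\mathbb{H}}u\ne0$, the normalized $p$-Laplacian is $$\Delta^N_{\mathbb{H},p}u=(p-2)\Big\langle D^{2,*}_{\mathbb{H}}u\,\tfrac{\nabla_{\mathbb{H}}u}{|\nabla_{\mathbb{H}}u|},\tfrac{\nabla_{\mathbb{H}}u}{|\nabla_{\mathbb{H}}u|}\Big\rangle+\Delta_{\mathbb{H}}u .$$ Boundary strips: for $0<\varepsilon\le1$, $\Gamma^{\mathbb{H}}_\varepsilon=\{x\in\mathbb{H}\setminus\Omega:\operatorname{dist}_{\mathbb{H}}(x,\Omega)\le\varepsilon\}$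 and $\Omega_\varepsilon=\Omega\cup\Gamma^{\mathbb{H}}_\varepsilon$. Natural $p$-mean: for $1<p<\infty$, $\phi$ bounded and Lebesgue measurable on $\Omega_\varepsilon$, and $x\in\overline\Omega$, $\mu^{\mathbb{H}}_p(\phi,\varepsilon)(x)$ is the unique real number $\lambda$ minimizing $\|\phi-\lambda\|_{L^p(\overline{B^{\mathbb{H}}_\varepsilon(x)})}$ (with respect to Lebesgue measure on $\mathbb{R}^3$). Dynamic programming principle with boundary datum $G$: $u(x)=\mu^{\mathbb{H}}_p(u,\varepsilon)(x)$ for $x\in\Omega$ and $u=G$ on $\Gamma^{\mathbb{H}}_\varepsilon$. A bounded measurable $u$ on $\Omega_\varepsilon$ is a subsolution (resp. supersolution) with boundary datum $G$ if $u\le G$ (resp. $u\ge G$) on $\Gamma^{\mathbb{H}}_\varepsilon$ and $u(x)\le\mu^{\mathbb{H}}_p(u,\varepsilon)(x)$ (resp. $\ge$) for $x\in\Omega$. *)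

theory Defs
  imports "HOL-Analysis.Analysis"
begin

section \<open>The Heisenberg group\<close>

text \<open>
  Points of the Heisenberg group are points of \<open>\<real>\<^sup>3\<close>.  The gauge metric below induces the Euclidean
  topology and has the same bounded sets as the Euclidean metric, so \<^const>\<open>open\<close>,
  \<^const>\<open>closure\<close>, \<^const>\<open>connected\<close> and \<^const>\<open>bounded\<close> are those of \<open>\<real>\<^sup>3\<close>.
\<close>

type_synonym heis = "real^3"

definition heis_mult :: "heis \<Rightarrow> heis \<Rightarrow> heis" where
  "heis_mult x y =
     vector [x$1 + y$1, x$2 + y$2, x$3 + y$3 + (x$1 * y$2 - x$2 * y$1) / 2]"

definition heis_inv :: "heis \<Rightarrow> heis" where
  "heis_inv x = - x"

lemma heis_mult_group:
  "heis_mult (heis_mult x y) z = heis_mult x (heis_mult y z)"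
  "heis_mult 0 x = x" "heis_mult x 0 = x"
  "heis_mult (heis_inv x) x = 0" "heis_mult x (heis_inv x) = 0"
  by (simp_all add: heis_mult_def heis_inv_def vec_eq_iff forall_3 field_simps)

definition heis_gauge :: "heis \<Rightarrow> real" where
  "heis_gauge x = (((x$1)\<^sup>2 + (x$2)\<^sup>2)\<^sup>2 + 16 * (x$3)\<^sup>2) powr (1/4)"

definition heis_dist :: "heis \<Rightarrow> heis \<Rightarrow> real" where
  "heis_dist x y = heis_gauge (heis_mult (heis_inv x) y)"

definition heis_ball :: "heis \<Rightarrow> real \<Rightarrow> heis set" where
  "heis_ball x0 r = {x. heis_dist x0 x < r}"

text \<open>The infimum is meaningful for nonempty \<open>S\<close> only.\<close>

definition heis_setdist :: "heis \<Rightarrow> heis set \<Rightarrow> real" where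
  "heis_setdist x S = (INF y\<in>S. heis_dist x y)"

definition boundary_strip :: "heis set \<Rightarrow> real \<Rightarrow> heis set" where
  "boundary_strip \<Omega> \<epsilon> = {x. x \<notin> \<Omega> \<and> heis_setdist x \<Omega> \<le> \<epsilon>}"

definition extended_domain :: "heis set \<Rightarrow> real \<Rightarrow> heis set" where
  "extended_domain \<Omega> \<epsilon> = \<Omega> \<union> boundary_strip \<Omega> \<epsilon>"


section \<open>Smooth functions and horizontal derivatives\<close>

definition partial :: "3 \<Rightarrow> (heis \<Rightarrow> real) \<Rightarrow> heis \<Rightarrow> real" where
  "partial k u x = frechet_derivative u (at x) (axis k 1)"

text \<open>
  \<open>C^n\<close> on an open set \<open>S\<close>: all iterated partial derivatives of order at most \<open>n\<close> exist and
  are continuous on \<open>S\<close>.  Asking for total differentiability at each stage before the last is no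
  restriction, since it follows from continuity of the partial derivatives, and it makes
  \<^const>\<open>frechet_derivative\<close> meaningful.
\<close>

fun Cn_on :: "nat \<Rightarrow> heis set \<Rightarrow> (heis \<Rightarrow> real) \<Rightarrow> bool" where
  "Cn_on 0 S u \<longleftrightarrow> continuous_on S u"
| "Cn_on (Suc n) S u \<longleftrightarrow> (\<forall>x\<in>S. u differentiable (at x)) \<and> (\<forall>k. Cn_on n S (partial k u))"

definition smooth_fun_on :: "heis set \<Rightarrow> (heis \<Rightarrow> real) \<Rightarrow> bool" where
  "smooth_fun_on S u \<longleftrightarrow> (\<forall>n. Cn_on n S u)"

definition hor :: "2 \<Rightarrow> (heis \<Rightarrow> real) \<Rightarrow> heis \<Rightarrow> real" where
  "hor i u x = (if i = 1 then partial 1 u x - x$2 / 2 * partial 3 u x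
                else partial 2 u x + x$1 / 2 * partial 3 u x)"

definition hor_grad :: "(heis \<Rightarrow> real) \<Rightarrow> heis \<Rightarrow> real^2" where
  "hor_grad u x = (\<chi> i. hor i u x)"

definition hor_laplacian :: "(heis \<Rightarrow> real) \<Rightarrow> heis \<Rightarrow> real" where
  "hor_laplacian u x = hor 1 (hor 1 u) x + hor 2 (hor 2 u) x"

definition sym_hor_hessian :: "(heis \<Rightarrow> real) \<Rightarrow> heis \<Rightarrow> real^2^2" where
  "sym_hor_hessian u x = (\<chi> i j. (hor i (hor j u) x + hor j (hor i u) x) / 2)"

text \<open>Meaningful where \<open>hor_grad u x \<noteq> 0\<close>.\<close>

definition normalized_p_laplacian :: "real \<Rightarrow> (heis \<Rightarrow> real) \<Rightarrow> heis \<Rightarrow> real" where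
  "normalized_p_laplacian p u x =
     (let n = (1 / norm (hor_grad u x)) *\<^sub>R hor_grad u x
      in (p - 2) * ((sym_hor_hessian u x *v n) \<bullet> n) + hor_laplacian u x)"


section \<open>The natural p-mean and the dynamic programming principle\<close>

definition Lp_norm_on :: "real \<Rightarrow> heis set \<Rightarrow> (heis \<Rightarrow> real) \<Rightarrow> real" where
  "Lp_norm_on p B f = (set_lebesgue_integral lebesgue B (\<lambda>y. \<bar>f y\<bar> powr p)) powr (1/p)"

text \<open>
  For \<open>1 < p\<close>, \<open>0 < \<epsilon>\<close> and \<open>\<phi>\<close> bounded and Lebesgue measurable on the ball the minimizer exists and is
  unique by strict convexity, so the description is proper.
\<close>

definition p_mean :: "real \<Rightarrow> (heis \<Rightarrow> real) \<Rightarrow> real \<Rightarrow> heis \<Rightarrow> real" where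
  "p_mean p \<phi> \<epsilon> x =
     (THE l. \<forall>m. Lp_norm_on p (closure (heis_ball x \<epsilon>)) (\<lambda>y. \<phi> y - l)
                \<le> Lp_norm_on p (closure (heis_ball x \<epsilon>)) (\<lambda>y. \<phi> y - m))"

definition bounded_measurable_on :: "heis set \<Rightarrow> (heis \<Rightarrow> real) \<Rightarrow> bool" where
  "bounded_measurable_on S u \<longleftrightarrow> bounded (u ` S) \<and> u \<in> borel_measurable (lebesgue_on S)"

definition dpp_subsolution ::
  "real \<Rightarrow> heis set \<Rightarrow> real \<Rightarrow> (heis \<Rightarrow> real) \<Rightarrow> (heis \<Rightarrow> real) \<Rightarrow> bool" where
  "dpp_subsolution p \<Omega> \<epsilon> G u \<longleftrightarrow>
     bounded_measurable_on (extended_domain \<Omega> \<epsilon>) u \<and>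
     (\<forall>x\<in>boundary_strip \<Omega> \<epsilon>. u x \<le> G x) \<and>
     (\<forall>x\<in>\<Omega>. u x \<le> p_mean p u \<epsilon> x)"

definition dpp_supersolution ::
  "real \<Rightarrow> heis set \<Rightarrow> real \<Rightarrow> (heis \<Rightarrow> real) \<Rightarrow> (heis \<Rightarrow> real) \<Rightarrow> bool" where
  "dpp_supersolution p \<Omega> \<epsilon> G u \<longleftrightarrow>
     bounded_measurable_on (extended_domain \<Omega> \<epsilon>) u \<and>
     (\<forall>x\<in>boundary_strip \<Omega> \<epsilon>. u x \<ge> G x) \<and>
     (\<forall>x\<in>\<Omega>. u x \<ge> p_mean p u \<epsilon> x)"

end

theory Submission
  imports Defs
begin

text \<open>
  Write \<open>h(t) = \<bar>t\<bar>\<^sup>p\<^sup>-\<^sup>2 t\<close> and let \<open>B\<close> be the closed unit gauge ball.  Since \<open>\<mu>\<close> is characterised by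
  \<open>\<integral> h(\<phi> - \<mu>) = 0\<close> and \<open>h\<close> is increasing, \<open>\<phi>(x) \<le> \<mu>\<close> follows from \<open>\<integral> h(\<phi> - \<phi>(x)) \<ge> 0\<close>.  After rescaling to
  \<open>B\<close> and dividing by \<open>\<epsilon>\<close>, the increment of \<open>\<phi> = U + \<epsilon>v\<close> is \<open>\<langle>a,z\<rangle> + \<epsilon>Q(z) + O(\<epsilon>\<^sup>2)\<close> with \<open>a\<close> the horizontal
  gradient.  The leading term integrates to zero by oddness, and the next one is a positive multiple of
  \<open>\<epsilon>\<close> times the normalized \<open>p\<close>-Laplacian of \<open>\<phi>\<close>, because \<open>\<integral> h(\<langle>a,z\<rangle>) z dz = \<kappa>\<bar>a\<bar>\<^sup>p\<^sup>-\<^sup>2 a\<close> by rotation invariance.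
  All further terms are at most \<open>C\<epsilon>\<^sup>2\<close> with \<open>C\<close> depending on \<open>U\<close> only.  As \<open>U\<close> is \<open>p\<close>-harmonic, the normalized
  \<open>p\<close>-Laplacian of \<open>\<phi>\<close> is \<open>\<epsilon>\<close> times its linearisation at \<open>U\<close> in the direction \<open>v\<close>, and a high power \<open>v\<close> of the
  gauge, centred so that \<open>\<Omega>\<close> stays away from the vertical axis through \<open>q\<^sub>0\<close>, makes that as large as
  needed to beat \<open>C\<close>.  The supersolution is the same statement for \<open>-U\<close>.
\<close>

section \<open>Signed powers\<close>

text \<open>Two obstacles shape the estimates. For \<open>p < 3\<close> the signed power is not
  twice differentiable at 0, so the quadratic remainder carries the weight
  \<open>\<bar>lin a b z\<bar> powr (p - 3)\<close>. This is integrable over the ball since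
  \<open>p - 3 > -1\<close>, and its integral is uniform only under a positive lower bound on the
  horizontal gradient, which the perturbation by the barrier must not destroy. The other obstacle is
  a possible circularity: the barrier has to beat an error constant, yet it changes the function
  whose error is estimated. As it enters with a factor \<open>\<epsilon>\<close>, it spoils the
  bounds on the coefficients by a fixed amount at most, provided \<open>\<epsilon>\<close> is small
  in terms of the barrier. So the error constant comes before the exponent, the exponent before the
  size of the barrier, and the threshold for \<open>\<epsilon>\<close> last. The gain comes from the
  Hessian of a power of the gauge: its rank-one part is quadratic in the exponent, while the
  gradient is only linear in it. The Laplacian in the operator makes this part count even where the
  gradients of \<open>U\<close> and of the barrier are orthogonal.\<close>

definition spow :: "real \<Rightarrow> real \<Rightarrow> real" where
  "spow p t = t * \<bar>t\<bar> powr (p - 2)"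

lemma spow_eq: "spow p t = sgn t * \<bar>t\<bar> powr (p - 1)"
proof (cases "t = 0")
  case False
  have "\<bar>t\<bar> powr (p - 1) = \<bar>t\<bar> powr (p - 2 + 1)" by simp
  also have "\<dots> = \<bar>t\<bar> powr (p - 2) * \<bar>t\<bar>" using False by (subst powr_add) simp
  finally show ?thesis by (simp add: spow_def sgn_if)
qed (simp add: spow_def)

lemma spow_minus [simp]: "spow p (- t) = - spow p t"
  by (simp add: spow_def)

lemma spow_0 [simp]: "spow p 0 = 0"
  by (simp add: spow_def)

lemma abs_spow: "\<bar>spow p t\<bar> = \<bar>t\<bar> powr (p - 1)"
  by (cases "t = 0") (simp_all add: spow_eq abs_mult)

lemma spow_mult: "c > 0 \<Longrightarrow> spow p (c * t) = c powr (p - 1) * spow p t"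
  by (simp add: spow_eq sgn_mult abs_mult powr_mult)

lemma spow_strict_mono:
  assumes "p > 1" "s < t"
  shows "spow p s < spow p t"
proof -
  consider "0 \<le> s" | "s < 0" "0 < t" | "t \<le> 0" by linarith
  then show ?thesis
  proof cases
    case 1
    then show ?thesis using assms
      by (simp add: spow_eq sgn_if powr_less_mono2)
  next
    case 2
    then show ?thesis by (simp add: spow_eq) (smt (verit) powr_gt_zero)
  next
    case 3
    then show ?thesis using assms
      by (auto simp: spow_eq sgn_if powr_less_mono2)
  qed
qed

lemma spow_mono: "p > 1 \<Longrightarrow> s \<le> t \<Longrightarrow> spow p s \<le> spow p t"
  using spow_strict_mono[of p s t] by (cases "s = t") auto

lemma DERIV_abs_powr:
  assumes "t \<noteq> 0"
  shows "((\<lambda>t::real. \<bar>t\<bar> powr a) has_real_derivative a * \<bar>t\<bar> powr (a - 1) * sgn t) (at t)"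
proof -
  have "((\<lambda>t::real. \<bar>t\<bar>) has_real_derivative sgn t) (at t)"
  proof (cases "t > 0")
    case True
    have "((\<lambda>t::real. t) has_real_derivative sgn t) (at t)" using True by simp
    then show ?thesis
      by (rule has_field_derivative_transform_within_open[of _ _ _ "{0<..}"]) (use True in auto)
  next
    case False
    have "((\<lambda>t::real. - t) has_real_derivative sgn t) (at t)"
      using False assms by (auto intro!: derivative_eq_intros)
    then show ?thesis
      by (rule has_field_derivative_transform_within_open[of _ _ _ "{..<0}"]) (use False assms in auto)
  qed
  from DERIV_chain2[OF has_real_derivative_powr[of "\<bar>t\<bar>" a] this]
  show ?thesis using assms by simp
qed

lemma DERIV_abs_powr_0:
  assumes "a > 1"
  shows "((\<lambda>t::real. \<bar>t\<bar> powr a) has_real_derivative 0) (at 0)"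
proof -
  have "((\<lambda>h::real. \<bar>h\<bar> powr (a - 1)) \<longlongrightarrow> 0) (at 0)"
    using assms by (auto intro!: tendsto_eq_intros)
  then have "((\<lambda>h::real. \<bar>\<bar>h\<bar> powr a / h\<bar>) \<longlongrightarrow> 0) (at 0)"
  proof (rule tendsto_cong[THEN iffD1, rotated], intro eventually_at_filter[THEN iffD2] always_eventually allI impI)
    fix h :: real assume "h \<noteq> 0"
    then show "\<bar>h\<bar> powr (a - 1) = \<bar>\<bar>h\<bar> powr a / h\<bar>"
      by (simp add: powr_diff)
  qed
  then have "((\<lambda>h::real. \<bar>h\<bar> powr a / h) \<longlongrightarrow> 0) (at 0)"
    by (rule tendsto_rabs_zero_cancel)
  then show ?thesis by (simp add: DERIV_def)
qed

lemma DERIV_abs_powr_spow: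
  assumes "p > 1"
  shows "((\<lambda>t. \<bar>t\<bar> powr p) has_real_derivative p * spow p t) (at t)"
proof (cases "t = 0")
  case True
  then show ?thesis using DERIV_abs_powr_0[OF assms] by simp
next
  case False
  then show ?thesis using DERIV_abs_powr[OF False, of p] by (simp add: spow_eq mult_ac)
qed

lemma DERIV_spow:
  assumes "p > 2"
  shows "(spow p has_real_derivative (p - 1) * \<bar>t\<bar> powr (p - 2)) (at t)"
proof (cases "t = 0")
  case True
  have "((\<lambda>h::real. \<bar>h\<bar> powr (p - 2)) \<longlongrightarrow> 0) (at 0)"
    using assms by (auto intro!: tendsto_eq_intros)
  then have "((\<lambda>h::real. spow p h / h) \<longlongrightarrow> 0) (at 0)"
  proof (rule tendsto_cong[THEN iffD1, rotated], intro eventually_at_filter[THEN iffD2] always_eventually allI impI)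
    fix h :: real assume "h \<noteq> 0"
    then show "\<bar>h\<bar> powr (p - 2) = spow p h / h" by (simp add: spow_def)
  qed
  then show ?thesis using assms True by (simp add: DERIV_def)
next
  case False
  have "((\<lambda>t. t * \<bar>t\<bar> powr (p - 2)) has_real_derivative
      1 * \<bar>t\<bar> powr (p - 2) + (p - 2) * \<bar>t\<bar> powr (p - 2 - 1) * sgn t * t) (at t)"
    by (rule DERIV_mult[OF DERIV_ident DERIV_abs_powr[OF False]])
  moreover have "\<bar>t\<bar> powr (p - 2 - 1) * sgn t * t = \<bar>t\<bar> powr (p - 2)"
    using False by (subst powr_diff) (simp add: sgn_if)
  ultimately show ?thesis
    unfolding spow_def[abs_def] by (simp only: mult.assoc) (simp add: algebra_simps)
qed

lemma continuous_on_spow [continuous_intros]: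
  assumes "p > 2" "continuous_on S f"
  shows "continuous_on S (\<lambda>x. spow p (f x))"
  by (rule continuous_on_compose2[OF DERIV_continuous_on[OF DERIV_spow[OF assms(1), THEN DERIV_subset]] assms(2)]) auto

text \<open>Strict convexity in tangent form, from the mean value theorem and the strict
  monotonicity of \<open>spow\<close>. Integrated over a ball it shows that a root of the
  Euler-Lagrange equation is a strict minimizer.\<close>

lemma abs_powr_tangent:
  assumes "p > 1" "s \<noteq> t"
  shows "\<bar>s\<bar> powr p + p * spow p s * (t - s) < \<bar>t\<bar> powr p"
proof (cases "s < t")
  case True
  obtain z where z: "s < z" "z < t" "\<bar>t\<bar> powr p - \<bar>s\<bar> powr p = (t - s) * (p * spow p z)"
    using MVT2[OF True DERIV_abs_powr_spow[OF assms(1)]] by blast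
  then have "(t - s) * (p * spow p s) < (t - s) * (p * spow p z)"
    using True assms spow_strict_mono[of p s z] by simp
  then show ?thesis using z by (simp add: algebra_simps)
next
  case False
  then have st: "t < s" using assms by simp
  obtain z where z: "t < z" "z < s" "\<bar>s\<bar> powr p - \<bar>t\<bar> powr p = (s - t) * (p * spow p z)"
    using MVT2[OF st DERIV_abs_powr_spow[OF assms(1)]] by blast
  then have "(s - t) * (p * spow p z) < (s - t) * (p * spow p s)"
    using st assms spow_strict_mono[of p z s] by simp
  then show ?thesis using z by (simp add: algebra_simps)
qed

text \<open>Trades the exponent \<open>p - 3\<close> for \<open>min (p - 3) 0\<close> on bounded
  arguments, so that \<open>p < 3\<close> and \<open>p \<ge> 3\<close> are treated together.\<close>

lemma powr_le_min_exponent: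
  fixes x D a g :: real
  assumes "0 < x" "x \<le> D" "1 \<le> D" "g \<le> a"
  shows "x powr a \<le> D powr (a - g) * x powr g"
proof -
  have "x powr a = x powr (a - g) * x powr g" using assms by (simp flip: powr_add)
  also have "\<dots> \<le> D powr (a - g) * x powr g"
    using assms by (intro mult_right_mono powr_mono2) auto
  finally show ?thesis .
qed

text \<open>For \<open>p < 3\<close> the second derivative of \<^term>\<open>spow p\<close> is singular, but still integrable, at the origin;
  hence the exponent \<^term>\<open>min (p - 3) 0\<close>.\<close>

lemma spow_taylor:
  assumes p: "p > 2" and D: "D \<ge> 1"
  obtains C where "C > 0"
    "\<And>A e. A \<noteq> 0 \<Longrightarrow> \<bar>A\<bar> \<le> D \<Longrightarrow> \<bar>e\<bar> \<le> D \<Longrightarrow>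
      \<bar>spow p (A + e) - spow p A - (p - 1) * \<bar>A\<bar> powr (p - 2) * e\<bar> \<le> C * e\<^sup>2 * \<bar>A\<bar> powr min (p - 3) 0"
proof -
  define g where "g = min (p - 3) 0"
  \<comment> \<open>\<open>E\<close> is the price of lowering the exponent \<open>p - 3\<close> to
    \<open>g\<close> on arguments up to \<open>2 * D\<close>. The factor \<open>(1/2) powr g\<close>
    below comes from arguments that are at least \<open>\<bar>A\<bar> / 2\<close>. \<open>C1\<close>
    and \<open>C2\<close> serve the two cases of a small and a large increment.\<close>
  define E where "E = (2 * D) powr (p - 3 - g)"
  define C1 where "C1 = (p - 1) * (p - 2) * E * (1/2) powr g"
  define C2 where "C2 = (3 powr (p - 1) + 2 powr (p - 1) + (p - 1) * 2 powr (p - 2)) * E * (1/2) powr g"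
  have g: "g \<le> 0" "g \<le> p - 3" by (auto simp: g_def)
  have E: "E > 0" using D by (simp add: E_def)
  have C1: "C1 > 0" using p E by (simp add: C1_def)
  have C2: "C2 > 0" using p E by (simp add: C2_def add_pos_pos)
  have "\<bar>spow p (A + e) - spow p A - (p - 1) * \<bar>A\<bar> powr (p - 2) * e\<bar> \<le> (C1 + C2) * e\<^sup>2 * \<bar>A\<bar> powr g"
    if A0: "A \<noteq> 0" and A: "\<bar>A\<bar> \<le> D" and e: "\<bar>e\<bar> \<le> D" for A e
  \<comment> \<open>For a small increment the segment from \<open>A\<close> to \<open>A + e\<close>
    stays away from 0 and Taylor's formula of order two applies. Otherwise each of the three terms
    is of order \<open>\<bar>e\<bar> powr (p - 1)\<close>, that is,
    \<open>e\<^sup>2 * \<bar>e\<bar> powr (p - 3)\<close>, and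
    \<open>\<bar>A\<bar> < 2 * \<bar>e\<bar>\<close> turns the last factor into a power of
    \<open>\<bar>A\<bar>\<close> because \<open>g \<le> 0\<close>.\<close>
  proof (cases "2 * \<bar>e\<bar> \<le> \<bar>A\<bar>")
    case True
    have der: "\<bar>spow p (A + e) - spow p A - (p - 1) * \<bar>A\<bar> powr (p - 2) * e\<bar> \<le> C1 * \<bar>A\<bar> powr g * e\<^sup>2"
    proof (cases "e = 0")
      case False
      define f where "f = (\<lambda>s. spow p (A + s * e))"
      have nz: "\<bar>A + s * e\<bar> \<ge> \<bar>A\<bar> / 2" "\<bar>A + s * e\<bar> \<le> 2 * D" if "0 \<le> s" "s \<le> 1" for s
      proof -
        have "\<bar>s * e\<bar> \<le> 1 * \<bar>e\<bar>" using that unfolding abs_mult by (intro mult_right_mono) auto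
        then show "\<bar>A + s * e\<bar> \<ge> \<bar>A\<bar> / 2" "\<bar>A + s * e\<bar> \<le> 2 * D" using True A by linarith+
      qed
      define d1 where "d1 = (\<lambda>s. (p - 1) * \<bar>A + s * e\<bar> powr (p - 2) * e)"
      define d2 where "d2 = (\<lambda>s. (p - 1) * ((p - 2) * \<bar>A + s * e\<bar> powr (p - 3) * sgn (A + s * e)) * e * e)"
      have D1: "(f has_real_derivative d1 s) (at s)" for s
      proof -
        have "((\<lambda>s. A + s * e) has_real_derivative e) (at s)" by (auto intro!: derivative_eq_intros)
        from DERIV_chain2[OF DERIV_spow[OF p] this] show ?thesis unfolding f_def d1_def .
      qed
      have D2: "(d1 has_real_derivative d2 s) (at s)" if "0 \<le> s" "s \<le> 1" for s
      proof -
        have "((\<lambda>s. A + s * e) has_real_derivative e) (at s)" by (auto intro!: derivative_eq_intros)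
        moreover have "A + s * e \<noteq> 0" using nz(1)[OF that] A0 by auto
        ultimately have "((\<lambda>s. \<bar>A + s * e\<bar> powr (p - 2)) has_real_derivative
            (p - 2) * \<bar>A + s * e\<bar> powr (p - 2 - 1) * sgn (A + s * e) * e) (at s)"
          using DERIV_chain2[where f = "\<lambda>t. \<bar>t\<bar> powr (p - 2)" and g = "\<lambda>s. A + s * e" and x = s,
              OF DERIV_abs_powr] by blast
        from DERIV_cmult_right[OF DERIV_cmult[OF this, of "p - 1"], of e]
        show ?thesis unfolding d1_def d2_def by (simp add: mult_ac)
      qed
      obtain s where s: "0 < s" "s < 1" "f 1 = (\<Sum>m<2. (if m = 0 then f 0 else d1 0) / fact m * 1 ^ m) + d2 s / fact 2 * 1 ^ 2"
      proof -
        have "\<exists>s>0. s < 1 \<and> f 1 = (\<Sum>m<2. (\<lambda>m::nat. if m = 0 then f else if m = 1 then d1 else d2) m 0 / fact m * 1 ^ m)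
            + (\<lambda>m::nat. if m = 0 then f else if m = 1 then d1 else d2) 2 s / fact 2 * 1 ^ 2"
        proof (rule Maclaurin)
          show "\<forall>m t. m < 2 \<and> 0 \<le> t \<and> t \<le> 1 \<longrightarrow>
             ((if m = 0 then f else if m = 1 then d1 else d2) has_real_derivative
              (if Suc m = 0 then f else if Suc m = 1 then d1 else d2) t) (at t)"
            using D1 D2 by (auto simp: less_2_cases_iff)
        qed auto
        then show ?thesis using that by (auto simp: numeral_2_eq_2)
      qed
      then have "f 1 - f 0 - d1 0 = d2 s / 2" by (simp add: numeral_2_eq_2)
      moreover have "\<bar>d2 s\<bar> \<le> C1 * \<bar>A\<bar> powr g * e\<^sup>2"
      proof -
        have n: "\<bar>A + s * e\<bar> \<ge> \<bar>A\<bar> / 2" "\<bar>A + s * e\<bar> \<le> 2 * D" using nz[of s] s by auto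
        then have pos: "0 < \<bar>A + s * e\<bar>" using A0 by linarith
        have "\<bar>A + s * e\<bar> powr (p - 3) \<le> E * \<bar>A + s * e\<bar> powr g"
          unfolding E_def using pos n g D by (intro powr_le_min_exponent) auto
        also have "\<bar>A + s * e\<bar> powr g \<le> (\<bar>A\<bar> / 2) powr g"
          using n g A0 by (intro powr_mono2') auto
        also have "(\<bar>A\<bar> / 2) powr g = (1/2) powr g * \<bar>A\<bar> powr g"
          by (subst powr_mult[symmetric]) auto
        finally have "\<bar>A + s * e\<bar> powr (p - 3) \<le> E * ((1/2) powr g * \<bar>A\<bar> powr g)"
          using E by simp
        then have "(p - 1) * (p - 2) * e\<^sup>2 * \<bar>A + s * e\<bar> powr (p - 3) \<le> (p - 1) * (p - 2) * e\<^sup>2 * (E * ((1/2) powr g * \<bar>A\<bar> powr g))"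
          using p by (intro mult_left_mono) auto
        moreover have "\<bar>d2 s\<bar> = (p - 1) * (p - 2) * e\<^sup>2 * \<bar>A + s * e\<bar> powr (p - 3)"
          using pos p by (simp add: d2_def abs_mult abs_sgn_eq power2_eq_square)
        ultimately show ?thesis by (simp add: C1_def mult_ac)
      qed
      ultimately have "\<bar>f 1 - f 0 - d1 0\<bar> \<le> C1 * \<bar>A\<bar> powr g * e\<^sup>2"
        by simp
      then show ?thesis by (simp add: f_def d1_def)
    qed (use C1 in simp)
    also have "\<dots> \<le> (C1 + C2) * e\<^sup>2 * \<bar>A\<bar> powr g"
      using C2 by (simp add: algebra_simps)
    finally show ?thesis .
  next
    case False
    then have e0: "\<bar>e\<bar> > 0" and Ae: "\<bar>A\<bar> < 2 * \<bar>e\<bar>" by auto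
    have 1: "\<bar>spow p (A + e)\<bar> \<le> 3 powr (p - 1) * \<bar>e\<bar> powr (p - 1)"
      unfolding abs_spow using Ae p
      by (subst powr_mult[symmetric]) (auto intro!: powr_mono2)
    have 2: "\<bar>spow p A\<bar> \<le> 2 powr (p - 1) * \<bar>e\<bar> powr (p - 1)"
      unfolding abs_spow using Ae p
      by (subst powr_mult[symmetric]) (auto intro!: powr_mono2)
    have "\<bar>A\<bar> powr (p - 2) \<le> 2 powr (p - 2) * \<bar>e\<bar> powr (p - 2)"
      using Ae p by (subst powr_mult[symmetric]) (auto intro!: powr_mono2)
    then have "(p - 1) * \<bar>A\<bar> powr (p - 2) * \<bar>e\<bar> \<le> (p - 1) * (2 powr (p - 2) * \<bar>e\<bar> powr (p - 2)) * \<bar>e\<bar>"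
      using p by (intro mult_right_mono mult_left_mono) auto
    also have "\<bar>e\<bar> powr (p - 1) = \<bar>e\<bar> powr (p - 2 + 1)" by simp
    then have "(p - 1) * (2 powr (p - 2) * \<bar>e\<bar> powr (p - 2)) * \<bar>e\<bar> = (p - 1) * 2 powr (p - 2) * \<bar>e\<bar> powr (p - 1)"
      using e0 by (simp only: powr_add) simp
    finally have 3: "\<bar>(p - 1) * \<bar>A\<bar> powr (p - 2) * e\<bar> \<le> (p - 1) * 2 powr (p - 2) * \<bar>e\<bar> powr (p - 1)"
      using p by (simp add: abs_mult)
    have "\<bar>e\<bar> powr (p - 3) \<le> E * \<bar>e\<bar> powr g"
      unfolding E_def using e0 e g D by (intro powr_le_min_exponent) auto
    also have "\<bar>e\<bar> powr g \<le> (\<bar>A\<bar> / 2) powr g"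
      using Ae g A0 by (intro powr_mono2') auto
    also have "(\<bar>A\<bar> / 2) powr g = (1/2) powr g * \<bar>A\<bar> powr g"
      by (subst powr_mult[symmetric]) auto
    finally have "\<bar>e\<bar> powr (p - 3) \<le> E * ((1/2) powr g * \<bar>A\<bar> powr g)" using E by simp
    moreover have "\<bar>e\<bar> powr (p - 1) = e\<^sup>2 * \<bar>e\<bar> powr (p - 3)"
    proof -
      have "\<bar>e\<bar> powr (p - 1) = \<bar>e\<bar> powr (2 + (p - 3))" by simp
      also have "\<dots> = \<bar>e\<bar> powr 2 * \<bar>e\<bar> powr (p - 3)" by (rule powr_add)
      finally show ?thesis using e0 by simp
    qed
    ultimately have 4: "\<bar>e\<bar> powr (p - 1) \<le> e\<^sup>2 * (E * ((1/2) powr g * \<bar>A\<bar> powr g))"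
      by (simp add: mult_left_mono)
    have "\<bar>spow p (A + e) - spow p A - (p - 1) * \<bar>A\<bar> powr (p - 2) * e\<bar>
        \<le> (3 powr (p - 1) + 2 powr (p - 1) + (p - 1) * 2 powr (p - 2)) * \<bar>e\<bar> powr (p - 1)"
      using 1 2 3 unfolding distrib_right by linarith
    also have "\<dots> \<le> (3 powr (p - 1) + 2 powr (p - 1) + (p - 1) * 2 powr (p - 2)) * (e\<^sup>2 * (E * ((1/2) powr g * \<bar>A\<bar> powr g)))"
      using p by (intro mult_left_mono[OF 4]) auto
    also have "\<dots> = C2 * e\<^sup>2 * \<bar>A\<bar> powr g" by (simp add: C2_def mult_ac)
    also have "\<dots> \<le> (C1 + C2) * e\<^sup>2 * \<bar>A\<bar> powr g" using C1 by (simp add: algebra_simps)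
    finally show ?thesis .
  qed
  then show ?thesis using that[of "C1 + C2"] C1 C2 by (auto simp: g_def)
qed

section \<open>Integration over the unit gauge ball\<close>

lemma absolutely_integrable_continuous_compact:
  fixes f :: "'a::euclidean_space \<Rightarrow> 'b::euclidean_space"
  assumes "compact S" "continuous_on S f"
  shows "f absolutely_integrable_on S"
  unfolding set_integrable_def
  using borel_integrable_compact[OF assms] by (simp add: integrable_completion)

lemma integrable_continuous_compact:
  fixes f :: "'a::euclidean_space \<Rightarrow> 'b::euclidean_space"
  assumes "compact S" "continuous_on S f"
  shows "f integrable_on S"
  using absolutely_integrable_continuous_compact[OF assms] set_lebesgue_integral_eq_integral(1) by blast

lemma integral_change_of_variables_affine:
  fixes f :: "real^'n::{finite,wellorder} \<Rightarrow> real" and L :: "real^'n::_ \<Rightarrow> real^'n::_"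
  assumes S: "compact S" and L: "linear L" "inj L"
    and f: "(\<lambda>z. f (c + L z)) absolutely_integrable_on S"
  shows "f absolutely_integrable_on ((\<lambda>z. c + L z) ` S)"
    and "integral ((\<lambda>z. c + L z) ` S) f = \<bar>det (matrix L)\<bar> * integral S (\<lambda>z. f (c + L z))"
proof -
  let ?g = "\<lambda>z. c + L z"
  \<comment> \<open>The change of variables theorem is applied to vector-valued functions, so
    \<open>f\<close> is carried into \<open>real^1\<close> and its only component is read off at the
    end.\<close>
  let ?f = "\<lambda>y. f y *\<^sub>R (1 :: real^1)"
  have "(\<lambda>z. \<bar>det (matrix L)\<bar> *\<^sub>R ?f (?g z)) absolutely_integrable_on S \<and>
        integral S (\<lambda>z. \<bar>det (matrix L)\<bar> *\<^sub>R ?f (?g z)) = integral S (\<lambda>z. \<bar>det (matrix L)\<bar> *\<^sub>R ?f (?g z))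
    \<longleftrightarrow> ?f absolutely_integrable_on (?g ` S) \<and> integral (?g ` S) ?f = integral S (\<lambda>z. \<bar>det (matrix L)\<bar> *\<^sub>R ?f (?g z))"
  proof (rule has_absolute_integral_change_of_variables_compact[OF S])
    show "((\<lambda>z. c + L z) has_derivative L) (at x within S)" for x
      using L(1) by (auto intro!: derivative_eq_intros linear_imp_has_derivative)
    show "inj_on (\<lambda>z. c + L z) S"
      using L(2) by (auto simp: inj_on_def)
  qed
  moreover have fi: "(\<lambda>z. \<bar>det (matrix L)\<bar> *\<^sub>R ?f (?g z)) absolutely_integrable_on S"
    using f by (intro set_integrable_scaleR_right set_integrable_scaleR_left)
  ultimately have *: "?f absolutely_integrable_on (?g ` S)"
    "integral (?g ` S) ?f = integral S (\<lambda>z. \<bar>det (matrix L)\<bar> *\<^sub>R ?f (?g z))" by auto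
  from absolutely_integrable_linear[OF *(1) bounded_linear_vec_nth[of 1]]
  show "f absolutely_integrable_on (?g ` S)" by (simp add: o_def)
  have "integral (?g ` S) f = integral (?g ` S) ?f $ 1"
    using set_lebesgue_integral_eq_integral(1)[OF *(1)]
    by (subst integral_component_eq_cart[symmetric]) simp_all
  also have "\<dots> = integral S (\<lambda>z. \<bar>det (matrix L)\<bar> * f (?g z))"
    unfolding *(2) using set_lebesgue_integral_eq_integral(1)[OF fi]
    by (subst integral_component_eq_cart[symmetric]) simp_all
  finally show "integral (?g ` S) f = \<bar>det (matrix L)\<bar> * integral S (\<lambda>z. f (?g z))" by simp
qed

section \<open>The closed unit gauge ball and its symmetries\<close>

definition korb :: "heis set" where
  "korb = {z. ((z$1)\<^sup>2 + (z$2)\<^sup>2)\<^sup>2 + 16 * (z$3)\<^sup>2 \<le> 1}"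

lemma korb_bounds:
  assumes "z \<in> korb"
  shows "(z$1)\<^sup>2 + (z$2)\<^sup>2 \<le> 1" "\<bar>z$1\<bar> \<le> 1" "\<bar>z$2\<bar> \<le> 1" "\<bar>z$3\<bar> \<le> 1"
proof -
  have k: "((z$1)\<^sup>2 + (z$2)\<^sup>2)\<^sup>2 + 16 * (z$3)\<^sup>2 \<le> 1" using assms by (simp add: korb_def)
  have "((z$1)\<^sup>2 + (z$2)\<^sup>2)\<^sup>2 \<le> 1\<^sup>2" using k zero_le_power2[of "z$3"] unfolding one_power2 by linarith
  then show 1: "(z$1)\<^sup>2 + (z$2)\<^sup>2 \<le> 1" by (rule power2_le_imp_le) simp
  have "(z$1)\<^sup>2 \<le> 1" "(z$2)\<^sup>2 \<le> 1" using 1 zero_le_power2[of "z$1"] zero_le_power2[of "z$2"] by linarith+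
  then show "\<bar>z$1\<bar> \<le> 1" "\<bar>z$2\<bar> \<le> 1" by (simp_all add: abs_square_le_1)
  have "(z$3)\<^sup>2 \<le> 1" using k zero_le_power2[of "(z$1)\<^sup>2 + (z$2)\<^sup>2"] by linarith
  then show "\<bar>z$3\<bar> \<le> 1" by (simp add: abs_square_le_1)
qed

lemma compact_korb: "compact korb"
proof -
  have "closed korb" unfolding korb_def
    by (intro closed_Collect_le continuous_intros)
  moreover have "bounded korb"
  proof (rule bounded_subset[OF bounded_cbox])
    show "korb \<subseteq> cbox (-1) 1"
      using korb_bounds by (auto simp: mem_box_cart forall_3 abs_le_iff)
  qed
  ultimately show ?thesis by (simp add: compact_eq_bounded_closed)
qed

text \<open>For \<open>c\<^sup>2 + s\<^sup>2 = 1\<close> and signs \<open>\<sigma>\<close>,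
  \<open>\<tau>\<close>: an orthogonal map of the horizontal plane together with a sign on the
  vertical coordinate. Only the gauge and the volume have to be preserved, not the group law, so the
  two signs are independent. The family contains both the rotations and the reflections used
  below.\<close>

definition kmap :: "real \<Rightarrow> real \<Rightarrow> real \<Rightarrow> real \<Rightarrow> heis \<Rightarrow> heis" where
  "kmap c s \<sigma> \<tau> z = vector [c * z$1 - \<sigma> * s * z$2, s * z$1 + \<sigma> * c * z$2, \<tau> * z$3]"

lemma kmap_nth [simp]:
  "kmap c s \<sigma> \<tau> z $ 1 = c * z$1 - \<sigma> * s * z$2"
  "kmap c s \<sigma> \<tau> z $ 2 = s * z$1 + \<sigma> * c * z$2"
  "kmap c s \<sigma> \<tau> z $ 3 = \<tau> * z$3"
  by (simp_all add: kmap_def)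

lemma linear_kmap: "linear (kmap c s \<sigma> \<tau>)"
  by (rule linearI) (simp_all add: vec_eq_iff forall_3 algebra_simps)

context
  fixes c s \<sigma> \<tau> :: real
  assumes unit: "c\<^sup>2 + s\<^sup>2 = 1" "\<sigma>\<^sup>2 = 1" "\<tau>\<^sup>2 = 1"
begin

lemma kmap_inverse: "kmap c s \<sigma> \<tau> (kmap c (- \<sigma> * s) \<sigma> \<tau> z) = z" "kmap c (- \<sigma> * s) \<sigma> \<tau> (kmap c s \<sigma> \<tau> z) = z"
  using unit by (simp_all add: vec_eq_iff forall_3) algebra+

lemma kmap_in_korb: "kmap c s \<sigma> \<tau> z \<in> korb \<longleftrightarrow> z \<in> korb"
proof -
  have "(c * z$1 - \<sigma> * s * z$2)\<^sup>2 + (s * z$1 + \<sigma> * c * z$2)\<^sup>2 = (z$1)\<^sup>2 + (z$2)\<^sup>2"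
    "(\<tau> * z$3)\<^sup>2 = (z$3)\<^sup>2"
    using unit by algebra+
  then show ?thesis by (simp add: korb_def)
qed

lemma kmap_image_korb: "kmap c s \<sigma> \<tau> ` korb = korb"
proof -
  have "x \<in> kmap c s \<sigma> \<tau> ` korb" if "x \<in> korb" for x
    using that kmap_inverse(1)[of x] kmap_in_korb by (metis imageI)
  then show ?thesis using kmap_in_korb by blast
qed

lemma abs_det_kmap: "\<bar>det (matrix (kmap c s \<sigma> \<tau>))\<bar> = 1"
proof -
  have "det (matrix (kmap c s \<sigma> \<tau>)) = c * (\<sigma> * c) * \<tau> + \<sigma> * s * s * \<tau>"
    by (simp add: det_3 matrix_def axis_def)
  also have "\<dots> = \<sigma> * \<tau> * (c\<^sup>2 + s\<^sup>2)" by algebra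
  finally have "det (matrix (kmap c s \<sigma> \<tau>)) = \<sigma> * \<tau>" using unit by simp
  moreover have "(\<sigma> * \<tau>)\<^sup>2 = 1" using unit by (simp add: power_mult_distrib)
  ultimately show ?thesis by (auto simp: power2_eq_1_iff)
qed

lemma integral_korb_kmap:
  fixes f :: "heis \<Rightarrow> real"
  assumes "(\<lambda>z. f (kmap c s \<sigma> \<tau> z)) absolutely_integrable_on korb"
  shows "f absolutely_integrable_on korb"
    "integral korb f = integral korb (\<lambda>z. f (kmap c s \<sigma> \<tau> z))"
proof -
  have "inj (kmap c s \<sigma> \<tau>)" using kmap_inverse(2) by (metis injI)
  from integral_change_of_variables_affine[OF compact_korb linear_kmap this, of f 0] assms
  show "f absolutely_integrable_on korb"
    "integral korb f = integral korb (\<lambda>z. f (kmap c s \<sigma> \<tau> z))"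
    by (simp_all add: kmap_image_korb abs_det_kmap)
qed

text \<open>The change of variables turns the integral into its own negative. It is used for the
  reflections in \<open>z$2\<close> and in \<open>z$3\<close> and for the half turn of the
  horizontal plane.\<close>

lemma integral_korb_odd:
  fixes f :: "heis \<Rightarrow> real"
  assumes "continuous_on korb f" "\<And>z. f (kmap c s \<sigma> \<tau> z) = - f z"
  shows "integral korb f = 0"
proof -
  have "(\<lambda>z. - f z) absolutely_integrable_on korb"
    using assms compact_korb by (intro absolutely_integrable_continuous_compact continuous_intros)
  then have "integral korb f = - integral korb f"
    using integral_korb_kmap(2)[of f] by (simp add: assms(2))
  then show ?thesis by simp
qed

end

text \<open>The ball lies in the cube with sides from -1 to 1, over which the integral factors by
  Tonelli; the only factor that is not a length is the integral of
  \<open>\<bar>u\<bar> powr g\<close>, finite for \<open>g > -1\<close>. This covers the singular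
  weight of \<open>spow_taylor\<close>.\<close>

lemma absolutely_integrable_abs_powr_korb:
  assumes "g > -1"
  shows "(\<lambda>z. \<bar>z$1\<bar> powr g) absolutely_integrable_on korb"
proof -
  define f where "f = (\<lambda>(b::heis) (u::real). ennreal (indicator {-1..1} u * (if b = axis 1 1 then \<bar>u\<bar> powr g else 1)))"
  have i1: "(\<lambda>u::real. \<bar>u\<bar> powr g) absolutely_integrable_on {-1..1}"
  proof -
    have 1: "(\<lambda>u::real. u powr g) integrable_on {0..1}"
      using has_integral_powr_from_0[OF assms, of 1] by auto
    then have "(\<lambda>u::real. \<bar>u\<bar> powr g) integrable_on {0..1}"
      by (rule integrable_eq) auto
    moreover have "(\<lambda>u::real. \<bar>u\<bar> powr g) integrable_on {-1..0}"
      using Henstock_Kurzweil_Integration.integrable_reflect_real[THEN iffD2, OF calculation]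
      by (simp only: abs_minus_cancel minus_zero)
    ultimately have "(\<lambda>u::real. \<bar>u\<bar> powr g) integrable_on {-1..1}"
      by (intro Henstock_Kurzweil_Integration.integrable_combine[where a = "-1" and c = 0 and b = 1]) auto
    then show ?thesis by (intro nonnegative_absolutely_integrable_1) auto
  qed
  have fin: "(\<integral>\<^sup>+u. f b u \<partial>lborel) < \<infinity>" for b
  proof (cases "b = axis 1 1")
    case True
    have "integrable lebesgue (\<lambda>u. indicator {-1..1} u * \<bar>u\<bar> powr g :: real)"
      using i1 by (simp add: set_integrable_def)
    then have "integrable lborel (\<lambda>u. indicator {-1..1} u * \<bar>u\<bar> powr g :: real)"
      by (subst (asm) integrable_completion) auto
    then show ?thesis using True
      by (simp add: f_def integrable_iff_bounded)
  next
    case False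
    then have "f b = indicator {-1..1}"
      by (auto simp: f_def fun_eq_iff indicator_def)
    then show ?thesis by simp
  qed
  have prod: "ennreal (indicator korb z * \<bar>z$1\<bar> powr g) \<le> (\<Prod>b\<in>Basis. f b (z \<bullet> b))" for z
  proof (cases "z \<in> korb")
    case True
    have B: "(Basis :: heis set) = {axis 1 1, axis 2 1, axis 3 1}"
      by (auto simp: Basis_vec_def exhaust_3 UNIV_3)
    show ?thesis using korb_bounds[OF True] True
      by (simp add: B f_def axis_eq_axis inner_axis abs_le_iff)
  qed simp
  have "(\<integral>\<^sup>+z. ennreal (indicator korb z * \<bar>z$1\<bar> powr g) \<partial>lborel) \<le> (\<integral>\<^sup>+z. (\<Prod>b\<in>Basis. f b (z \<bullet> b)) \<partial>lborel)"
    by (intro nn_integral_mono prod)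
  also have "\<dots> = (\<Prod>b\<in>Basis. (\<integral>\<^sup>+u. f b u \<partial>lborel))"
    by (intro nn_integral_lborel_prod) (auto simp: f_def)
  also have "\<dots> < \<infinity>"
  proof -
    have "(\<Prod>b\<in>Basis. (\<integral>\<^sup>+u. f b u \<partial>lborel)) \<noteq> top"
      using fin unfolding ennreal_prod_eq_top infinity_ennreal_def by (metis less_irrefl)
    then show ?thesis by (simp add: less_top)
  qed
  finally have "integrable lborel (\<lambda>z. indicator korb z * \<bar>z$1\<bar> powr g :: real)"
    using compact_korb[THEN compact_imp_closed, THEN borel_closed]
    by (simp add: integrable_iff_bounded)
  then show ?thesis
    unfolding set_integrable_def
    using compact_korb[THEN compact_imp_closed, THEN borel_closed]
    by (subst integrable_completion) (auto)
qed

section \<open>First moments of the signed power of a linear form\<close>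

lemma continuous_on_korb_integrable:
  fixes f :: "heis \<Rightarrow> real"
  assumes "continuous_on korb f"
  shows "f integrable_on korb" "f absolutely_integrable_on korb"
  using assms compact_korb by (auto intro: integrable_continuous_compact absolutely_integrable_continuous_compact)

lemma continuous_on_abs_powr [continuous_intros]:
  fixes f :: "'a::topological_space \<Rightarrow> real"
  assumes "a > 0" "continuous_on S f"
  shows "continuous_on S (\<lambda>x. \<bar>f x\<bar> powr a)"
  using assms by (intro continuous_on_powr' continuous_intros) auto

text \<open>The integral of \<open>\<bar>z$1\<bar> powr p\<close>, written in the form in which the
  rotation argument produces it.\<close>

definition kappa :: "real \<Rightarrow> real" where
  "kappa p = integral korb (\<lambda>z. spow p (z$1) * z$1)"

definition lin :: "real \<Rightarrow> real \<Rightarrow> heis \<Rightarrow> real" where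
  "lin a b z = a * z$1 + b * z$2"

lemma continuous_on_lin [continuous_intros]: "continuous_on S (lin a b)"
  unfolding lin_def[abs_def] by (intro continuous_intros)

text \<open>\<open>c\<close> and \<open>s\<close> are the cosine and sine of the angle of
  \<open>(a, b)\<close>. This reduces integrals of functions of \<open>lin a b\<close> to integrals
  in \<open>z$1\<close>.\<close>

lemma rotation_to_axis:
  assumes "(a, b) \<noteq> (0, 0)"
  obtains r c s where "r > 0" "r\<^sup>2 = a\<^sup>2 + b\<^sup>2" "c\<^sup>2 + s\<^sup>2 = 1" "a = r * c" "b = r * s"
    "\<And>z. lin a b (kmap c s 1 1 z) = r * z$1"
proof -
  define r where "r = sqrt (a\<^sup>2 + b\<^sup>2)"
  have r: "r > 0" "r\<^sup>2 = a\<^sup>2 + b\<^sup>2"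
    using assms by (auto simp: r_def sum_power2_gt_zero_iff)
  have u: "(a / r)\<^sup>2 + (b / r)\<^sup>2 = 1"
    using r(1) by (simp add: power_divide r(2)[symmetric] flip: add_divide_distrib)
  have "lin a b (kmap (a / r) (b / r) 1 1 z) = r * z$1" for z
  proof -
    have "a * (a / r) + b * (b / r) = r"
      using r by (simp add: power2_eq_square field_simps)
    moreover have "lin a b (kmap (a / r) (b / r) 1 1 z) = (a * (a / r) + b * (b / r)) * z$1"
      using r(1) by (simp add: lin_def field_simps)
    ultimately show ?thesis by simp
  qed
  then show ?thesis using that[of r "a / r" "b / r"] r u by simp
qed

text \<open>By rotation invariance, \<open>\<integral> spow p \<langle>a,z\<rangle> z\<^sub>i dz = \<kappa> \<bar>a\<bar>\<^sup>p\<^sup>-\<^sup>2 a\<^sub>i\<close>; differentiating this in \<open>a\<close> gives the second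
  moments, with the right ratio \<open>p - 1\<close> between the two directions.\<close>

lemma integral_spow_lin:
  assumes p: "p > 2" and ab: "(a, b) \<noteq> (0, 0)"
  shows "integral korb (\<lambda>z. spow p (lin a b z) * z$1) = kappa p * (a\<^sup>2 + b\<^sup>2) powr ((p - 2) / 2) * a"
    and "integral korb (\<lambda>z. spow p (lin a b z) * z$2) = kappa p * (a\<^sup>2 + b\<^sup>2) powr ((p - 2) / 2) * b"
proof -
  obtain r c s where r: "r > 0" "r\<^sup>2 = a\<^sup>2 + b\<^sup>2" "c\<^sup>2 + s\<^sup>2 = 1" "a = r * c" "b = r * s"
    "\<And>z. lin a b (kmap c s 1 1 z) = r * z$1"
    by (rule rotation_to_axis[OF ab]) (rule that, assumption+)
  have r2: "(a\<^sup>2 + b\<^sup>2) powr ((p - 2) / 2) = r powr (p - 2)"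
  proof -
    have "(a\<^sup>2 + b\<^sup>2) powr ((p - 2) / 2) = (r powr 2) powr ((p - 2) / 2)"
      using r(1) by (simp flip: r(2))
    also have "\<dots> = r powr (2 * ((p - 2) / 2))" by (rule powr_powr)
    also have "2 * ((p - 2) / 2) = p - 2" by simp
    finally show ?thesis .
  qed
  have r1: "r powr (p - 1) = r powr (p - 2) * r"
  proof -
    have "r powr (p - 1) = r powr (p - 2 + 1)" by simp
    then show ?thesis unfolding powr_add using r(1) by simp
  qed
  have 0: "integral korb (\<lambda>z. spow p (z$1) * z$2) = 0"
    using p by (intro integral_korb_odd[of 1 0 "-1" 1] continuous_intros) auto
  have cont: "continuous_on korb (\<lambda>z. spow p (z$1) * z$1)" "continuous_on korb (\<lambda>z. spow p (z$1) * z$2)"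
    using p by (auto intro!: continuous_intros)
  have "integral korb (\<lambda>z. spow p (lin a b z) * z$1)
      = integral korb (\<lambda>z. spow p (r * z$1) * (c * z$1 - s * z$2))"
    using p r(3) by (subst integral_korb_kmap(2)[of c s 1 1])
      (auto simp: r(6) intro!: continuous_on_korb_integrable(2) continuous_intros)
  also have "\<dots> = integral korb (\<lambda>z. r powr (p - 1) * c * (spow p (z$1) * z$1) - r powr (p - 1) * s * (spow p (z$1) * z$2))"
    by (simp add: spow_mult[OF r(1)] algebra_simps)
  also have "\<dots> = r powr (p - 1) * c * kappa p"
    using cont by (subst integral_diff) (simp_all add: continuous_on_korb_integrable integrable_on_mult_right 0 kappa_def)
  finally show "integral korb (\<lambda>z. spow p (lin a b z) * z$1) = kappa p * (a\<^sup>2 + b\<^sup>2) powr ((p - 2) / 2) * a"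
    unfolding r2 r1 by (simp add: r(4) mult_ac)
  have "integral korb (\<lambda>z. spow p (lin a b z) * z$2)
      = integral korb (\<lambda>z. spow p (r * z$1) * (s * z$1 + c * z$2))"
    using p r(3) by (subst integral_korb_kmap(2)[of c s 1 1])
      (auto simp: r(6) intro!: continuous_on_korb_integrable(2) continuous_intros)
  also have "\<dots> = integral korb (\<lambda>z. r powr (p - 1) * s * (spow p (z$1) * z$1) + r powr (p - 1) * c * (spow p (z$1) * z$2))"
    by (simp add: spow_mult[OF r(1)] algebra_simps)
  also have "\<dots> = r powr (p - 1) * s * kappa p"
    using cont by (subst integral_add) (simp_all add: continuous_on_korb_integrable integrable_on_mult_right 0 kappa_def)
  finally show "integral korb (\<lambda>z. spow p (lin a b z) * z$2) = kappa p * (a\<^sup>2 + b\<^sup>2) powr ((p - 2) / 2) * b"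
    unfolding r2 r1 by (simp add: r(5) mult_ac)
qed

text \<open>Mean value inequality with the derivative bounded on the segment. It supplies the
  dominating function for differentiation under the integral, and the continuity in \<open>l\<close>
  of the Euler-Lagrange integral.\<close>

lemma spow_lipschitz:
  assumes p: "p > 2"
  shows "\<bar>spow p (x + e) - spow p x\<bar> \<le> (p - 1) * (\<bar>x\<bar> + \<bar>e\<bar>) powr (p - 2) * \<bar>e\<bar>"
proof -
  have "norm (spow p (x + e) - spow p x) \<le> (p - 1) * (\<bar>x\<bar> + \<bar>e\<bar>) powr (p - 2) * norm (x + e - x)"
  proof (rule field_differentiable_bound[of "closed_segment x (x + e)"])
    fix z assume "z \<in> closed_segment x (x + e)"
    then have "\<bar>z\<bar> \<le> \<bar>x\<bar> + \<bar>e\<bar>" by (auto simp: closed_segment_eq_real_ivl split: if_splits)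
    then show "norm ((p - 1) * \<bar>z\<bar> powr (p - 2)) \<le> (p - 1) * (\<bar>x\<bar> + \<bar>e\<bar>) powr (p - 2)"
      using p by (auto simp: abs_mult intro!: powr_mono2)
  qed (auto intro: DERIV_spow[OF p] DERIV_subset)
  then show ?thesis by simp
qed

text \<open>The derivative of the integral is known to exist, so it only has to be identified, and
  the single sequence of increments \<open>1 / (k + 1)\<close> suffices. Dominated convergence then
  exchanges limit and integral.\<close>

lemma DERIV_integral_spow:
  fixes A \<beta> q :: "heis \<Rightarrow> real"
  assumes p: "p > 2" and A: "continuous_on korb A" and \<beta>: "continuous_on korb \<beta>" and q: "continuous_on korb q"
    and der: "((\<lambda>t. integral korb (\<lambda>z. spow p (A z + t * \<beta> z) * q z)) has_real_derivative D) (at 0)"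
  shows "integral korb (\<lambda>z. (p - 1) * \<bar>A z\<bar> powr (p - 2) * \<beta> z * q z) = D"
proof -
  define h where "h = (\<lambda>k. inverse (real (Suc k)))"
  have h: "h \<longlonglongrightarrow> 0" "h k \<noteq> 0" "0 < h k" "h k \<le> 1" for k
    using LIMSEQ_inverse_real_of_nat by (auto simp: h_def field_simps)
  define f where "f = (\<lambda>k z. (spow p (A z + h k * \<beta> z) - spow p (A z)) / h k * q z)"
  \<comment> \<open>The bound of \<open>spow_lipschitz\<close> divided by the increment, made
    independent of \<open>k\<close> by \<open>h k \<le> 1\<close>.\<close>
  define g where "g = (\<lambda>z. (p - 1) * (\<bar>A z\<bar> + \<bar>\<beta> z\<bar>) powr (p - 2) * \<bar>\<beta> z\<bar> * \<bar>q z\<bar>)"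
  have cf: "continuous_on korb (f k)" for k
    unfolding f_def using h(2) p by (intro continuous_intros A \<beta> q) auto
  have cg: "continuous_on korb g"
  proof -
    have "continuous_on korb (\<lambda>z. \<bar>\<bar>A z\<bar> + \<bar>\<beta> z\<bar>\<bar> powr (p - 2))"
      using p by (intro continuous_intros A \<beta>) auto
    then have "continuous_on korb (\<lambda>z. (\<bar>A z\<bar> + \<bar>\<beta> z\<bar>) powr (p - 2))" by simp
    then show ?thesis unfolding g_def by (intro continuous_on_mult continuous_on_const continuous_on_rabs \<beta> q)
  qed
  have "(\<lambda>k. integral korb (f k)) \<longlonglongrightarrow> integral korb (\<lambda>z. (p - 1) * \<bar>A z\<bar> powr (p - 2) * \<beta> z * q z)"
  proof (rule dominated_convergence(2)[where h = g])
    show "f k integrable_on korb" "g integrable_on korb" for k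
      using cf cg continuous_on_korb_integrable by blast+
    fix z assume "z \<in> korb"
    show "norm (f k z) \<le> g z" for k
    proof -
      have "\<bar>spow p (A z + h k * \<beta> z) - spow p (A z)\<bar> \<le> (p - 1) * (\<bar>A z\<bar> + \<bar>h k * \<beta> z\<bar>) powr (p - 2) * \<bar>h k * \<beta> z\<bar>"
        by (rule spow_lipschitz[OF p])
      also have "\<dots> \<le> (p - 1) * (\<bar>A z\<bar> + \<bar>\<beta> z\<bar>) powr (p - 2) * \<bar>h k * \<beta> z\<bar>"
        using p h(3,4)[of k] by (intro mult_right_mono mult_left_mono powr_mono2)
          (auto simp: abs_mult mult_left_le_one_le)
      finally have "\<bar>spow p (A z + h k * \<beta> z) - spow p (A z)\<bar> / h k \<le> (p - 1) * (\<bar>A z\<bar> + \<bar>\<beta> z\<bar>) powr (p - 2) * \<bar>\<beta> z\<bar>"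
        using h(3)[of k] by (simp add: abs_mult divide_le_eq mult_ac)
      then have "\<bar>spow p (A z + h k * \<beta> z) - spow p (A z)\<bar> / h k * \<bar>q z\<bar> \<le> g z"
        unfolding g_def by (intro mult_right_mono) auto
      then show ?thesis using h(3)[of k] by (simp add: f_def abs_mult)
    qed
    have "((\<lambda>t. spow p (A z + t * \<beta> z)) has_real_derivative (p - 1) * \<bar>A z\<bar> powr (p - 2) * \<beta> z) (at 0)"
    proof -
      have "((\<lambda>t. A z + t * \<beta> z) has_real_derivative \<beta> z) (at 0)"
        by (auto intro!: derivative_eq_intros)
      from DERIV_chain2[where f = "spow p" and x = "0::real", OF DERIV_spow[OF p] this] show ?thesis by simp
    qed
    then have "(\<lambda>t. (spow p (A z + t * \<beta> z) - spow p (A z)) / t) \<midarrow>0\<rightarrow> (p - 1) * \<bar>A z\<bar> powr (p - 2) * \<beta> z"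
      by (simp add: DERIV_def)
    then have "(\<lambda>k. (spow p (A z + h k * \<beta> z) - spow p (A z)) / h k) \<longlonglongrightarrow> (p - 1) * \<bar>A z\<bar> powr (p - 2) * \<beta> z"
      using h by (auto intro: LIMSEQ_SEQ_conv[THEN iffD2, rule_format])
    then show "(\<lambda>k. f k z) \<longlonglongrightarrow> (p - 1) * \<bar>A z\<bar> powr (p - 2) * \<beta> z * q z"
      unfolding f_def by (intro tendsto_mult_right)
  qed
  moreover have "(\<lambda>k. integral korb (f k)) \<longlonglongrightarrow> D"
  proof -
    have "integral korb (f k) = (integral korb (\<lambda>z. spow p (A z + h k * \<beta> z) * q z) - integral korb (\<lambda>z. spow p (A z) * q z)) / h k" for k
    proof -
      have "integral korb (\<lambda>z. spow p (A z + h k * \<beta> z) * q z) - integral korb (\<lambda>z. spow p (A z) * q z)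
        = integral korb (\<lambda>z. h k * f k z)"
      proof -
        have "h k * f k z = spow p (A z + h k * \<beta> z) * q z - spow p (A z) * q z" for z
          using h(2)[of k] by (simp add: f_def left_diff_distrib)
        then show ?thesis
          using p by (simp only:, subst integral_diff)
            (auto intro!: continuous_on_korb_integrable continuous_intros A \<beta> q)
      qed
      then show ?thesis using h(2)[of k] by simp
    qed
    moreover have "(\<lambda>t. (integral korb (\<lambda>z. spow p (A z + t * \<beta> z) * q z) - integral korb (\<lambda>z. spow p (A z) * q z)) / t) \<midarrow>0\<rightarrow> D"
      using der by (simp add: DERIV_def)
    ultimately show ?thesis
      using h by (auto intro: LIMSEQ_SEQ_conv[THEN iffD2, rule_format])
  qed
  ultimately show ?thesis by (rule LIMSEQ_unique)
qed

section \<open>Second moments\<close>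

text \<open>Both sides are the derivative at 0 of the closed form of
  \<open>integral_spow_lin\<close> along \<open>(a + t * u, b + t * v)\<close>, paired with
  \<open>(u', v')\<close>. The first summand comes from the power of the norm, the second from the
  linear factor; for directions along \<open>(a, b)\<close> they add up to
  \<open>p - 1\<close>.\<close>

lemma second_moments:
  assumes p: "p > 2" and ab: "(a, b) \<noteq> (0, 0)"
  shows "integral korb (\<lambda>z. (p - 1) * \<bar>lin a b z\<bar> powr (p - 2) * lin u v z * lin u' v' z)
    = kappa p * (a\<^sup>2 + b\<^sup>2) powr ((p - 4) / 2) *
      ((p - 2) * (a * u + b * v) * (a * u' + b * v') + (a\<^sup>2 + b\<^sup>2) * (u * u' + v * v'))"
proof (rule DERIV_integral_spow[OF p])
  define n where "n = (\<lambda>t. (a + t * u)\<^sup>2 + (b + t * v)\<^sup>2)"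
  have n0: "n 0 > 0" using ab by (auto simp: n_def sum_power2_gt_zero_iff)
  have dn: "(n has_real_derivative 2 * (a * u + b * v)) (at 0)"
    unfolding n_def by (auto intro!: derivative_eq_intros)
  have "((\<lambda>t. n t powr ((p - 2) / 2)) has_real_derivative
      (p - 2) / 2 * n 0 powr ((p - 2) / 2 - 1) * (2 * (a * u + b * v))) (at 0)"
    using DERIV_chain2[where f = "\<lambda>y. y powr ((p - 2) / 2)", OF has_real_derivative_powr[OF n0] dn] .
  also have "(p - 2) / 2 - 1 = (p - 4) / 2" by (simp add: field_simps)
  finally have dp: "((\<lambda>t. n t powr ((p - 2) / 2)) has_real_derivative
      (p - 2) / 2 * n 0 powr ((p - 4) / 2) * (2 * (a * u + b * v))) (at 0)" .
  have dl: "((\<lambda>t. (a + t * u) * u' + (b + t * v) * v') has_real_derivative u * u' + v * v') (at 0)"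
    by (auto intro!: derivative_eq_intros)
  have pw: "n 0 powr ((p - 2) / 2) = n 0 * n 0 powr ((p - 4) / 2)"
  proof -
    have "(p - 2) / 2 = 1 + (p - 4) / 2" by (simp add: field_simps)
    then show ?thesis using n0 by (simp only: powr_add) simp
  qed
  have D: "((\<lambda>t. kappa p * (n t powr ((p - 2) / 2) * ((a + t * u) * u' + (b + t * v) * v'))) has_real_derivative
      kappa p * (a\<^sup>2 + b\<^sup>2) powr ((p - 4) / 2) *
      ((p - 2) * (a * u + b * v) * (a * u' + b * v') + (a\<^sup>2 + b\<^sup>2) * (u * u' + v * v'))) (at 0)"
    by (rule DERIV_cong[OF DERIV_cmult[OF DERIV_mult[OF dp dl]]])
      (simp add: pw, simp add: n_def field_simps)
  \<comment> \<open>The closed form is available only where \<open>(a + t * u, b + t * v)\<close> is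
    nonzero, hence the passage through a neighbourhood of 0.\<close>
  have op: "open {t. n t > 0}" "0 \<in> {t. n t > 0}"
    using n0 unfolding n_def by (auto intro!: open_Collect_less continuous_intros)
  show "((\<lambda>t. integral korb (\<lambda>z. spow p (lin a b z + t * lin u v z) * lin u' v' z)) has_real_derivative
      kappa p * (a\<^sup>2 + b\<^sup>2) powr ((p - 4) / 2) *
      ((p - 2) * (a * u + b * v) * (a * u' + b * v') + (a\<^sup>2 + b\<^sup>2) * (u * u' + v * v'))) (at 0)"
  proof (rule has_field_derivative_transform_within_open[OF D op])
    fix t assume "t \<in> {t. n t > 0}"
    then have nz: "(a + t * u, b + t * v) \<noteq> (0, 0)"
      unfolding n_def by (auto simp: sum_power2_gt_zero_iff)
    have cont: "continuous_on korb (\<lambda>z. spow p (lin (a + t * u) (b + t * v) z) * z$i)" for i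
      using p by (intro continuous_intros)
    have "integral korb (\<lambda>z. spow p (lin a b z + t * lin u v z) * lin u' v' z)
      = integral korb (\<lambda>z. u' * (spow p (lin (a + t * u) (b + t * v) z) * z$1) + v' * (spow p (lin (a + t * u) (b + t * v) z) * z$2))"
      by (intro integral_cong) (simp add: lin_def algebra_simps)
    also have "\<dots> = u' * integral korb (\<lambda>z. spow p (lin (a + t * u) (b + t * v) z) * z$1)
      + v' * integral korb (\<lambda>z. spow p (lin (a + t * u) (b + t * v) z) * z$2)"
      using cont by (subst integral_add) (simp_all add: continuous_on_korb_integrable integrable_on_mult_right)
    also have "\<dots> = kappa p * (n t powr ((p - 2) / 2) * ((a + t * u) * u' + (b + t * v) * v'))"
      unfolding integral_spow_lin[OF p nz] n_def by (simp add: algebra_simps)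
    finally show "kappa p * (n t powr ((p - 2) / 2) * ((a + t * u) * u' + (b + t * v) * v'))
      = integral korb (\<lambda>z. spow p (lin a b z + t * lin u v z) * lin u' v' z)" by simp
  qed
qed (intro continuous_intros)+

text \<open>\<open>\<bar>\<nabla>u\<bar>\<^sup>2\<close> times the normalized \<open>p\<close>-Laplacian of a function \<open>u\<close> with horizontal gradient \<open>(a, b)\<close> and
  symmetrised horizontal Hessian \<open>(m11, m12; m12, m22)\<close>; unlike the quotient, it is polynomial.\<close>

definition pform :: "real \<Rightarrow> real \<Rightarrow> real \<Rightarrow> real \<Rightarrow> real \<Rightarrow> real \<Rightarrow> real" where
  "pform p a b m11 m12 m22 =
     (p - 2) * (m11 * a\<^sup>2 + 2 * m12 * a * b + m22 * b\<^sup>2) + (a\<^sup>2 + b\<^sup>2) * (m11 + m22)"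

text \<open>The part of a Taylor polynomial that is homogeneous of degree two under the group
  dilations. The vertical coordinate has weight two, so a first vertical derivative
  \<open>\<tau>\<close> stands beside the horizontal second derivatives.\<close>

definition qform :: "real \<Rightarrow> real \<Rightarrow> real \<Rightarrow> real \<Rightarrow> heis \<Rightarrow> real" where
  "qform \<tau> m11 m12 m22 z = \<tau> * z$3 + (m11 * (z$1)\<^sup>2 + 2 * m12 * z$1 * z$2 + m22 * (z$2)\<^sup>2) / 2"

lemma continuous_on_qform [continuous_intros]: "continuous_on S (qform \<tau> m11 m12 m22)"
  unfolding qform_def[abs_def] by (intro continuous_intros) auto

text \<open>The horizontal part is a combination of products of \<open>lin 1 0\<close> and
  \<open>lin 0 1\<close>, so \<open>second_moments\<close> applies; the vertical part is odd in
  \<open>z$3\<close> and drops out. Here the correction of order \<open>\<epsilon>\<close> becomes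
  the operator.\<close>

lemma integral_weighted_qform:
  assumes p: "p > 2" and ab: "(a, b) \<noteq> (0, 0)"
  shows "integral korb (\<lambda>z. (p - 1) * \<bar>lin a b z\<bar> powr (p - 2) * qform \<tau> m11 m12 m22 z)
    = kappa p / 2 * (a\<^sup>2 + b\<^sup>2) powr ((p - 4) / 2) * pform p a b m11 m12 m22"
proof -
  define W where "W = (\<lambda>z. (p - 1) * \<bar>lin a b z\<bar> powr (p - 2))"
  have W: "continuous_on korb W" unfolding W_def using p by (intro continuous_intros) auto
  define I where "I = (\<lambda>u v u' v'. integral korb (\<lambda>z. W z * lin u v z * lin u' v' z))"
  have I: "I u v u' v' = kappa p * (a\<^sup>2 + b\<^sup>2) powr ((p - 4) / 2) *
      ((p - 2) * (a * u + b * v) * (a * u' + b * v') + (a\<^sup>2 + b\<^sup>2) * (u * u' + v * v'))" for u v u' v'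
    unfolding I_def W_def by (rule second_moments[OF p ab])
  have 0: "integral korb (\<lambda>z. W z * z$3) = 0"
    by (intro integral_korb_odd[of 1 0 1 "-1"] continuous_intros W) (auto simp: W_def lin_def)
  have int: "(\<lambda>z. c * (W z * lin u v z * lin u' v' z)) integrable_on korb" "(\<lambda>z. c * (W z * z$3)) integrable_on korb" for c u v u' v'
    by (intro continuous_on_korb_integrable continuous_intros W)+
  have "integral korb (\<lambda>z. W z * qform \<tau> m11 m12 m22 z)
    = integral korb (\<lambda>z. \<tau> * (W z * z$3) + (m11 / 2 * (W z * lin 1 0 z * lin 1 0 z)
       + (m12 * (W z * lin 1 0 z * lin 0 1 z) + m22 / 2 * (W z * lin 0 1 z * lin 0 1 z))))"
    by (intro integral_cong) (simp add: qform_def lin_def field_simps power2_eq_square)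
  also have "\<dots> = \<tau> * integral korb (\<lambda>z. W z * z$3) + (m11 / 2 * I 1 0 1 0 + (m12 * I 1 0 0 1 + m22 / 2 * I 0 1 0 1))"
    unfolding I_def
    by (simp only: integral_add[OF int(2) integrable_add[OF int(1) integrable_add[OF int(1) int(1)]]]
        integral_add[OF int(1) integrable_add[OF int(1) int(1)]] integral_add[OF int(1) int(1)] integral_mult_right)
  also have "\<dots> = kappa p / 2 * (a\<^sup>2 + b\<^sup>2) powr ((p - 4) / 2) * pform p a b m11 m12 m22"
    unfolding I 0 pform_def by (simp add: field_simps power2_eq_square)
  finally show ?thesis by (simp add: W_def)
qed

section \<open>The sign of the integral for a perturbed linear form\<close>

lemma kappa_pos:
  assumes p: "p > 2"
  shows "kappa p > 0"
proof -
  \<comment> \<open>A box with \<open>z$1 \<ge> 1/4\<close> on which the fourth power of the gauge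
    is at most \<open>(5/16)\<^sup>2 + 1/4 < 1\<close>.\<close>
  define l h :: heis where "l = vector [1/4, 0, 0]" and "h = vector [1/2, 1/4, 1/8]"
  have sub: "cbox l h \<subseteq> korb"
  proof
    fix z assume "z \<in> cbox l h"
    then have z: "0 \<le> z$1" "z$1 \<le> 1/2" "0 \<le> z$2" "z$2 \<le> 1/4" "0 \<le> z$3" "z$3 \<le> 1/8"
      by (auto simp: mem_box_cart forall_3 l_def h_def)
    then have "(z$1)\<^sup>2 \<le> (1/2)\<^sup>2" "(z$2)\<^sup>2 \<le> (1/4)\<^sup>2" "(z$3)\<^sup>2 \<le> (1/8)\<^sup>2" by (auto intro: power_mono)
    moreover from this have "((z$1)\<^sup>2 + (z$2)\<^sup>2)\<^sup>2 \<le> ((1/2)\<^sup>2 + (1/4)\<^sup>2)\<^sup>2" by (intro power_mono) auto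
    ultimately show "z \<in> korb" unfolding korb_def by (simp add: power2_eq_square)
  qed
  have eq: "spow p t * t = \<bar>t\<bar> powr p" for t
  proof -
    have "\<bar>t\<bar> powr p = \<bar>t\<bar> powr (p - 2 + 2)" by simp
    also have "\<dots> = \<bar>t\<bar> powr (p - 2) * \<bar>t\<bar> powr 2" by (rule powr_add)
    also have "\<bar>t\<bar> powr 2 = t\<^sup>2" by (cases "t = 0") auto
    finally show ?thesis by (simp add: spow_def power2_eq_square)
  qed
  have cont: "continuous_on S (\<lambda>z::heis. spow p (z$1) * z$1)" for S
    using p by (auto intro!: continuous_intros)
  have "0 < measure lborel (cbox l h) * (1/4) powr p"
  proof -
    have "cbox l h \<noteq> {}" by (simp add: interval_ne_empty_cart forall_3 l_def h_def)
    moreover have "\<forall>i. 0 < h$i - l$i" by (simp add: forall_3 l_def h_def)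
    ultimately show ?thesis by (simp add: content_cbox_cart prod_pos)
  qed
  also have "\<dots> = integral (cbox l h) (\<lambda>_. (1/4) powr p)" by simp
  also have "\<dots> \<le> integral (cbox l h) (\<lambda>z. spow p (z$1) * z$1)"
    using cont p by (intro integral_le integrable_continuous)
      (auto simp: eq mem_box_cart forall_3 l_def intro!: powr_mono2 continuous_intros)
  also have "\<dots> \<le> kappa p"
    unfolding kappa_def using cont
    by (intro integral_subset_le sub integrable_continuous continuous_on_korb_integrable) (auto simp: eq)
  finally show ?thesis .
qed

text \<open>Again by rotation to the first axis. The explicit factor makes the integral of the
  singular weight uniform once \<open>a\<^sup>2 + b\<^sup>2\<close> is bounded below.\<close>

lemma integral_abs_lin_powr:
  assumes g: "-1 < g" and ab: "(a, b) \<noteq> (0, 0)"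
  shows "(\<lambda>z. \<bar>lin a b z\<bar> powr g) absolutely_integrable_on korb"
    and "integral korb (\<lambda>z. \<bar>lin a b z\<bar> powr g) = (a\<^sup>2 + b\<^sup>2) powr (g / 2) * integral korb (\<lambda>z. \<bar>z$1\<bar> powr g)"
proof -
  obtain r c s where r: "r > 0" "r\<^sup>2 = a\<^sup>2 + b\<^sup>2" "c\<^sup>2 + s\<^sup>2 = 1" "a = r * c" "b = r * s"
    "\<And>z. lin a b (kmap c s 1 1 z) = r * z$1"
    by (rule rotation_to_axis[OF ab]) (rule that, assumption+)
  have eq: "\<bar>lin a b (kmap c s 1 1 z)\<bar> powr g = r powr g * \<bar>z$1\<bar> powr g" for z
    using r(1) by (simp add: r(6) abs_mult powr_mult)
  have i: "(\<lambda>z. \<bar>lin a b (kmap c s 1 1 z)\<bar> powr g) absolutely_integrable_on korb"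
    unfolding eq by (intro set_integrable_mult_right absolutely_integrable_abs_powr_korb g)
  show "(\<lambda>z. \<bar>lin a b z\<bar> powr g) absolutely_integrable_on korb"
    using integral_korb_kmap(1)[OF r(3) _ _ i] by simp
  have "r powr g = (r powr 2) powr (g / 2)" by (simp only: powr_powr) simp
  also have "\<dots> = (a\<^sup>2 + b\<^sup>2) powr (g / 2)" using r(1) by (simp flip: r(2))
  finally show "integral korb (\<lambda>z. \<bar>lin a b z\<bar> powr g) = (a\<^sup>2 + b\<^sup>2) powr (g / 2) * integral korb (\<lambda>z. \<bar>z$1\<bar> powr g)"
    using integral_korb_kmap(2)[OF r(3) _ _ i] by (simp add: eq)
qed

text \<open>Used with exponent \<open>(p - 4) / 2\<close>, whose sign depends on
  \<open>p\<close>.\<close>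

lemma powr_between_lower:
  fixes l u x e :: real
  assumes "0 < l" "l \<le> x" "x \<le> u"
  shows "min (l powr e) (u powr e) \<le> x powr e"
proof (cases "e \<ge> 0")
  case True
  then have "l powr e \<le> x powr e" using assms by (intro powr_mono2) auto
  then show ?thesis by simp
next
  case False
  then have "u powr e \<le> x powr e" using assms by (intro powr_mono2') auto
  then show ?thesis by simp
qed

lemma abs_mult_le_bound:
  fixes a b :: real
  assumes "\<bar>a\<bar> \<le> A" "\<bar>b\<bar> \<le> B"
  shows "\<bar>a * b\<bar> \<le> A * B"
  unfolding abs_mult using assms by (intro mult_mono) auto

text \<open>The constant \<open>K\<close> does not depend on the data of the barrier function, which is what allows to
  choose that function last.\<close>

lemma integral_spow_nonneg:
  assumes p: "p > 2" and c0: "c0 > 0" and D: "D \<ge> 1" and B: "B \<ge> 0" and R: "R \<ge> 0"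
  obtains K where "K > 0"
    "\<And>w a b \<tau> m11 m12 m22 \<epsilon>. continuous_on korb w \<Longrightarrow> 0 < \<epsilon> \<Longrightarrow> \<epsilon> \<le> 1 \<Longrightarrow> c0 \<le> a\<^sup>2 + b\<^sup>2 \<Longrightarrow>
      \<bar>a\<bar> \<le> D \<Longrightarrow> \<bar>b\<bar> \<le> D \<Longrightarrow> \<bar>\<tau>\<bar> \<le> B \<Longrightarrow> \<bar>m11\<bar> \<le> B \<Longrightarrow> \<bar>m12\<bar> \<le> B \<Longrightarrow> \<bar>m22\<bar> \<le> B \<Longrightarrow>
      \<forall>z\<in>korb. lin a b z + \<epsilon> * qform \<tau> m11 m12 m22 z - \<epsilon>\<^sup>2 * R \<le> w z \<Longrightarrow>
      \<epsilon> * K \<le> pform p a b m11 m12 m22 \<Longrightarrow> 0 \<le> integral korb (\<lambda>z. spow p (w z))"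
proof -
  define g where "g = min (p - 3) 0"
  have g: "-1 < g" "g \<le> 0" using p by (auto simp: g_def)
  define E where "E = 3 * B + R"
  define D' where "D' = max (2 * D) (max E 1)"
  obtain C where C: "C > 0" "\<And>A e. A \<noteq> 0 \<Longrightarrow> \<bar>A\<bar> \<le> D' \<Longrightarrow> \<bar>e\<bar> \<le> D' \<Longrightarrow>
      \<bar>spow p (A + e) - spow p A - (p - 1) * \<bar>A\<bar> powr (p - 2) * e\<bar> \<le> C * e\<^sup>2 * \<bar>A\<bar> powr g"
    by (rule spow_taylor[OF p, of D']) (auto simp: D'_def g_def intro: that)
  define V where "V = integral korb (\<lambda>_. 1 :: real)"
  define Vg where "Vg = integral korb (\<lambda>z. \<bar>z$1\<bar> powr g)"
  \<comment> \<open>All errors of order \<open>\<epsilon>\<^sup>2\<close>: the quadratic remainder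
    of \<open>spow_taylor\<close>, and the term \<open>\<epsilon>\<^sup>2 * R\<close> multiplied by
    the derivative of \<open>spow\<close> at the linear form.\<close>
  define C' where "C' = C * E\<^sup>2 * (c0 powr (g / 2) * Vg) + R * ((p - 1) * (2 * D) powr (p - 2) * V)"
  \<comment> \<open>A lower bound for the power of \<open>a\<^sup>2 + b\<^sup>2\<close> in
    \<open>integral_weighted_qform\<close>, valid between \<open>c0\<close> and
    \<open>2 * D\<^sup>2\<close>.\<close>
  define L where "L = min (c0 powr ((p - 4) / 2)) ((2 * D\<^sup>2) powr ((p - 4) / 2))"
  have V: "V \<ge> 0" unfolding V_def by (intro integral_nonneg continuous_on_korb_integrable) auto
  have Vg: "Vg \<ge> 0" unfolding Vg_def
    by (intro integral_nonneg set_lebesgue_integral_eq_integral(1) absolutely_integrable_abs_powr_korb g) auto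
  have C': "C' \<ge> 0" unfolding C'_def using C(1) V Vg R p by (intro add_nonneg_nonneg mult_nonneg_nonneg) auto
  have L: "L > 0" unfolding L_def using c0 D by auto
  \<comment> \<open>With this value the hypothesis on \<open>pform\<close> makes the term of order
    \<open>\<epsilon>\<close> at least \<open>\<epsilon>\<^sup>2 * (C' + 1)\<close>, which leaves
    \<open>\<epsilon>\<^sup>2\<close> after the errors.\<close>
  define K where "K = (C' + 1) / (kappa p / 2 * L)"
  have K: "K > 0" unfolding K_def using C' L kappa_pos[OF p] by auto
  have "0 \<le> integral korb (\<lambda>z. spow p (w z))"
    if w: "continuous_on korb w" and \<epsilon>: "0 < \<epsilon>" "\<epsilon> \<le> 1" and n: "c0 \<le> a\<^sup>2 + b\<^sup>2"
      and bd: "\<bar>a\<bar> \<le> D" "\<bar>b\<bar> \<le> D" "\<bar>\<tau>\<bar> \<le> B" "\<bar>m11\<bar> \<le> B" "\<bar>m12\<bar> \<le> B" "\<bar>m22\<bar> \<le> B"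
      and low: "\<forall>z\<in>korb. lin a b z + \<epsilon> * qform \<tau> m11 m12 m22 z - \<epsilon>\<^sup>2 * R \<le> w z"
      and K': "\<epsilon> * K \<le> pform p a b m11 m12 m22"
    for w a b \<tau> m11 m12 m22 \<epsilon>
  proof -
    have ab: "(a, b) \<noteq> (0, 0)" using n c0 by auto
    have n2: "a\<^sup>2 + b\<^sup>2 \<le> 2 * D\<^sup>2"
    proof -
      have "a\<^sup>2 \<le> D\<^sup>2" "b\<^sup>2 \<le> D\<^sup>2"
        using bd power_mono[of "\<bar>a\<bar>" D 2] power_mono[of "\<bar>b\<bar>" D 2] by simp_all
      then show ?thesis by simp
    qed
    let ?A = "lin a b"
    let ?Q = "qform \<tau> m11 m12 m22"
    let ?W = "\<lambda>z. (p - 1) * \<bar>?A z\<bar> powr (p - 2)"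
    define X where "X = integral korb (\<lambda>z. ?W z * ?Q z)"
    have A: "\<bar>?A z\<bar> \<le> 2 * D" if "z \<in> korb" for z
    proof -
      have "\<bar>a * z$1\<bar> \<le> D * 1" "\<bar>b * z$2\<bar> \<le> D * 1"
        by (rule abs_mult_le_bound bd korb_bounds(2-4)[OF that])+
      then show ?thesis unfolding lin_def by linarith
    qed
    have Q: "\<bar>?Q z\<bar> \<le> 3 * B" if "z \<in> korb" for z
    proof -
      have "\<bar>\<tau> * z$3\<bar> \<le> B * 1" "\<bar>m11 * (z$1 * z$1)\<bar> \<le> B * (1 * 1)" "\<bar>m12 * (z$1 * z$2)\<bar> \<le> B * (1 * 1)"
        "\<bar>m22 * (z$2 * z$2)\<bar> \<le> B * (1 * 1)"
        by (rule abs_mult_le_bound bd korb_bounds(2-4)[OF that])+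
      moreover have "\<bar>t + (x + 2 * y + w) / 2\<bar> \<le> 3 * B"
        if "\<bar>t\<bar> \<le> B" "\<bar>x\<bar> \<le> B" "\<bar>y\<bar> \<le> B" "\<bar>w\<bar> \<le> B" for t x y w
        using that by (simp add: abs_le_iff field_simps)
      ultimately show ?thesis unfolding qform_def power2_eq_square mult.assoc mult_1_right by blast
    qed
    \<comment> \<open>Monotonicity of \<open>spow\<close> passes the lower bound for
      \<open>w\<close> through, so no upper bound for \<open>w\<close> enters.\<close>
    have pt: "spow p (?A z) + (\<epsilon> * (?W z * ?Q z) - (\<epsilon>\<^sup>2 * R * ?W z + \<epsilon>\<^sup>2 * (C * E\<^sup>2) * \<bar>?A z\<bar> powr g)) \<le> spow p (w z)"
      if z: "z \<in> korb" and nz: "?A z \<noteq> 0" for z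
    proof -
      define e where "e = \<epsilon> * ?Q z - \<epsilon>\<^sup>2 * R"
      have "\<bar>\<epsilon> * ?Q z\<bar> \<le> \<epsilon> * (3 * B)" unfolding abs_mult using Q[OF z] \<epsilon> by (simp add: mult_left_mono)
      moreover have "\<epsilon>\<^sup>2 * R \<le> \<epsilon> * R" "0 \<le> \<epsilon>\<^sup>2 * R"
        using \<epsilon> R by (auto simp: power2_eq_square mult_left_le_one_le)
      ultimately have e: "\<bar>e\<bar> \<le> \<epsilon> * E" unfolding e_def E_def by (simp add: algebra_simps)
      have E0: "E \<ge> 0" using B R by (simp add: E_def)
      have "\<epsilon> * E \<le> 1 * E" using \<epsilon> E0 by (intro mult_right_mono) auto
      then have eD: "\<bar>e\<bar> \<le> D'" using e by (simp add: D'_def)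
      have AD: "\<bar>?A z\<bar> \<le> D'" using A[OF z] by (simp add: D'_def)
      have e2: "e\<^sup>2 \<le> (\<epsilon> * E)\<^sup>2" using e E0 \<epsilon> by (simp flip: abs_le_square_iff)
      have "\<bar>spow p (?A z + e) - spow p (?A z) - ?W z * e\<bar> \<le> C * e\<^sup>2 * \<bar>?A z\<bar> powr g"
        by (rule C(2)[OF nz AD eD])
      also have "\<dots> \<le> C * (\<epsilon> * E)\<^sup>2 * \<bar>?A z\<bar> powr g"
        using e2 C(1) by (intro mult_right_mono mult_left_mono) auto
      finally have "spow p (?A z) + ?W z * e - C * (\<epsilon> * E)\<^sup>2 * \<bar>?A z\<bar> powr g \<le> spow p (?A z + e)"
        by linarith
      also have "\<dots> \<le> spow p (w z)"
        using bspec[OF low z] p by (intro spow_mono) (auto simp: e_def)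
      finally show ?thesis
        by (simp add: e_def algebra_simps power_mult_distrib)
    qed
    have cW: "continuous_on korb ?W" using p by (intro continuous_intros) auto
    have iA: "(\<lambda>z. spow p (?A z)) integrable_on korb"
      using p by (intro continuous_on_korb_integrable continuous_intros)
    have iW: "?W integrable_on korb" using cW by (rule continuous_on_korb_integrable)
    have iQ: "(\<lambda>z. ?W z * ?Q z) integrable_on korb"
      by (intro continuous_on_korb_integrable continuous_on_mult[OF cW] continuous_intros)
    have ig: "(\<lambda>z. \<bar>?A z\<bar> powr g) integrable_on korb"
      by (intro set_lebesgue_integral_eq_integral(1) integral_abs_lin_powr g ab)
    have iw: "(\<lambda>z. spow p (w z)) integrable_on korb"
      using p w by (intro continuous_on_korb_integrable continuous_intros)
    have neg: "negligible {z. ?A z = 0}"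
    proof -
      have "{z. ?A z = 0} = {z. vector [a, b, 0] \<bullet> z = 0}"
        by (auto simp: lin_def inner_vec_def sum_3)
      moreover have "(vector [a, b, 0] :: heis) \<noteq> 0" using ab by (auto simp: vec_eq_iff forall_3)
      ultimately show ?thesis using negligible_hyperplane[of "vector [a, b, 0] :: heis" 0] by simp
    qed
    define l where "l = (\<lambda>z. spow p (?A z) + (\<epsilon> * (?W z * ?Q z) - (\<epsilon>\<^sup>2 * R * ?W z + \<epsilon>\<^sup>2 * (C * E\<^sup>2) * \<bar>?A z\<bar> powr g)))"
    have il: "l integrable_on korb"
      unfolding l_def by (intro integrable_add integrable_diff integrable_on_mult_right iA iW iQ ig)
    have l: "integral korb l \<le> integral korb (\<lambda>z. spow p (w z))"
    proof -
      have "integral korb l = integral korb (\<lambda>z. if ?A z = 0 then spow p (w z) else l z)"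
        by (rule integral_spike[OF neg]) auto
      also have "\<dots> \<le> integral korb (\<lambda>z. spow p (w z))"
      proof (rule integral_le)
        show "(\<lambda>z. if ?A z = 0 then spow p (w z) else l z) integrable_on korb"
          by (rule integrable_spike[OF il neg]) auto
      qed (use iw pt in \<open>auto simp: l_def\<close>)
      finally show ?thesis .
    qed
    \<comment> \<open>The half turn of the horizontal plane changes the sign of the linear
      form.\<close>
    have A0: "integral korb (\<lambda>z. spow p (?A z)) = 0"
      using p by (intro integral_korb_odd[of "-1" 0 1 1] continuous_intros) (auto simp: lin_def simp flip: spow_minus)
    have "integral korb l = \<epsilon> * X - (\<epsilon>\<^sup>2 * R * integral korb ?W + \<epsilon>\<^sup>2 * (C * E\<^sup>2) * integral korb (\<lambda>z. \<bar>?A z\<bar> powr g))"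
    proof -
      have "integral korb l = integral korb (\<lambda>z. spow p (?A z)) + (integral korb (\<lambda>z. \<epsilon> * (?W z * ?Q z))
        - (integral korb (\<lambda>z. \<epsilon>\<^sup>2 * R * ?W z) + integral korb (\<lambda>z. \<epsilon>\<^sup>2 * (C * E\<^sup>2) * \<bar>?A z\<bar> powr g)))"
        unfolding l_def
        by (simp only: integral_add integral_diff integrable_add integrable_diff integrable_on_mult_right iA iW iQ ig)
      then show ?thesis unfolding A0 X_def by simp
    qed
    moreover have "integral korb ?W \<le> (p - 1) * (2 * D) powr (p - 2) * V"
    proof -
      have "integral korb ?W \<le> integral korb (\<lambda>z. (p - 1) * (2 * D) powr (p - 2) * 1)"
        using p by (intro integral_le iW continuous_on_korb_integrable) (auto intro!: powr_mono2 A)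
      then show ?thesis unfolding V_def integral_mult_right .
    qed
    then have "R * integral korb ?W \<le> R * ((p - 1) * (2 * D) powr (p - 2) * V)"
      using R by (rule mult_left_mono)
    moreover have "integral korb (\<lambda>z. \<bar>?A z\<bar> powr g) \<le> c0 powr (g / 2) * Vg"
      unfolding integral_abs_lin_powr(2)[OF g(1) ab] Vg_def[symmetric]
      using n c0 g Vg by (intro mult_right_mono powr_mono2') auto
    then have "C * E\<^sup>2 * integral korb (\<lambda>z. \<bar>?A z\<bar> powr g) \<le> C * E\<^sup>2 * (c0 powr (g / 2) * Vg)"
      using C(1) by (intro mult_left_mono) auto
    ultimately have l2: "\<epsilon> * X - \<epsilon>\<^sup>2 * C' \<le> integral korb l"
    proof -
      assume 1: "integral korb l = \<epsilon> * X - (\<epsilon>\<^sup>2 * R * integral korb ?W + \<epsilon>\<^sup>2 * (C * E\<^sup>2) * integral korb (\<lambda>z. \<bar>?A z\<bar> powr g))"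
        and 2: "R * integral korb ?W \<le> R * ((p - 1) * (2 * D) powr (p - 2) * V)"
        and 3: "C * E\<^sup>2 * integral korb (\<lambda>z. \<bar>?A z\<bar> powr g) \<le> C * E\<^sup>2 * (c0 powr (g / 2) * Vg)"
      have "\<epsilon>\<^sup>2 * (C * E\<^sup>2 * integral korb (\<lambda>z. \<bar>?A z\<bar> powr g) + R * integral korb ?W) \<le> \<epsilon>\<^sup>2 * C'"
        unfolding C'_def by (intro mult_left_mono add_mono 2 3) auto
      then show ?thesis unfolding 1 by (simp add: algebra_simps)
    qed
    have "\<epsilon> * (C' + 1) \<le> X"
    proof -
      have Ln: "L \<le> (a\<^sup>2 + b\<^sup>2) powr ((p - 4) / 2)"
        unfolding L_def by (rule powr_between_lower[OF c0 n n2])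
      have "\<epsilon> * (C' + 1) = kappa p / 2 * L * (\<epsilon> * K)"
        using L kappa_pos[OF p] by (simp add: K_def)
      also have "\<dots> \<le> kappa p / 2 * (a\<^sup>2 + b\<^sup>2) powr ((p - 4) / 2) * (\<epsilon> * K)"
        using Ln kappa_pos[OF p] \<epsilon> K by (intro mult_right_mono mult_left_mono) auto
      also have "\<dots> \<le> kappa p / 2 * (a\<^sup>2 + b\<^sup>2) powr ((p - 4) / 2) * pform p a b m11 m12 m22"
        using K' kappa_pos[OF p] by (intro mult_left_mono) auto
      also have "\<dots> = X" unfolding X_def integral_weighted_qform[OF p ab] ..
      finally show ?thesis .
    qed
    then have "\<epsilon> * (\<epsilon> * (C' + 1)) \<le> \<epsilon> * X" using \<epsilon> by (intro mult_left_mono) auto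
    moreover have "\<epsilon> * (\<epsilon> * (C' + 1)) - \<epsilon>\<^sup>2 * C' = \<epsilon>\<^sup>2" by (simp add: algebra_simps power2_eq_square)
    ultimately have "\<epsilon>\<^sup>2 \<le> integral korb l" using l2 by linarith
    then show ?thesis using l zero_le_power2[of \<epsilon>] by linarith
  qed
  then show ?thesis by (rule that[OF K])
qed

section \<open>The natural mean\<close>

lemma integral_pos_compact:
  fixes f :: "heis \<Rightarrow> real"
  assumes K: "compact K" "integral K (\<lambda>_. 1 :: real) > 0" and f: "continuous_on K f" "\<And>y. y \<in> K \<Longrightarrow> f y > 0"
  shows "integral K f > 0"
proof -
  have "K \<noteq> {}" using K(2) by auto
  then obtain y where y: "y \<in> K" "\<And>z. z \<in> K \<Longrightarrow> f y \<le> f z"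
    using continuous_attains_inf[OF K(1) _ f(1)] by blast
  have "0 < f y * integral K (\<lambda>_. 1)" using K(2) f(2)[OF y(1)] by simp
  also have "\<dots> = integral K (\<lambda>_. f y * 1)" by (rule integral_mult_right[symmetric])
  also have "\<dots> \<le> integral K f"
    using y(2) f(1) K(1) by (intro integral_le integrable_continuous_compact) (auto intro: continuous_intros)
  finally show ?thesis .
qed

text \<open>The integral is Lipschitz in \<open>l\<close> on \<open>{-M..M}\<close>, where
  \<open>M\<close> bounds \<open>\<bar>\<phi>\<bar>\<close>, nonnegative at \<open>- M\<close> and
  nonpositive at \<open>M\<close>; the intermediate value theorem gives a root.\<close>

lemma Lp_minimizer:
  fixes \<phi> :: "heis \<Rightarrow> real"
  assumes p: "p > 2" and K: "compact K" "integral K (\<lambda>_. 1 :: real) > 0" and \<phi>: "continuous_on K \<phi>"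
  obtains l where "integral K (\<lambda>y. spow p (\<phi> y - l)) = 0"
proof -
  define DD where "DD = (\<lambda>l. integral K (\<lambda>y. spow p (\<phi> y - l)))"
  have int: "(\<lambda>y. spow p (\<phi> y - l)) integrable_on K" for l
    using p by (intro integrable_continuous_compact K(1) continuous_intros \<phi>)
  obtain M where M: "M > 0" "\<And>y. y \<in> K \<Longrightarrow> \<bar>\<phi> y\<bar> \<le> M"
    using compact_imp_bounded[OF compact_continuous_image[OF \<phi> K(1)]] by (auto simp: bounded_pos)
  \<comment> \<open>\<open>4 * M\<close> bounds
    \<open>\<bar>\<phi> y - m\<bar> + \<bar>m - l\<bar>\<close>, each summand being at most
    \<open>2 * M\<close>.\<close>
  define C where "C = (p - 1) * (4 * M) powr (p - 2) * integral K (\<lambda>_. 1)"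
  have "C-lipschitz_on {-M..M} DD"
  proof (rule lipschitz_onI)
    fix l m assume lm: "l \<in> {-M..M}" "m \<in> {-M..M}"
    have "\<bar>DD l - DD m\<bar> = \<bar>integral K (\<lambda>y. spow p (\<phi> y - l) - spow p (\<phi> y - m))\<bar>"
      unfolding DD_def by (subst integral_diff[OF int int]) simp
    also have "\<dots> \<le> integral K (\<lambda>y. (p - 1) * (4 * M) powr (p - 2) * \<bar>l - m\<bar> * 1)"
    proof (rule integral_norm_bound_integral[where 'a = real, unfolded real_norm_def])
      fix y assume y: "y \<in> K"
      have "\<bar>spow p ((\<phi> y - m) + (m - l)) - spow p (\<phi> y - m)\<bar> \<le> (p - 1) * (\<bar>\<phi> y - m\<bar> + \<bar>m - l\<bar>) powr (p - 2) * \<bar>m - l\<bar>"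
        by (rule spow_lipschitz[OF p])
      also have "\<dots> \<le> (p - 1) * (4 * M) powr (p - 2) * \<bar>m - l\<bar>"
      proof -
        have "\<bar>\<phi> y - m\<bar> \<le> 2 * M" "\<bar>m - l\<bar> \<le> 2 * M" using M(2)[OF y] lm by auto
        then show ?thesis using p by (intro mult_right_mono mult_left_mono powr_mono2) auto
      qed
      finally show "\<bar>spow p (\<phi> y - l) - spow p (\<phi> y - m)\<bar> \<le> (p - 1) * (4 * M) powr (p - 2) * \<bar>l - m\<bar> * 1"
        by (simp add: abs_minus_commute)
    qed (intro integrable_diff int, intro integrable_continuous_compact K(1) continuous_intros)
    also have "\<dots> = C * \<bar>l - m\<bar>" unfolding integral_mult_right C_def by (simp add: mult_ac)
    finally show "dist (DD l) (DD m) \<le> C * dist l m" by (simp add: dist_real_def)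
  qed (use p K(2) in \<open>simp add: C_def\<close>)
  then have cont: "continuous_on {-M..M} DD" by (rule lipschitz_on_continuous_on)
  have "DD M \<le> 0"
  proof -
    have "DD M \<le> integral K (\<lambda>_. 0)" unfolding DD_def
    proof (intro integral_le int integrable_0)
      fix y assume "y \<in> K"
      then have "spow p (\<phi> y - M) \<le> spow p 0" using M(2)[of y] p by (intro spow_mono) auto
      then show "spow p (\<phi> y - M) \<le> 0" by simp
    qed
    then show ?thesis by simp
  qed
  moreover have "0 \<le> DD (- M)" unfolding DD_def
  proof (intro integral_nonneg int)
    fix y assume "y \<in> K"
    then have "spow p 0 \<le> spow p (\<phi> y - - M)" using M(2)[of y] p by (intro spow_mono) auto
    then show "0 \<le> spow p (\<phi> y - - M)" by simp
  qed
  ultimately obtain l where "DD l = 0"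
    using IVT2'[of DD M 0 "-M"] cont M(1) by auto
  then show ?thesis using that by (simp add: DD_def)
qed

text \<open>Integrating \<open>abs_powr_tangent\<close> kills the linear term at a root, so every
  root is the strict minimizer and fixes the value of \<open>THE\<close>. The converse follows
  because a root exists by \<open>Lp_minimizer\<close>, and that root is the mean as well.\<close>

lemma p_mean_euler_lagrange:
  fixes \<phi> :: "heis \<Rightarrow> real" and x :: heis and \<epsilon> :: real
  defines "K \<equiv> closure (heis_ball x \<epsilon>)"
  assumes p: "p > 2" and K: "compact K" "integral K (\<lambda>_. 1 :: real) > 0" and \<phi>: "continuous_on K \<phi>"
  shows "integral K (\<lambda>y. spow p (\<phi> y - l)) = 0 \<longleftrightarrow> p_mean p \<phi> \<epsilon> x = l"
proof -
  define F where "F = (\<lambda>l. integral K (\<lambda>y. \<bar>\<phi> y - l\<bar> powr p))"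
  define N where "N = (\<lambda>l. Lp_norm_on p K (\<lambda>y. \<phi> y - l))"
  have cF: "continuous_on K (\<lambda>y. \<bar>\<phi> y - l\<bar> powr p)" for l
    using p by (intro continuous_intros \<phi>) auto
  have N: "N l = F l powr (1 / p)" for l
    unfolding N_def F_def Lp_norm_on_def
    by (subst set_lebesgue_integral_eq_integral(2)[OF absolutely_integrable_continuous_compact[OF K(1) cF]]) simp
  have N_fold: "Lp_norm_on p K (\<lambda>y. \<phi> y - l) = N l" for l
    by (simp add: N_def)
  have F0: "F l \<ge> 0" for l
    unfolding F_def by (intro integral_nonneg integrable_continuous_compact K(1) cF) auto
  have min: "N l < N m" if l: "integral K (\<lambda>y. spow p (\<phi> y - l)) = 0" and ne: "m \<noteq> l" for l m
  proof -
    have int: "(\<lambda>y. spow p (\<phi> y - l)) integrable_on K"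
      using p by (intro integrable_continuous_compact K(1) continuous_intros \<phi>)
    have iF: "(\<lambda>y. \<bar>\<phi> y - k\<bar> powr p) integrable_on K" for k
      by (intro integrable_continuous_compact K(1) cF)
    have "0 < integral K (\<lambda>y. \<bar>\<phi> y - m\<bar> powr p - \<bar>\<phi> y - l\<bar> powr p - p * (l - m) * spow p (\<phi> y - l))"
    proof (rule integral_pos_compact[OF K])
      show "continuous_on K (\<lambda>y. \<bar>\<phi> y - m\<bar> powr p - \<bar>\<phi> y - l\<bar> powr p - p * (l - m) * spow p (\<phi> y - l))"
        using p by (intro continuous_intros \<phi>) auto
      fix y
      have "\<bar>\<phi> y - l\<bar> powr p + p * spow p (\<phi> y - l) * ((\<phi> y - m) - (\<phi> y - l)) < \<bar>\<phi> y - m\<bar> powr p"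
        using ne p by (intro abs_powr_tangent) auto
      then show "0 < \<bar>\<phi> y - m\<bar> powr p - \<bar>\<phi> y - l\<bar> powr p - p * (l - m) * spow p (\<phi> y - l)"
        by (simp add: algebra_simps)
    qed
    also have "\<dots> = F m - F l - p * (l - m) * integral K (\<lambda>y. spow p (\<phi> y - l))"
      unfolding F_def
      by (simp only: integral_diff integrable_diff iF int integrable_on_mult_right integral_mult_right)
    finally have "F l < F m" using l by simp
    then show ?thesis unfolding N using F0 p by (intro powr_less_mono2) auto
  qed
  have pm: "p_mean p \<phi> \<epsilon> x = l" if l: "integral K (\<lambda>y. spow p (\<phi> y - l)) = 0" for l
    unfolding p_mean_def K_def[symmetric] N_fold
  proof (rule the_equality)
    show "\<forall>m. N l \<le> N m" using min[OF l] less_imp_le by (metis order_refl)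
    show "l' = l" if "\<forall>m. N l' \<le> N m" for l'
      using min[OF l, of l'] that by (meson not_less)
  qed
  obtain l' where "integral K (\<lambda>y. spow p (\<phi> y - l')) = 0"
    by (rule Lp_minimizer[OF p K \<phi>])
  with pm[OF this] pm[of l] show ?thesis by auto
qed

text \<open>The integral is nonincreasing in \<open>l\<close> and vanishes exactly at the mean, so
  its sign at \<open>l\<close> tells on which side of the mean \<open>l\<close> lies.\<close>

lemma p_mean_comparison:
  fixes \<phi> :: "heis \<Rightarrow> real" and x :: heis and \<epsilon> :: real
  defines "K \<equiv> closure (heis_ball x \<epsilon>)"
  assumes p: "p > 2" and K: "compact K" "integral K (\<lambda>_. 1 :: real) > 0" and \<phi>: "continuous_on K \<phi>"
  shows "integral K (\<lambda>y. spow p (\<phi> y - l)) \<ge> 0 \<Longrightarrow> l \<le> p_mean p \<phi> \<epsilon> x"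
    and "integral K (\<lambda>y. spow p (\<phi> y - l)) \<le> 0 \<Longrightarrow> p_mean p \<phi> \<epsilon> x \<le> l"
proof -
  define k where "k = p_mean p \<phi> \<epsilon> x"
  have EL: "integral K (\<lambda>y. spow p (\<phi> y - l)) = 0 \<longleftrightarrow> k = l" for l
    using p_mean_euler_lagrange[of p x \<epsilon> \<phi> l] p K \<phi> by (simp add: K_def k_def)
  have int: "(\<lambda>y. spow p (\<phi> y - l)) integrable_on K" for l
    using p by (intro integrable_continuous_compact K(1) continuous_intros \<phi>)
  have mono: "integral K (\<lambda>y. spow p (\<phi> y - m)) \<le> integral K (\<lambda>y. spow p (\<phi> y - l))" if "l \<le> m" for l m
    using that p by (intro integral_le int spow_mono) auto
  show "l \<le> p_mean p \<phi> \<epsilon> x" if "integral K (\<lambda>y. spow p (\<phi> y - l)) \<ge> 0"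
    using that mono[of k l] EL[of k] EL[of l] by (fold k_def) linarith
  show "p_mean p \<phi> \<epsilon> x \<le> l" if "integral K (\<lambda>y. spow p (\<phi> y - l)) \<le> 0"
    using that mono[of l k] EL[of k] EL[of l] by (fold k_def) linarith
qed

section \<open>Dilations, left translations and gauge balls\<close>

definition dil :: "real \<Rightarrow> heis \<Rightarrow> heis" where
  "dil t z = vector [t * z$1, t * z$2, t\<^sup>2 * z$3]"

text \<open>Plays two roles: \<open>move x t\<close> maps \<open>korb\<close> onto the closed ball
  of radius \<open>t\<close> about \<open>x\<close>, and for fixed \<open>z\<close> the curve in
  \<open>t\<close> is the one along which functions are expanded.\<close>

definition move :: "heis \<Rightarrow> real \<Rightarrow> heis \<Rightarrow> heis" where
  "move x t z = heis_mult x (dil t z)"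

lemma heis_mult_nth [simp]:
  "heis_mult x y $ 1 = x$1 + y$1" "heis_mult x y $ 2 = x$2 + y$2"
  "heis_mult x y $ 3 = x$3 + y$3 + (x$1 * y$2 - x$2 * y$1) / 2"
  by (simp_all add: heis_mult_def)

lemma dil_nth [simp]: "dil t z $ 1 = t * z$1" "dil t z $ 2 = t * z$2" "dil t z $ 3 = t\<^sup>2 * z$3"
  by (simp_all add: dil_def)

lemma move_nth:
  "move x t z $ 1 = x$1 + t * z$1" "move x t z $ 2 = x$2 + t * z$2"
  "move x t z $ 3 = x$3 + t\<^sup>2 * z$3 + t * (x$1 * z$2 - x$2 * z$1) / 2"
  by (simp_all add: move_def algebra_simps)

text \<open>The fourth power of the gauge is a polynomial; the barrier will be one of its integer
  powers.\<close>

definition gauge4 :: "heis \<Rightarrow> real" where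
  "gauge4 z = ((z$1)\<^sup>2 + (z$2)\<^sup>2)\<^sup>2 + 16 * (z$3)\<^sup>2"

lemma gauge4_nonneg [simp]: "gauge4 z \<ge> 0" by (simp add: gauge4_def)

lemma heis_gauge_gauge4: "heis_gauge z = gauge4 z powr (1/4)"
  by (simp add: heis_gauge_def gauge4_def)

lemma gauge4_dil: "gauge4 (dil t z) = t ^ 4 * gauge4 z"
  by (simp add: gauge4_def) algebra

lemma heis_gauge_dil: "t \<ge> 0 \<Longrightarrow> heis_gauge (dil t z) = t * heis_gauge z"
proof (cases "t = 0")
  case False
  assume "t \<ge> 0"
  have "(t ^ 4) powr (1/4) = (t powr 4) powr (1/4)" using False \<open>t \<ge> 0\<close> by simp
  also have "\<dots> = t" using False \<open>t \<ge> 0\<close> by (simp only: powr_powr) simp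
  finally show ?thesis by (simp add: heis_gauge_gauge4 gauge4_dil powr_mult)
qed (simp add: heis_gauge_gauge4 gauge4_dil)

lemma heis_gauge_le_1: "heis_gauge z \<le> 1 \<longleftrightarrow> z \<in> korb"
proof -
  have "gauge4 z powr (1/4) \<le> 1 powr (1/4) \<longleftrightarrow> gauge4 z \<le> 1"
  proof (cases "gauge4 z \<le> 1")
    case True
    then show ?thesis using powr_mono2[of "1/4" "gauge4 z" 1] by simp
  next
    case False
    then have "1 powr (1/4) < gauge4 z powr (1/4)" by (intro powr_less_mono2) auto
    then show ?thesis using False by linarith
  qed
  then show ?thesis by (simp add: heis_gauge_gauge4 korb_def gauge4_def)
qed

lemma continuous_on_heis_dist: "continuous_on S (heis_dist x)"
proof -
  have "continuous_on S (\<lambda>y. gauge4 (heis_mult (heis_inv x) y) powr (1/4))"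
    unfolding gauge4_def heis_mult_nth by (intro continuous_on_powr' continuous_intros) auto
  then show ?thesis unfolding heis_dist_def[abs_def] heis_gauge_gauge4 .
qed

lemma heis_dist_move: "t \<ge> 0 \<Longrightarrow> heis_dist x (move x t z) = t * heis_gauge z"
  by (simp add: heis_dist_def move_def heis_mult_group flip: heis_mult_group(1) add: heis_gauge_dil)

lemma move_of_dist:
  assumes "\<epsilon> > 0" "heis_dist x y \<le> \<epsilon>"
  obtains z where "z \<in> korb" "y = move x \<epsilon> z"
proof
  define z where "z = dil (1 / \<epsilon>) (heis_mult (heis_inv x) y)"
  have dd: "dil \<epsilon> z = heis_mult (heis_inv x) y"
    using assms(1) by (simp add: z_def vec_eq_iff forall_3 power2_eq_square)
  show "y = move x \<epsilon> z"
    unfolding move_def dd by (simp add: heis_mult_group flip: heis_mult_group(1))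
  have "heis_gauge z = heis_dist x y / \<epsilon>"
    using assms(1) by (simp add: z_def heis_gauge_dil heis_dist_def)
  then show "z \<in> korb" using assms by (simp add: heis_gauge_le_1[symmetric])
qed

lemma continuous_on_move [continuous_intros]:
  assumes "continuous_on S h" "continuous_on S f" "continuous_on S g"
  shows "continuous_on S (\<lambda>s. move (h s) (f s) (g s))"
proof -
  have "continuous_on S (\<lambda>s. (\<chi> i::3. if i = 1 then h s$1 + f s * g s$1 else if i = 2 then h s$2 + f s * g s$2
      else h s$3 + (f s)\<^sup>2 * g s$3 + f s * (h s$1 * g s$2 - h s$2 * g s$1) / 2) :: heis)"
  proof (intro continuous_on_vec_lambda)
    fix i :: 3
    show "continuous_on S (\<lambda>s. if i = 1 then h s$1 + f s * g s$1 else if i = 2 then h s$2 + f s * g s$2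
      else h s$3 + (f s)\<^sup>2 * g s$3 + f s * (h s$1 * g s$2 - h s$2 * g s$1) / 2)"
      by (cases "i = 1"; cases "i = 2") (simp_all, (intro continuous_intros assms, simp?)+)
  qed
  also have "(\<lambda>s. (\<chi> i::3. if i = 1 then h s$1 + f s * g s$1 else if i = 2 then h s$2 + f s * g s$2
      else h s$3 + (f s)\<^sup>2 * g s$3 + f s * (h s$1 * g s$2 - h s$2 * g s$1) / 2) :: heis) = (\<lambda>s. move (h s) (f s) (g s))"
    by (simp add: fun_eq_iff vec_eq_iff forall_3 move_nth)
  finally show ?thesis .
qed

lemma closure_heis_ball:
  assumes "\<epsilon> > 0"
  shows "closure (heis_ball x \<epsilon>) = move x \<epsilon> ` korb"
proof
  have "closed {y. heis_dist x y \<le> \<epsilon>}"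
    using continuous_on_heis_dist[of UNIV x] by (intro closed_Collect_le continuous_intros)
  then have "closure (heis_ball x \<epsilon>) \<subseteq> {y. heis_dist x y \<le> \<epsilon>}"
    by (intro closure_minimal) (auto simp: heis_ball_def)
  also have "\<dots> \<subseteq> move x \<epsilon> ` korb"
    using move_of_dist[OF assms] by blast
  finally show "closure (heis_ball x \<epsilon>) \<subseteq> move x \<epsilon> ` korb" .
  show "move x \<epsilon> ` korb \<subseteq> closure (heis_ball x \<epsilon>)"
  proof
    fix y assume "y \<in> move x \<epsilon> ` korb"
    then obtain z where z: "z \<in> korb" "y = move x \<epsilon> z" by blast
    \<comment> \<open>Radii strictly below \<open>\<epsilon>\<close> and tending to it: shrinking
      \<open>z\<close> by dilations approaches \<open>y\<close> from inside the open ball.\<close>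
    define s where "s = (\<lambda>n. \<epsilon> * (1 - inverse (real (Suc n))))"
    have "s \<longlonglongrightarrow> \<epsilon> * (1 - 0)" unfolding s_def
      by (intro tendsto_intros LIMSEQ_inverse_real_of_nat)
    moreover have "continuous_on UNIV (\<lambda>t. move x t z)" by (intro continuous_intros)
    ultimately have "(\<lambda>n. move x (s n) z) \<longlonglongrightarrow> y"
      unfolding z(2) using continuous_on_tendsto_compose[of UNIV "\<lambda>t. move x t z" s \<epsilon> sequentially] by simp
    moreover have "move x (s n) z \<in> heis_ball x \<epsilon>" for n
    proof -
      have "0 \<le> s n" "s n < \<epsilon>" using assms by (auto simp: s_def field_simps)
      moreover have "s n * heis_gauge z \<le> s n * 1"
        using z(1) calculation by (intro mult_left_mono) (auto simp: heis_gauge_le_1)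
      ultimately show ?thesis by (simp add: heis_ball_def heis_dist_move)
    qed
    ultimately show "y \<in> closure (heis_ball x \<epsilon>)"
      unfolding closure_sequential by (intro exI[of _ "\<lambda>n. move x (s n) z"]) auto
  qed
qed

text \<open>In coordinates the map is affine with lower triangular linear part, of diagonal
  \<open>\<epsilon>, \<epsilon>, \<epsilon>\<^sup>2\<close>; the exponent 4 is the homogeneous
  dimension of the group.\<close>

lemma integral_move_korb:
  fixes f :: "heis \<Rightarrow> real"
  assumes \<epsilon>: "\<epsilon> > 0" and f: "continuous_on (move x \<epsilon> ` korb) f"
  shows "integral (move x \<epsilon> ` korb) f = \<epsilon> ^ 4 * integral korb (\<lambda>z. f (move x \<epsilon> z))"
proof -
  define L :: "heis \<Rightarrow> heis" where "L = (\<lambda>z. vector [\<epsilon> * z$1, \<epsilon> * z$2, \<epsilon>\<^sup>2 * z$3 + \<epsilon> * (x$1 * z$2 - x$2 * z$1) / 2])"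
  have mv: "move x \<epsilon> z = x + L z" for z
    by (simp add: L_def vec_eq_iff forall_3 move_nth)
  have "linear L" by (rule linearI) (simp_all add: L_def vec_eq_iff forall_3 field_simps)
  moreover have "inj L" using \<epsilon> by (auto simp: inj_on_def L_def vec_eq_iff forall_3)
  moreover have "det (matrix L) = \<epsilon> ^ 4"
    by (simp add: det_3 matrix_def axis_def L_def power4_eq_xxxx power2_eq_square)
  moreover have "(\<lambda>z. f (x + L z)) absolutely_integrable_on korb"
    unfolding mv[symmetric]
    by (intro continuous_on_korb_integrable continuous_on_compose2[OF f] continuous_intros) auto
  ultimately have "integral ((\<lambda>z. x + L z) ` korb) f = \<bar>\<epsilon> ^ 4\<bar> * integral korb (\<lambda>z. f (x + L z))"
    using integral_change_of_variables_affine(2)[OF compact_korb, of L f x] by simp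
  moreover have "move x \<epsilon> = (\<lambda>z. x + L z)" using mv by auto
  ultimately show ?thesis by simp
qed

text \<open>By homogeneity of \<open>spow\<close>, dividing the increments by
  \<open>\<epsilon>\<close> changes the integral by a positive factor only. The rescaled increments
  have a leading term of order one.\<close>

lemma p_mean_comparison_korb:
  fixes \<phi> :: "heis \<Rightarrow> real"
  assumes p: "p > 2" and \<epsilon>: "\<epsilon> > 0" and \<phi>: "continuous_on (move x \<epsilon> ` korb) \<phi>"
    and V: "integral korb (\<lambda>_. 1 :: real) > 0"
  shows "integral korb (\<lambda>z. spow p ((\<phi> (move x \<epsilon> z) - l) / \<epsilon>)) \<ge> 0 \<Longrightarrow> l \<le> p_mean p \<phi> \<epsilon> x"
    and "integral korb (\<lambda>z. spow p ((\<phi> (move x \<epsilon> z) - l) / \<epsilon>)) \<le> 0 \<Longrightarrow> p_mean p \<phi> \<epsilon> x \<le> l"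
proof -
  let ?K = "move x \<epsilon> ` korb"
  have K: "compact ?K" by (intro compact_continuous_image compact_korb continuous_intros)
  have "integral ?K (\<lambda>_. 1 :: real) = \<epsilon> ^ 4 * integral korb (\<lambda>_. 1)"
    by (rule integral_move_korb[OF \<epsilon>]) auto
  then have K1: "integral ?K (\<lambda>_. 1 :: real) > 0" using V \<epsilon> by simp
  have "integral ?K (\<lambda>y. spow p (\<phi> y - l)) = \<epsilon> ^ 4 * integral korb (\<lambda>z. spow p (\<phi> (move x \<epsilon> z) - l))"
    using p by (intro integral_move_korb[OF \<epsilon>] continuous_intros \<phi>)
  also have "(\<lambda>z. spow p (\<phi> (move x \<epsilon> z) - l)) = (\<lambda>z. \<epsilon> powr (p - 1) * spow p ((\<phi> (move x \<epsilon> z) - l) / \<epsilon>))"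
    using \<epsilon> by (simp flip: spow_mult)
  finally have eq: "integral ?K (\<lambda>y. spow p (\<phi> y - l))
      = \<epsilon> ^ 4 * \<epsilon> powr (p - 1) * integral korb (\<lambda>z. spow p ((\<phi> (move x \<epsilon> z) - l) / \<epsilon>))" by simp
  have pos: "\<epsilon> ^ 4 * \<epsilon> powr (p - 1) > 0" using \<epsilon> by simp
  note cmp = p_mean_comparison[of p x \<epsilon> \<phi> l, unfolded closure_heis_ball[OF \<epsilon>], OF p K K1 \<phi>, unfolded eq]
  show "integral korb (\<lambda>z. spow p ((\<phi> (move x \<epsilon> z) - l) / \<epsilon>)) \<ge> 0 \<Longrightarrow> l \<le> p_mean p \<phi> \<epsilon> x"
    using cmp(1) pos by (simp add: zero_le_mult_iff)
  show "integral korb (\<lambda>z. spow p ((\<phi> (move x \<epsilon> z) - l) / \<epsilon>)) \<le> 0 \<Longrightarrow> p_mean p \<phi> \<epsilon> x \<le> l"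
    using cmp(2) pos by (simp add: mult_le_0_iff)
qed

section \<open>Taylor expansion along dilated translations\<close>

lemma partial_eq: "(f has_derivative f') (at x) \<Longrightarrow> partial k f x = f' (axis k 1)"
  unfolding partial_def using frechet_derivative_at by metis

lemma differentiable_transform_open:
  assumes "f differentiable (at x)" "open S" "x \<in> S" "\<And>y. y \<in> S \<Longrightarrow> f y = g y"
  shows "g differentiable (at x)" "partial k g x = partial k f x"
proof -
  obtain f' where f': "(f has_derivative f') (at x)" using assms(1) by (auto simp: differentiable_def)
  then have g': "(g has_derivative f') (at x)"
    by (rule has_derivative_transform_within_open[OF _ assms(2,3)]) (use assms(4) in auto)
  then show "g differentiable (at x)" by (auto simp: differentiable_def)
  show "partial k g x = partial k f x" using partial_eq[OF f'] partial_eq[OF g'] by simp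
qed

text \<open>The rules for derivatives of sums and products hold only at points of \<open>S\<close>;
  this transfers them through the recursion, openness of \<open>S\<close> making the derivatives
  agree as well.\<close>

lemma Cn_on_cong:
  assumes "open S" "\<And>y. y \<in> S \<Longrightarrow> f y = g y" "Cn_on n S f"
  shows "Cn_on n S g"
  using assms(2,3)
proof (induction n arbitrary: f g)
  case 0
  then show ?case using continuous_on_cong by force
next
  case (Suc n)
  then have d: "\<forall>x\<in>S. f differentiable (at x)" "\<And>k. Cn_on n S (partial k f)" by auto
  have "Cn_on n S (partial k g)" for k
    by (rule Suc.IH[OF _ d(2)[of k]])
      (use differentiable_transform_open(2)[of f _ S g k] d(1) assms(1) Suc.prems(1) in simp)
  moreover have "\<forall>x\<in>S. g differentiable (at x)"
    using differentiable_transform_open(1)[of f _ S g] d(1) assms(1) Suc.prems(1) by blast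
  ultimately show ?case by simp
qed

lemma Cn_on_continuous: "Cn_on n S f \<Longrightarrow> continuous_on S f"
  by (cases n) (auto intro!: continuous_at_imp_continuous_on differentiable_imp_continuous_within)

lemma Cn_on_Suc_imp: "Cn_on (Suc n) S f \<Longrightarrow> Cn_on n S f"
proof (induction n arbitrary: f)
  case 0
  then show ?case using Cn_on_continuous[OF 0] by simp
qed auto

lemma partial_add_mult:
  assumes "f differentiable (at x)" "g differentiable (at x)"
  shows "partial k (\<lambda>x. f x + g x) x = partial k f x + partial k g x"
    and "partial k (\<lambda>x. f x * g x) x = f x * partial k g x + partial k f x * g x"
proof -
  obtain f' g' where d: "(f has_derivative f') (at x)" "(g has_derivative g') (at x)"
    using assms by (auto simp: differentiable_def)
  show "partial k (\<lambda>x. f x + g x) x = partial k f x + partial k g x"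
    using partial_eq[OF has_derivative_add[OF d]] partial_eq[OF d(1)] partial_eq[OF d(2)] by simp
  show "partial k (\<lambda>x. f x * g x) x = f x * partial k g x + partial k f x * g x"
    using partial_eq[OF has_derivative_mult[OF d]] partial_eq[OF d(1)] partial_eq[OF d(2)] by simp
qed

lemma Cn_on_add:
  assumes "open S" "Cn_on n S f" "Cn_on n S g"
  shows "Cn_on n S (\<lambda>x. f x + g x)"
  using assms(2,3)
proof (induction n arbitrary: f g)
  case (Suc n)
  have "Cn_on n S (partial k (\<lambda>x. f x + g x))" for k
    by (rule Cn_on_cong[OF assms(1) _ Suc.IH[of "partial k f" "partial k g"]])
      (use Suc.prems partial_add_mult(1)[of f _ g k] in auto)
  then show ?case using Suc.prems by auto
qed (auto intro: continuous_intros)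

lemma Cn_on_mult:
  assumes "open S" "Cn_on n S f" "Cn_on n S g"
  shows "Cn_on n S (\<lambda>x. f x * g x)"
  using assms(2,3)
proof (induction n arbitrary: f g)
  case (Suc n)
  have fg: "Cn_on n S f" "Cn_on n S g" using Suc.prems by (blast intro: Cn_on_Suc_imp)+
  have "Cn_on n S (partial k (\<lambda>x. f x * g x))" for k
    by (rule Cn_on_cong[OF assms(1) _ Cn_on_add[OF assms(1) Suc.IH[of f "partial k g"] Suc.IH[of "partial k f" g]]])
      (use Suc.prems fg partial_add_mult(2)[of f _ g k] in auto)
  then show ?case using Suc.prems by auto
qed (auto intro: continuous_intros)

lemma Cn_on_const: "Cn_on n S (\<lambda>_. c)"
proof (induction n arbitrary: c)
  case (Suc n)
  have "partial k (\<lambda>_. c) = (\<lambda>_. 0)" for k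
    using partial_eq[OF has_derivative_const] by blast
  then show ?case using Suc by simp
qed simp

lemma Cn_on_nth: "Cn_on n S (\<lambda>x. x $ i)"
proof (cases n)
  case (Suc m)
  have d: "((\<lambda>x::heis. x $ i) has_derivative (\<lambda>x. x $ i)) (at x)" for x
    by (simp add: bounded_linear_imp_has_derivative bounded_linear_vec_nth)
  have "partial k (\<lambda>x. x $ i) = (\<lambda>_. axis k 1 $ i)" for k
    using partial_eq[OF d] by blast
  then show ?thesis using Suc d Cn_on_const by (auto simp: differentiable_def)
qed (auto intro: continuous_intros)

lemma smooth_fun_on_partial: "smooth_fun_on S f \<Longrightarrow> smooth_fun_on S (partial k f)"
  unfolding smooth_fun_on_def by (metis Cn_on.simps(2))

lemma smooth_fun_on_hor:
  assumes "open S" "smooth_fun_on S f"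
  shows "smooth_fun_on S (hor i f)"
  unfolding smooth_fun_on_def
proof
  fix n
  have P: "Cn_on n S (partial k f)" for k
    using smooth_fun_on_partial[OF assms(2)] by (auto simp: smooth_fun_on_def)
  have "Cn_on n S (\<lambda>x. partial 1 f x + (-1/2) * x$2 * partial 3 f x)"
    by (intro Cn_on_add Cn_on_mult assms(1) P Cn_on_const Cn_on_nth)
  moreover have "Cn_on n S (\<lambda>x. partial 2 f x + (1/2) * x$1 * partial 3 f x)"
    by (intro Cn_on_add Cn_on_mult assms(1) P Cn_on_const Cn_on_nth)
  moreover have "hor i f = (if i = 1 then (\<lambda>x. partial 1 f x + (-1/2) * x$2 * partial 3 f x)
      else (\<lambda>x. partial 2 f x + (1/2) * x$1 * partial 3 f x))"
    by (auto simp: hor_def fun_eq_iff)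
  ultimately show "Cn_on n S (hor i f)" by simp
qed

lemma smooth_fun_on_differentiable: "smooth_fun_on S f \<Longrightarrow> x \<in> S \<Longrightarrow> f differentiable (at x)"
  unfolding smooth_fun_on_def by (metis Cn_on.simps(2))

lemma smooth_fun_on_continuous: "smooth_fun_on S f \<Longrightarrow> continuous_on S f"
  unfolding smooth_fun_on_def using Cn_on_continuous by blast

text \<open>In the frame of the two horizontal fields and the vertical one, taken at the moving
  point, the velocity has coefficients \<open>z$1\<close>, \<open>z$2\<close> and
  \<open>2 * t * z$3\<close>: the contributions \<open>t * z$1 * z$2\<close> of the two horizontal
  fields cancel.\<close>

lemma DERIV_along_move:
  assumes "f differentiable (at (move x t z))"
  shows "((\<lambda>t. f (move x t z)) has_real_derivative
    z$1 * hor 1 f (move x t z) + z$2 * hor 2 f (move x t z) + 2 * t * z$3 * partial 3 f (move x t z)) (at t)"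
proof -
  define v :: heis where "v = vector [z$1, z$2, 2 * t * z$3 + (x$1 * z$2 - x$2 * z$1) / 2]"
  obtain f' where f': "(f has_derivative f') (at (move x t z))" using assms by (auto simp: differentiable_def)
  interpret f': bounded_linear f' using f' by (rule has_derivative_bounded_linear)
  have "((\<lambda>t. move x t z) has_vector_derivative v) (at t)"
  proof -
    have "((\<lambda>t. x + t *\<^sub>R (vector [z$1, z$2, (x$1 * z$2 - x$2 * z$1) / 2] :: heis) + t\<^sup>2 *\<^sub>R (vector [0, 0, z$3] :: heis))
      has_vector_derivative v) (at t)"
      by (auto intro!: derivative_eq_intros simp: v_def vec_eq_iff forall_3)
    also have "(\<lambda>t. x + t *\<^sub>R (vector [z$1, z$2, (x$1 * z$2 - x$2 * z$1) / 2] :: heis) + t\<^sup>2 *\<^sub>R (vector [0, 0, z$3] :: heis))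
      = (\<lambda>t. move x t z)"
      by (simp add: fun_eq_iff vec_eq_iff forall_3 move_nth algebra_simps)
    finally show ?thesis .
  qed
  then have "((\<lambda>t. f (move x t z)) has_derivative (\<lambda>h. f' (h *\<^sub>R v))) (at t)"
    unfolding has_vector_derivative_def
    by (rule has_derivative_compose[where f = "\<lambda>t. move x t z" and g = f and g' = f', OF _ f'])
  moreover have "(\<lambda>h. f' (h *\<^sub>R v)) = (*) (f' v)" by (simp add: fun_eq_iff f'.scaleR)
  ultimately have "((\<lambda>t. f (move x t z)) has_real_derivative f' v) (at t)"
    by (simp add: has_field_derivative_def)
  moreover have "v = v$1 *\<^sub>R axis 1 1 + v$2 *\<^sub>R axis 2 1 + v$3 *\<^sub>R axis 3 1"
    by (simp add: vec_eq_iff forall_3 axis_def)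
  then have "f' v = v$1 * partial 1 f (move x t z) + v$2 * partial 2 f (move x t z) + v$3 * partial 3 f (move x t z)"
    using partial_eq[OF f'] by (metis f'.add f'.scaleR real_scaleR_def)
  then have "f' v = z$1 * hor 1 f (move x t z) + z$2 * hor 2 f (move x t z) + 2 * t * z$3 * partial 3 f (move x t z)"
    by (simp add: v_def hor_def move_nth field_simps)
  ultimately show ?thesis by simp
qed

text \<open>A Euclidean bound, used to keep short moves from a compact set inside an open
  one.\<close>

lemma norm_move_diff:
  assumes "z \<in> korb" "0 \<le> t" "t \<le> 1" "\<bar>x$1\<bar> \<le> M" "\<bar>x$2\<bar> \<le> M"
  shows "norm (move x t z - x) \<le> t * (3 + M)"
proof -
  note kb = korb_bounds[OF assms(1)]
  have "norm (move x t z - x) \<le> (\<Sum>i\<in>UNIV. \<bar>(move x t z - x) $ i\<bar>)" by (rule norm_le_l1_cart)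
  also have "\<dots> = \<bar>t * z$1\<bar> + \<bar>t * z$2\<bar> + \<bar>t * (t * z$3 + (x$1 * z$2 - x$2 * z$1) / 2)\<bar>"
    by (simp add: sum_3 move_nth algebra_simps power2_eq_square)
  also have "\<dots> = t * (\<bar>z$1\<bar> + \<bar>z$2\<bar> + \<bar>t * z$3 + (x$1 * z$2 - x$2 * z$1) / 2\<bar>)"
  proof -
    have "\<bar>t * w\<bar> = t * \<bar>w\<bar>" for w using assms(2) by (simp add: abs_mult)
    then show ?thesis by (simp only:) (simp only: distrib_left)
  qed
  also have "\<dots> \<le> t * (3 + M)"
  proof (rule mult_left_mono)
    have "\<bar>t * z$3\<bar> \<le> 1 * 1" "\<bar>x$1 * z$2\<bar> \<le> M * 1" "\<bar>x$2 * z$1\<bar> \<le> M * 1"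
      by (rule abs_mult_le_bound assms kb | use assms in simp)+
    moreover have "\<bar>A + (B - C) / 2\<bar> \<le> 1 + M" if "\<bar>A\<bar> \<le> 1" "\<bar>B\<bar> \<le> M" "\<bar>C\<bar> \<le> M" for A B C
      using that by (simp add: abs_le_iff field_simps)
    ultimately have "\<bar>t * z$3 + (x$1 * z$2 - x$2 * z$1) / 2\<bar> \<le> 1 + M" by simp
    then show "\<bar>z$1\<bar> + \<bar>z$2\<bar> + \<bar>t * z$3 + (x$1 * z$2 - x$2 * z$1) / 2\<bar> \<le> 3 + M"
      using kb by linarith
  qed (rule assms)
  finally show ?thesis .
qed

text \<open>All points that can be reached from \<open>X\<close> within gauge distance
  \<open>\<delta>\<close>. As a continuous image of a compact product it is compact, so derivatives
  of smooth functions are bounded on it.\<close>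

definition moves :: "heis set \<Rightarrow> real \<Rightarrow> heis set" where
  "moves X \<delta> = (\<lambda>(x, t, z). move x t z) ` (X \<times> {0..\<delta>} \<times> korb)"

lemma move_in_moves: "x \<in> X \<Longrightarrow> z \<in> korb \<Longrightarrow> 0 \<le> t \<Longrightarrow> t \<le> \<delta> \<Longrightarrow> move x t z \<in> moves X \<delta>"
  unfolding moves_def by force

lemma compact_moves: "compact X \<Longrightarrow> compact (moves X \<delta>)"
  unfolding moves_def
  by (intro compact_continuous_image compact_Times compact_korb compact_Icc)
    (auto simp: case_prod_unfold intro!: continuous_intros)

lemma bounded_on_compact:
  fixes f :: "'a::topological_space \<Rightarrow> real"
  assumes "compact P" "P \<subseteq> S" "continuous_on S f"
  obtains C where "C > 0" "\<forall>y\<in>P. \<bar>f y\<bar> \<le> C"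
proof -
  have "bounded (f ` P)"
    using assms by (intro compact_imp_bounded compact_continuous_image) (auto intro: continuous_on_subset)
  then show ?thesis using that by (auto simp: bounded_pos)
qed

lemma move_compact_subset:
  assumes "compact X" "open S" "X \<subseteq> S"
  obtains \<delta> where "0 < \<delta>" "\<delta> \<le> 1" "moves X \<delta> \<subseteq> S"
proof -
  obtain e where e: "e > 0" "(\<Union>x\<in>X. ball x e) \<subseteq> S"
    using compact_subset_open_imp_ball_epsilon_subset[OF assms] by blast
  obtain M where M: "M > 0" "\<And>x. x \<in> X \<Longrightarrow> norm x \<le> M"
    using compact_imp_bounded[OF assms(1)] by (auto simp: bounded_pos)
  define \<delta> where "\<delta> = min 1 (e / (2 * (3 + M)))"
  show ?thesis
  proof (rule that)
    show "0 < \<delta>" "\<delta> \<le> 1" using e M by (auto simp: \<delta>_def)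
    have "move x t z \<in> S" if *: "x \<in> X" "z \<in> korb" "0 \<le> t" "t \<le> \<delta>" for x z t
    proof -
    have "norm (move x t z - x) \<le> t * (3 + M)"
      using * M(2)[OF *(1)] component_le_norm_cart[of x 1] component_le_norm_cart[of x 2] \<open>\<delta> \<le> 1\<close>
      by (intro norm_move_diff) auto
    also have "\<dots> \<le> e / (2 * (3 + M)) * (3 + M)"
      using * M(1) by (intro mult_right_mono) (auto simp: \<delta>_def)
    also have "\<dots> = e / 2"
    proof -
      have "3 + M \<noteq> 0" using M(1) by simp
      moreover have "e / (2 * c) * c = e / 2" if "c \<noteq> 0" for c using that by simp
      ultimately show ?thesis by blast
    qed
    also have "\<dots> < e" using e by simp
    finally have "move x t z \<in> ball x e" by (simp add: dist_norm norm_minus_commute)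
    then show ?thesis using e(2) *(1) by blast
    qed
    then show "moves X \<delta> \<subseteq> S" by (auto simp: moves_def)
  qed
qed

lemma move_0 [simp]: "move x 0 z = x"
  by (simp add: vec_eq_iff forall_3 move_nth)

text \<open>Mean value inequality along the curve. Applied to second derivatives, it compares the
  intermediate point of Taylor's formula with \<open>x\<close>.\<close>

lemma increment_along_move:
  assumes X: "compact X" and S: "open S" and f: "smooth_fun_on S f"
    and mv: "moves X \<delta> \<subseteq> S" and \<delta>: "\<delta> \<le> 1"
  obtains C where "C > 0" "\<forall>x\<in>X. \<forall>z\<in>korb. \<forall>t\<in>{0..\<delta>}. \<bar>f (move x t z) - f x\<bar> \<le> C * t"
proof -
  note bd = bounded_on_compact[OF compact_moves[OF X] mv smooth_fun_on_continuous]
  obtain C1 where C1: "C1 > 0" "\<forall>y\<in>moves X \<delta>. \<bar>hor 1 f y\<bar> \<le> C1"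
    by (rule bd[OF smooth_fun_on_hor[OF S f]])
  obtain C2 where C2: "C2 > 0" "\<forall>y\<in>moves X \<delta>. \<bar>hor 2 f y\<bar> \<le> C2"
    by (rule bd[OF smooth_fun_on_hor[OF S f]])
  obtain C3 where C3: "C3 > 0" "\<forall>y\<in>moves X \<delta>. \<bar>partial 3 f y\<bar> \<le> C3"
    by (rule bd[OF smooth_fun_on_partial[OF f]])
  have "\<bar>f (move x t z) - f x\<bar> \<le> (C1 + C2 + 2 * C3) * t"
    if *: "x \<in> X" "z \<in> korb" "0 \<le> t" "t \<le> \<delta>" for x z t
  proof -
    note kb = korb_bounds[OF *(2)]
    let ?d = "\<lambda>s. z$1 * hor 1 f (move x s z) + z$2 * hor 2 f (move x s z) + 2 * s * z$3 * partial 3 f (move x s z)"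
    have "norm (f (move x t z) - f (move x 0 z)) \<le> (C1 + C2 + 2 * C3) * norm (t - 0)"
    proof (rule field_differentiable_bound[where S = "{0..t}" and f = "\<lambda>s. f (move x s z)" and f' = ?d])
      fix s assume s: "s \<in> {0..t}"
      then have m: "move x s z \<in> moves X \<delta>" using * by (intro move_in_moves) auto
      then show "((\<lambda>s. f (move x s z)) has_field_derivative ?d s) (at s within {0..t})"
        using mv by (intro DERIV_subset[OF DERIV_along_move[OF smooth_fun_on_differentiable[OF f]]]) auto
      have "\<bar>2 * s\<bar> \<le> 2" using s * \<delta> by auto
      moreover have "\<bar>hor 1 f (move x s z)\<bar> \<le> C1" "\<bar>hor 2 f (move x s z)\<bar> \<le> C2" "\<bar>partial 3 f (move x s z)\<bar> \<le> C3"
        using C1 C2 C3 m by auto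
      ultimately have "\<bar>z$1 * hor 1 f (move x s z)\<bar> \<le> 1 * C1" "\<bar>z$2 * hor 2 f (move x s z)\<bar> \<le> 1 * C2"
        "\<bar>2 * s * z$3 * partial 3 f (move x s z)\<bar> \<le> 2 * 1 * C3"
        by - (rule kb(2-4) abs_mult_le_bound | assumption)+
      then show "norm (?d s) \<le> C1 + C2 + 2 * C3" unfolding real_norm_def by linarith
    qed (use * in auto)
    then show ?thesis using *(3) by simp
  qed
  then show ?thesis using C1(1) C2(1) C3(1) by (intro that[of "C1 + C2 + 2 * C3"]) auto
qed

text \<open>The symmetrised horizontal second derivatives appear without any appeal to the symmetry of the
  Euclidean second derivatives, because \<^term>\<open>\<lambda>t. move x t z\<close> is, up to its vertical component, an integral
  curve of a left-invariant horizontal field.\<close>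

lemma taylor_along_move:
  assumes X: "compact X" and S: "open S" and u: "smooth_fun_on S u"
    and mv: "moves X \<delta> \<subseteq> S" and \<delta>: "\<delta> \<le> 1"
  obtains C where "C > 0"
    "\<forall>x\<in>X. \<forall>z\<in>korb. \<forall>t\<in>{0..\<delta>}.
      \<bar>u (move x t z) - u x - t * lin (hor 1 u x) (hor 2 u x) z
        - t\<^sup>2 * qform (partial 3 u x) (hor 1 (hor 1 u) x) ((hor 1 (hor 2 u) x + hor 2 (hor 1 u) x) / 2) (hor 2 (hor 2 u) x) z\<bar>
      \<le> C * t ^ 3"
proof -
  let ?X = "\<lambda>i. hor i u" and ?T = "partial 3 u"
  have sm: "smooth_fun_on S (?X i)" "smooth_fun_on S ?T" for i
    using u S by (auto intro: smooth_fun_on_hor smooth_fun_on_partial)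
  have sm2: "smooth_fun_on S (hor j (?X i))" "smooth_fun_on S (partial 3 (?X i))" "smooth_fun_on S (hor i ?T)" "smooth_fun_on S (partial 3 ?T)" for i j
    using sm S by (auto intro: smooth_fun_on_hor smooth_fun_on_partial)
  note inc = increment_along_move[OF X S _ mv \<delta>]
  note bd = bounded_on_compact[OF compact_moves[OF X] mv smooth_fun_on_continuous]
  obtain C11 where C11: "C11 > 0" "\<forall>x\<in>X. \<forall>z\<in>korb. \<forall>t\<in>{0..\<delta>}. \<bar>hor 1 (?X 1) (move x t z) - hor 1 (?X 1) x\<bar> \<le> C11 * t"
    by (rule inc[OF sm2(1)])
  obtain C12 where C12: "C12 > 0" "\<forall>x\<in>X. \<forall>z\<in>korb. \<forall>t\<in>{0..\<delta>}. \<bar>hor 1 (?X 2) (move x t z) - hor 1 (?X 2) x\<bar> \<le> C12 * t"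
    by (rule inc[OF sm2(1)])
  obtain C21 where C21: "C21 > 0" "\<forall>x\<in>X. \<forall>z\<in>korb. \<forall>t\<in>{0..\<delta>}. \<bar>hor 2 (?X 1) (move x t z) - hor 2 (?X 1) x\<bar> \<le> C21 * t"
    by (rule inc[OF sm2(1)])
  obtain C22 where C22: "C22 > 0" "\<forall>x\<in>X. \<forall>z\<in>korb. \<forall>t\<in>{0..\<delta>}. \<bar>hor 2 (?X 2) (move x t z) - hor 2 (?X 2) x\<bar> \<le> C22 * t"
    by (rule inc[OF sm2(1)])
  obtain C3 where C3: "C3 > 0" "\<forall>x\<in>X. \<forall>z\<in>korb. \<forall>t\<in>{0..\<delta>}. \<bar>?T (move x t z) - ?T x\<bar> \<le> C3 * t"
    by (rule inc[OF sm(2)])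
  obtain B1 where B1: "B1 > 0" "\<forall>y\<in>moves X \<delta>. \<bar>partial 3 (?X 1) y\<bar> \<le> B1" by (rule bd[OF sm2(2)])
  obtain B2 where B2: "B2 > 0" "\<forall>y\<in>moves X \<delta>. \<bar>partial 3 (?X 2) y\<bar> \<le> B2" by (rule bd[OF sm2(2)])
  obtain B3 where B3: "B3 > 0" "\<forall>y\<in>moves X \<delta>. \<bar>hor 1 ?T y\<bar> \<le> B3" by (rule bd[OF sm2(3)])
  obtain B4 where B4: "B4 > 0" "\<forall>y\<in>moves X \<delta>. \<bar>hor 2 ?T y\<bar> \<le> B4" by (rule bd[OF sm2(3)])
  obtain B5 where B5: "B5 > 0" "\<forall>y\<in>moves X \<delta>. \<bar>partial 3 ?T y\<bar> \<le> B5" by (rule bd[OF sm2(4)])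
  define C where "C = C11 + C12 + C21 + C22 + 2 * C3 + 2 * (B1 + B2 + B3 + B4 + 2 * B5)"
  have "\<bar>u (move x t z) - u x - t * lin (hor 1 u x) (hor 2 u x) z
        - t\<^sup>2 * qform (partial 3 u x) (hor 1 (hor 1 u) x) ((hor 1 (hor 2 u) x + hor 2 (hor 1 u) x) / 2) (hor 2 (hor 2 u) x) z\<bar>
      \<le> C * t ^ 3" if *: "x \<in> X" "z \<in> korb" "0 \<le> t" "t \<le> \<delta>" for x z t
  proof (cases "t = 0")
    case True
    then show ?thesis by simp
  next
    case False
    note kb = korb_bounds[OF *(2)]
    have m: "move x s z \<in> moves X \<delta>" if "0 \<le> s" "s \<le> t" for s
      using that * by (intro move_in_moves) auto
    define D where "D = (\<lambda>f s. z$1 * hor 1 f (move x s z) + z$2 * hor 2 f (move x s z) + 2 * s * z$3 * partial 3 f (move x s z))"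
    have DD: "((\<lambda>s. f (move x s z)) has_real_derivative D f s) (at s)"
      if "smooth_fun_on S f" "0 \<le> s" "s \<le> t" for f s
      unfolding D_def using m[OF that(2,3)] mv
      by (intro DERIV_along_move smooth_fun_on_differentiable[OF that(1)]) auto
    define d2 where "d2 = (\<lambda>s. z$1 * D (?X 1) s + z$2 * D (?X 2) s + (2 * z$3 * ?T (move x s z) + 2 * s * z$3 * D ?T s))"
    have D2: "(D u has_real_derivative d2 s) (at s)" if "0 \<le> s" "s \<le> t" for s
      unfolding d2_def fun_cong[OF D_def, of u]
      by (rule derivative_eq_intros DD sm that refl)+ simp
    \<comment> \<open>This is the value of \<open>d2\<close> at 0; the mixed second derivatives
      already occur there as a sum with common factor \<open>z$1 * z$2\<close>.\<close>
    define q where "q = 2 * qform (?T x) (hor 1 (?X 1) x) ((hor 1 (?X 2) x + hor 2 (?X 1) x) / 2) (hor 2 (?X 2) x) z"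
    obtain s where s: "0 < s" "s < t" "u (move x t z) - u x - t * D u 0 = d2 s / 2 * t\<^sup>2"
    proof -
      let ?d = "\<lambda>m::nat. if m = 0 then (\<lambda>s. u (move x s z)) else if m = 1 then D u else d2"
      have "\<exists>s>0. s < t \<and> u (move x t z) = (\<Sum>m<2. ?d m 0 / fact m * t ^ m) + ?d 2 s / fact 2 * t ^ 2"
      proof (rule Maclaurin)
        show "\<forall>m s. m < 2 \<and> 0 \<le> s \<and> s \<le> t \<longrightarrow> (?d m has_real_derivative ?d (Suc m) s) (at s)"
          using DD[OF u] D2 by (auto simp: less_2_cases_iff)
      qed (use * False in auto)
      then show ?thesis using that by (auto simp: numeral_2_eq_2)
    qed
    have b: "\<bar>d2 s - q\<bar> \<le> C * s"
    proof -
      have ms: "move x s z \<in> moves X \<delta>" and s01: "s \<in> {0..\<delta>}"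
        using s m * by auto
      let ?y = "move x s z"
      have s2: "\<bar>2 * s\<bar> \<le> 2 * s" "\<bar>2 * s\<bar> \<le> 2" "\<bar>2 :: real\<bar> \<le> 2" using s01 \<delta> by auto
      have Cs: "\<bar>hor 1 (?X 1) ?y - hor 1 (?X 1) x\<bar> \<le> C11 * s" "\<bar>hor 1 (?X 2) ?y - hor 1 (?X 2) x\<bar> \<le> C12 * s"
        "\<bar>hor 2 (?X 1) ?y - hor 2 (?X 1) x\<bar> \<le> C21 * s" "\<bar>hor 2 (?X 2) ?y - hor 2 (?X 2) x\<bar> \<le> C22 * s"
        "\<bar>?T ?y - ?T x\<bar> \<le> C3 * s"
        using C11(2) C12(2) C21(2) C22(2) C3(2) *(1,2) s01(1) by blast+
      have Bs: "\<bar>partial 3 (?X 1) ?y\<bar> \<le> B1" "\<bar>partial 3 (?X 2) ?y\<bar> \<le> B2" "\<bar>hor 1 ?T ?y\<bar> \<le> B3"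
        "\<bar>hor 2 ?T ?y\<bar> \<le> B4" "\<bar>partial 3 ?T ?y\<bar> \<le> B5"
        using B1(2) B2(2) B3(2) B4(2) B5(2) ms by blast+
      have i: "\<bar>z$1 * z$1 * (hor 1 (?X 1) ?y - hor 1 (?X 1) x)\<bar> \<le> 1 * 1 * (C11 * s)"
        "\<bar>z$2 * z$1 * (hor 1 (?X 2) ?y - hor 1 (?X 2) x)\<bar> \<le> 1 * 1 * (C12 * s)"
        "\<bar>z$1 * z$2 * (hor 2 (?X 1) ?y - hor 2 (?X 1) x)\<bar> \<le> 1 * 1 * (C21 * s)"
        "\<bar>z$2 * z$2 * (hor 2 (?X 2) ?y - hor 2 (?X 2) x)\<bar> \<le> 1 * 1 * (C22 * s)"
        "\<bar>2 * z$3 * (?T ?y - ?T x)\<bar> \<le> 2 * 1 * (C3 * s)"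
        by (rule kb(2-4) s2 Cs abs_mult_le_bound)+
      have j: "\<bar>2 * s * (z$1 * z$3 * partial 3 (?X 1) ?y)\<bar> \<le> 2 * s * (1 * 1 * B1)"
        "\<bar>2 * s * (z$2 * z$3 * partial 3 (?X 2) ?y)\<bar> \<le> 2 * s * (1 * 1 * B2)"
        "\<bar>2 * s * (z$3 * z$1 * hor 1 ?T ?y)\<bar> \<le> 2 * s * (1 * 1 * B3)"
        "\<bar>2 * s * (z$3 * z$2 * hor 2 ?T ?y)\<bar> \<le> 2 * s * (1 * 1 * B4)"
        "\<bar>2 * s * (2 * s * (z$3 * z$3 * partial 3 ?T ?y))\<bar> \<le> 2 * s * (2 * (1 * 1 * B5))"
        by (rule kb(2-4) s2 Bs abs_mult_le_bound)+
      \<comment> \<open>Every term is either an increment of a derivative along the curve or carries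
        an explicit factor \<open>s\<close>, so the difference is of order \<open>s\<close>.\<close>
      have eq: "d2 s - q = z$1 * z$1 * (hor 1 (?X 1) ?y - hor 1 (?X 1) x)
        + z$2 * z$1 * (hor 1 (?X 2) ?y - hor 1 (?X 2) x)
        + z$1 * z$2 * (hor 2 (?X 1) ?y - hor 2 (?X 1) x)
        + z$2 * z$2 * (hor 2 (?X 2) ?y - hor 2 (?X 2) x)
        + 2 * z$3 * (?T ?y - ?T x)
        + 2 * s * (z$1 * z$3 * partial 3 (?X 1) ?y)
        + 2 * s * (z$2 * z$3 * partial 3 (?X 2) ?y)
        + 2 * s * (z$3 * z$1 * hor 1 ?T ?y)
        + 2 * s * (z$3 * z$2 * hor 2 ?T ?y)
        + 2 * s * (2 * s * (z$3 * z$3 * partial 3 ?T ?y))"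
        unfolding d2_def D_def q_def qform_def by (simp add: field_simps power2_eq_square)
      have "\<bar>d2 s - q\<bar> \<le> 1 * 1 * (C11 * s) + 1 * 1 * (C12 * s) + 1 * 1 * (C21 * s) + 1 * 1 * (C22 * s) + 2 * 1 * (C3 * s)
        + 2 * s * (1 * 1 * B1) + 2 * s * (1 * 1 * B2) + 2 * s * (1 * 1 * B3) + 2 * s * (1 * 1 * B4) + 2 * s * (2 * (1 * 1 * B5))"
        unfolding eq by (rule i j order_trans[OF abs_triangle_ineq add_mono])+
      also have "\<dots> = C * s" by (simp add: C_def algebra_simps)
      finally show ?thesis .
    qed
    have "\<bar>u (move x t z) - u x - t * lin (hor 1 u x) (hor 2 u x) z - t\<^sup>2 * (q / 2)\<bar> = t\<^sup>2 * (\<bar>d2 s - q\<bar> / 2)"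
    proof -
      have "D u 0 = lin (hor 1 u x) (hor 2 u x) z" by (simp add: D_def lin_def mult.commute)
      then have eq: "u (move x t z) - u x - t * lin (hor 1 u x) (hor 2 u x) z - t\<^sup>2 * (q / 2) = t\<^sup>2 * ((d2 s - q) / 2)"
        using s(3) by (simp add: field_simps)
      show ?thesis unfolding eq by (simp add: abs_mult)
    qed
    also have "\<dots> \<le> t\<^sup>2 * (C * t)"
    proof (rule mult_left_mono)
      have C0: "C > 0" using C11 C12 C21 C22 C3 B1 B2 B3 B4 B5 by (simp add: C_def)
      then have "C * s \<le> C * t" using s by (intro mult_left_mono) auto
      moreover have "0 \<le> C * s" using C0 s by simp
      ultimately have "\<bar>d2 s - q\<bar> \<le> 2 * (C * t)" using b by linarith
      then show "\<bar>d2 s - q\<bar> / 2 \<le> C * t" by simp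
    qed simp
    also have "\<dots> = C * t ^ 3" by (simp add: power2_eq_square power3_eq_cube)
    finally show ?thesis by (simp add: q_def)
  qed
  moreover have "C > 0" using C11 C12 C21 C22 C3 B1 B2 B3 B4 B5 by (simp add: C_def)
  ultimately show ?thesis by (intro that[of C]) auto
qed

text \<open>Multiplying the equation by the squared length of the horizontal gradient clears the
  denominators.\<close>

lemma p_harmonic_pform:
  assumes "normalized_p_laplacian p u x = 0" "hor_grad u x \<noteq> 0"
  shows "pform p (hor 1 u x) (hor 2 u x) (hor 1 (hor 1 u) x) ((hor 1 (hor 2 u) x + hor 2 (hor 1 u) x) / 2) (hor 2 (hor 2 u) x) = 0"
    and "(hor 1 u x)\<^sup>2 + (hor 2 u x)\<^sup>2 > 0"
proof -
  define a b where "a = hor 1 u x" and "b = hor 2 u x"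
  define r where "r = norm (hor_grad u x)"
  have r: "r > 0" using assms(2) by (simp add: r_def)
  have r2: "r\<^sup>2 = a\<^sup>2 + b\<^sup>2"
    unfolding r_def a_def b_def power2_norm_eq_inner
    by (simp add: inner_vec_def sum_2 hor_grad_def power2_eq_square)
  then show "(hor 1 u x)\<^sup>2 + (hor 2 u x)\<^sup>2 > 0" using zero_less_power[OF r, of 2] by (simp add: a_def b_def)
  define m11 m12 m22 where "m11 = hor 1 (hor 1 u) x" and "m12 = (hor 1 (hor 2 u) x + hor 2 (hor 1 u) x) / 2" and "m22 = hor 2 (hor 2 u) x"
  have "(p - 2) * ((m11 * a\<^sup>2 + 2 * m12 * a * b + m22 * b\<^sup>2) / r\<^sup>2) + (m11 + m22) = 0"
  proof -
    let ?n = "(1 / r) *\<^sub>R hor_grad u x"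
    have "(sym_hor_hessian u x *v ?n) \<bullet> ?n = (m11 * a\<^sup>2 + 2 * m12 * a * b + m22 * b\<^sup>2) / r\<^sup>2"
      using r by (simp add: sym_hor_hessian_def matrix_vector_mult_def inner_vec_def sum_2 hor_grad_def
          a_def[symmetric] b_def[symmetric] m11_def m12_def m22_def field_simps power2_eq_square)
    then show ?thesis
      using assms(1) unfolding normalized_p_laplacian_def Let_def r_def[symmetric] hor_laplacian_def m11_def m22_def
      by simp
  qed
  then have "(p - 2) * (m11 * a\<^sup>2 + 2 * m12 * a * b + m22 * b\<^sup>2) + (m11 + m22) * r\<^sup>2 = 0"
    using r by (simp add: field_simps)
  then show "pform p (hor 1 u x) (hor 2 u x) (hor 1 (hor 1 u) x) ((hor 1 (hor 2 u) x + hor 2 (hor 1 u) x) / 2) (hor 2 (hor 2 u) x) = 0"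
    unfolding pform_def r2 m11_def m12_def m22_def a_def b_def by (simp add: mult.commute)
qed

section \<open>The barrier\<close>

text \<open>The coefficients of \<open>t\<close> and \<open>t\<^sup>2\<close> in \<open>(x0 + x1 t + x2 t\<^sup>2 + \<dots>)\<^sup>m\<close>.\<close>

fun pow_c1 :: "real \<Rightarrow> real \<Rightarrow> nat \<Rightarrow> real" where
  "pow_c1 x0 x1 0 = 0"
| "pow_c1 x0 x1 (Suc m) = x0 * pow_c1 x0 x1 m + x1 * x0 ^ m"

fun pow_c2 :: "real \<Rightarrow> real \<Rightarrow> real \<Rightarrow> nat \<Rightarrow> real" where
  "pow_c2 x0 x1 x2 0 = 0"
| "pow_c2 x0 x1 x2 (Suc m) = x0 * pow_c2 x0 x1 x2 m + x1 * pow_c1 x0 x1 m + x2 * x0 ^ m"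

lemma pow_c1_closed: "pow_c1 x0 x1 (Suc m) = real (Suc m) * x0 ^ m * x1"
  by (induction m) (simp_all add: algebra_simps)

lemma pow_c2_closed:
  "pow_c2 x0 x1 x2 (Suc (Suc m)) =
    real (m + 2) * x0 ^ (m + 1) * x2 + real (m + 2) * real (m + 1) / 2 * x0 ^ m * x1\<^sup>2"
proof (induction m)
  case 0
  show ?case by (simp add: power2_eq_square algebra_simps)
next
  case (Suc m)
  have "pow_c2 x0 x1 x2 (Suc (Suc (Suc m))) = x0 * pow_c2 x0 x1 x2 (Suc (Suc m))
    + x1 * pow_c1 x0 x1 (Suc (Suc m)) + x2 * x0 ^ Suc (Suc m)" by simp
  then show ?case unfolding Suc pow_c1_closed by (simp add: field_simps power2_eq_square)
qed

text \<open>Uniform over bounded coefficients, so that \<open>x1\<close>, \<open>x2\<close> and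
  \<open>x3\<close> may vary with the point and the direction. The induction also carries bounds on
  the two coefficients, because the recursion for the remainder multiplies them by
  \<open>x1\<close>, \<open>x2\<close> and \<open>x3\<close>.\<close>

lemma power_taylor:
  assumes "W \<ge> 0"
  obtains C where "C \<ge> 0"
    "\<And>x0 x1 x2 x3 t. \<bar>x0\<bar> \<le> W \<Longrightarrow> \<bar>x1\<bar> \<le> W \<Longrightarrow> \<bar>x2\<bar> \<le> W \<Longrightarrow> \<bar>x3\<bar> \<le> W \<Longrightarrow> 0 \<le> t \<Longrightarrow> t \<le> 1 \<Longrightarrow>
      \<bar>(x0 + t * x1 + t\<^sup>2 * x2 + t ^ 3 * x3) ^ m - x0 ^ m - t * pow_c1 x0 x1 m - t\<^sup>2 * pow_c2 x0 x1 x2 m\<bar> \<le> C * t ^ 3"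
proof -
  have "\<exists>C\<ge>0. \<forall>x0 x1 x2 x3 t. \<bar>x0\<bar> \<le> W \<and> \<bar>x1\<bar> \<le> W \<and> \<bar>x2\<bar> \<le> W \<and> \<bar>x3\<bar> \<le> W \<and> 0 \<le> t \<and> t \<le> 1 \<longrightarrow>
     \<bar>pow_c1 x0 x1 m\<bar> \<le> C \<and> \<bar>pow_c2 x0 x1 x2 m\<bar> \<le> C \<and>
     \<bar>(x0 + t * x1 + t\<^sup>2 * x2 + t ^ 3 * x3) ^ m - x0 ^ m - t * pow_c1 x0 x1 m - t\<^sup>2 * pow_c2 x0 x1 x2 m\<bar> \<le> C * t ^ 3"
  proof (induction m)
    case 0
    show ?case by (intro exI[of _ 0]) auto
  next
    case (Suc m)
    then obtain C where C: "C \<ge> 0" "\<And>x0 x1 x2 x3 t. \<bar>x0\<bar> \<le> W \<Longrightarrow> \<bar>x1\<bar> \<le> W \<Longrightarrow> \<bar>x2\<bar> \<le> W \<Longrightarrow> \<bar>x3\<bar> \<le> W \<Longrightarrow> 0 \<le> t \<Longrightarrow> t \<le> 1 \<Longrightarrow>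
       \<bar>pow_c1 x0 x1 m\<bar> \<le> C \<and> \<bar>pow_c2 x0 x1 x2 m\<bar> \<le> C \<and>
       \<bar>(x0 + t * x1 + t\<^sup>2 * x2 + t ^ 3 * x3) ^ m - x0 ^ m - t * pow_c1 x0 x1 m - t\<^sup>2 * pow_c2 x0 x1 x2 m\<bar> \<le> C * t ^ 3"
      by blast
    \<comment> \<open>Of the nine copies of \<open>W * C\<close>, five bound \<open>P\<close> below,
      together with one \<open>W * W ^ m\<close>, and four come from
      \<open>\<bar>X\<bar> \<le> 4 * W\<close> times the old remainder.\<close>
    define C' where "C' = 9 * W * C + 3 * W * W ^ m"
    show ?case
    proof (intro exI[of _ C'] conjI allI impI)
      show "C' \<ge> 0" using C(1) assms by (simp add: C'_def)
      fix x0 x1 x2 x3 t :: real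
      assume "\<bar>x0\<bar> \<le> W \<and> \<bar>x1\<bar> \<le> W \<and> \<bar>x2\<bar> \<le> W \<and> \<bar>x3\<bar> \<le> W \<and> 0 \<le> t \<and> t \<le> 1"
      then have b: "\<bar>x0\<bar> \<le> W" "\<bar>x1\<bar> \<le> W" "\<bar>x2\<bar> \<le> W" "\<bar>x3\<bar> \<le> W" and t: "0 \<le> t" "t \<le> 1" by auto
      define c1 c2 where "c1 = pow_c1 x0 x1 m" and "c2 = pow_c2 x0 x1 x2 m"
      define X where "X = x0 + t * x1 + t\<^sup>2 * x2 + t ^ 3 * x3"
      define e where "e = X ^ m - x0 ^ m - t * c1 - t\<^sup>2 * c2"
      have c: "\<bar>c1\<bar> \<le> C" "\<bar>c2\<bar> \<le> C" "\<bar>e\<bar> \<le> C * t ^ 3"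
        using C(2)[OF b t] by (auto simp: c1_def c2_def e_def X_def)
      have x0m: "\<bar>x0 ^ m\<bar> \<le> W ^ m" unfolding power_abs using b by (intro power_mono) auto
      have tp: "\<bar>t\<bar> \<le> 1" "\<bar>t\<^sup>2\<bar> \<le> 1" "\<bar>t ^ 3\<bar> \<le> 1" "\<bar>t ^ 3\<bar> \<le> t ^ 3" using t by (auto simp: power_le_one)
      have WC: "0 \<le> W * C" "0 \<le> W * W ^ m" using assms C(1) by auto
      have i: "\<bar>x0 * c1\<bar> \<le> W * C" "\<bar>x1 * x0 ^ m\<bar> \<le> W * W ^ m" "\<bar>x0 * c2\<bar> \<le> W * C" "\<bar>x1 * c1\<bar> \<le> W * C"
        "\<bar>x2 * x0 ^ m\<bar> \<le> W * W ^ m" "\<bar>x3 * x0 ^ m\<bar> \<le> W * W ^ m" "\<bar>x1 * c2\<bar> \<le> W * C" "\<bar>x2 * c1\<bar> \<le> W * C"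
        "\<bar>t * (x2 * c2)\<bar> \<le> 1 * (W * C)" "\<bar>t * (x3 * c1)\<bar> \<le> 1 * (W * C)" "\<bar>t\<^sup>2 * (x3 * c2)\<bar> \<le> 1 * (W * C)"
        "\<bar>t * x1\<bar> \<le> 1 * W" "\<bar>t\<^sup>2 * x2\<bar> \<le> 1 * W" "\<bar>t ^ 3 * x3\<bar> \<le> 1 * W"
        by (rule b c tp x0m abs_mult_le_bound)+
      show "\<bar>pow_c1 x0 x1 (Suc m)\<bar> \<le> C'"
        using i(1,2) WC by (simp add: C'_def c1_def)
      show "\<bar>pow_c2 x0 x1 x2 (Suc m)\<bar> \<le> C'"
        using i(3,4,5) WC by (simp add: C'_def c1_def c2_def)
      have "\<bar>X\<bar> \<le> 4 * W" unfolding X_def using b(1) i(12-14) by linarith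
      then have Xe: "\<bar>X * e\<bar> \<le> 4 * W * (C * t ^ 3)" using c(3) by (rule abs_mult_le_bound)
      \<comment> \<open>The terms of order at least three in the product of \<open>X\<close> with
        the quadratic expansion of \<open>X ^ m\<close>, divided by \<open>t ^ 3\<close>.\<close>
      define P where "P = x3 * x0 ^ m + x1 * c2 + x2 * c1 + t * (x2 * c2) + t * (x3 * c1) + t\<^sup>2 * (x3 * c2)"
      have "\<bar>P\<bar> \<le> 5 * (W * C) + W * W ^ m" unfolding P_def using i(6-11) by linarith
      with tp(4) have tP: "\<bar>t ^ 3 * P\<bar> \<le> t ^ 3 * (5 * (W * C) + W * W ^ m)" by (rule abs_mult_le_bound)
      have "X ^ Suc m - x0 ^ Suc m - t * pow_c1 x0 x1 (Suc m) - t\<^sup>2 * pow_c2 x0 x1 x2 (Suc m) = t ^ 3 * P + X * e"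
      proof -
        have "X ^ Suc m = X * (x0 ^ m + t * c1 + t\<^sup>2 * c2) + X * e" by (simp add: e_def algebra_simps)
        moreover have "X * (x0 ^ m + t * c1 + t\<^sup>2 * c2) - x0 ^ Suc m - t * pow_c1 x0 x1 (Suc m) - t\<^sup>2 * pow_c2 x0 x1 x2 (Suc m) = t ^ 3 * P"
          unfolding X_def P_def by (simp flip: c1_def c2_def) algebra
        ultimately show ?thesis by linarith
      qed
      also have "\<bar>t ^ 3 * P + X * e\<bar> \<le> t ^ 3 * (5 * (W * C) + W * W ^ m) + 4 * W * (C * t ^ 3)"
        using tP Xe by linarith
      also have "\<dots> \<le> C' * t ^ 3"
      proof -
        have "0 \<le> (2 * (W * W ^ m)) * t ^ 3" using assms t by simp
        then show ?thesis by (simp add: C'_def algebra_simps)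
      qed
      finally show "\<bar>(x0 + t * x1 + t\<^sup>2 * x2 + t ^ 3 * x3) ^ Suc m - x0 ^ Suc m - t * pow_c1 x0 x1 (Suc m) - t\<^sup>2 * pow_c2 x0 x1 x2 (Suc m)\<bar> \<le> C' * t ^ 3"
        by (simp add: X_def)
    qed
  qed
  then show ?thesis using that by blast
qed

text \<open>\<open>(gr1, gr2)\<close> is the horizontal gradient of \<^const>\<open>gauge4\<close>.\<close>

definition gr1 :: "heis \<Rightarrow> real" where
  "gr1 y = 4 * y$1 * ((y$1)\<^sup>2 + (y$2)\<^sup>2) - 16 * y$2 * y$3"

definition gr2 :: "heis \<Rightarrow> real" where
  "gr2 y = 4 * y$2 * ((y$1)\<^sup>2 + (y$2)\<^sup>2) + 16 * y$1 * y$3"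

text \<open>The gradient degenerates exactly on the vertical axis. This is what the position of the
  centre of the barrier avoids.\<close>

lemma gr_norm: "(gr1 y)\<^sup>2 + (gr2 y)\<^sup>2 = 16 * ((y$1)\<^sup>2 + (y$2)\<^sup>2) * gauge4 y"
  unfolding gr1_def gr2_def gauge4_def by algebra

text \<open>Exact, as \<open>gauge4\<close> is a polynomial. In the second-order term the squared
  scalar and cross products of the horizontal parts occur with the same factor 4 and add up by
  Lagrange's identity; with a further factor 2 this gives the 6.\<close>

lemma gauge4_move:
  "gauge4 (move y t z) = gauge4 y + t * lin (gr1 y) (gr2 y) z
    + t\<^sup>2 * (32 * y$3 * z$3 + 6 * ((y$1)\<^sup>2 + (y$2)\<^sup>2) * ((z$1)\<^sup>2 + (z$2)\<^sup>2))
    + t ^ 3 * (4 * (y$1 * z$1 + y$2 * z$2) * ((z$1)\<^sup>2 + (z$2)\<^sup>2) + 16 * (y$1 * z$2 - y$2 * z$1) * z$3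
        + t * (((z$1)\<^sup>2 + (z$2)\<^sup>2)\<^sup>2 + 16 * (z$3)\<^sup>2))"
proof -
  have 3: "16 * (y$3 + t\<^sup>2 * z$3 + t * (y$1 * z$2 - y$2 * z$1) / 2)\<^sup>2 = 4 * (2 * y$3 + 2 * t\<^sup>2 * z$3 + t * (y$1 * z$2 - y$2 * z$1))\<^sup>2"
    by (simp add: power2_eq_square field_simps)
  show ?thesis
    unfolding gauge4_def move_nth 3 lin_def gr1_def gr2_def by algebra
qed

text \<open>The chain rule for the power \<open>m + 2\<close>: the symmetrised Hessian of
  \<open>gauge4\<close> is \<open>12 * ((y$1)\<^sup>2 + (y$2)\<^sup>2)\<close> times the identity,
  and the outer second derivative adds a rank-one matrix along the gradient. The prefactor of the
  rank-one part is quadratic in \<open>m\<close>, those of the gradient and of the other Hessian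
  part are linear.\<close>

lemma gauge4_power_taylor:
  assumes X: "compact X"
  obtains C where "C \<ge> 0"
    "\<forall>y\<in>X. \<forall>z\<in>korb. \<forall>t\<in>{0..1}.
      \<bar>gauge4 (move y t z) ^ (m + 2) - gauge4 y ^ (m + 2)
        - t * lin (real (m + 2) * gauge4 y ^ (m + 1) * gr1 y) (real (m + 2) * gauge4 y ^ (m + 1) * gr2 y) z
        - t\<^sup>2 * qform (real (m + 2) * gauge4 y ^ (m + 1) * (32 * y$3))
            (real (m + 2) * gauge4 y ^ (m + 1) * (12 * ((y$1)\<^sup>2 + (y$2)\<^sup>2)) + real (m + 2) * real (m + 1) * gauge4 y ^ m * (gr1 y)\<^sup>2)
            (real (m + 2) * real (m + 1) * gauge4 y ^ m * (gr1 y * gr2 y))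
            (real (m + 2) * gauge4 y ^ (m + 1) * (12 * ((y$1)\<^sup>2 + (y$2)\<^sup>2)) + real (m + 2) * real (m + 1) * gauge4 y ^ m * (gr2 y)\<^sup>2) z\<bar>
      \<le> C * t ^ 3"
proof -
  let ?P = "X \<times> {0..1::real} \<times> korb"
  have P: "compact ?P" by (intro compact_Times X compact_korb compact_Icc)
  define f0 f1 f2 f3 :: "heis \<times> real \<times> heis \<Rightarrow> real" where
    "f0 = (\<lambda>(y, t, z). gauge4 y)"
    and "f1 = (\<lambda>(y, t, z). lin (gr1 y) (gr2 y) z)"
    and "f2 = (\<lambda>(y, t, z). 32 * y$3 * z$3 + 6 * ((y$1)\<^sup>2 + (y$2)\<^sup>2) * ((z$1)\<^sup>2 + (z$2)\<^sup>2))"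
    and "f3 = (\<lambda>(y, t, z). 4 * (y$1 * z$1 + y$2 * z$2) * ((z$1)\<^sup>2 + (z$2)\<^sup>2) + 16 * (y$1 * z$2 - y$2 * z$1) * z$3
        + t * (((z$1)\<^sup>2 + (z$2)\<^sup>2)\<^sup>2 + 16 * (z$3)\<^sup>2))"
  have cont: "continuous_on ?P f0" "continuous_on ?P f1" "continuous_on ?P f2" "continuous_on ?P f3"
    unfolding f0_def f1_def f2_def f3_def case_prod_unfold gauge4_def lin_def gr1_def gr2_def
    by (intro continuous_intros)+
  obtain W0 where W0: "W0 > 0" "\<forall>w\<in>?P. \<bar>f0 w\<bar> \<le> W0" by (rule bounded_on_compact[OF P order_refl cont(1)])
  obtain W1 where W1: "W1 > 0" "\<forall>w\<in>?P. \<bar>f1 w\<bar> \<le> W1" by (rule bounded_on_compact[OF P order_refl cont(2)])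
  obtain W2 where W2: "W2 > 0" "\<forall>w\<in>?P. \<bar>f2 w\<bar> \<le> W2" by (rule bounded_on_compact[OF P order_refl cont(3)])
  obtain W3 where W3: "W3 > 0" "\<forall>w\<in>?P. \<bar>f3 w\<bar> \<le> W3" by (rule bounded_on_compact[OF P order_refl cont(4)])
  define W where "W = W0 + W1 + W2 + W3"
  have W: "W \<ge> 0" using W0 W1 W2 W3 by (simp add: W_def)
  obtain C where C: "C \<ge> 0" "\<And>x0 x1 x2 x3 t. \<bar>x0\<bar> \<le> W \<Longrightarrow> \<bar>x1\<bar> \<le> W \<Longrightarrow> \<bar>x2\<bar> \<le> W \<Longrightarrow> \<bar>x3\<bar> \<le> W \<Longrightarrow> 0 \<le> t \<Longrightarrow> t \<le> 1 \<Longrightarrow>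
      \<bar>(x0 + t * x1 + t\<^sup>2 * x2 + t ^ 3 * x3) ^ (m + 2) - x0 ^ (m + 2) - t * pow_c1 x0 x1 (m + 2) - t\<^sup>2 * pow_c2 x0 x1 x2 (m + 2)\<bar> \<le> C * t ^ 3"
    by (rule power_taylor[OF W, of "m + 2"]) (rule that, assumption+)
  show ?thesis
  proof (rule that[OF C(1)], intro ballI)
    fix y z t assume *: "y \<in> X" "z \<in> korb" "t \<in> {0..1::real}"
    then have w: "(y, t, z) \<in> ?P" by auto
    have b: "\<bar>f0 (y, t, z)\<bar> \<le> W" "\<bar>f1 (y, t, z)\<bar> \<le> W" "\<bar>f2 (y, t, z)\<bar> \<le> W" "\<bar>f3 (y, t, z)\<bar> \<le> W"
      using bspec[OF W0(2) w] bspec[OF W1(2) w] bspec[OF W2(2) w] bspec[OF W3(2) w] W0(1) W1(1) W2(1) W3(1)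
      by (simp_all add: W_def)
    have mv: "gauge4 (move y t z) = f0 (y, t, z) + t * f1 (y, t, z) + t\<^sup>2 * f2 (y, t, z) + t ^ 3 * f3 (y, t, z)"
      unfolding gauge4_move by (simp add: f0_def f1_def f2_def f3_def)
    have c1: "pow_c1 (f0 (y, t, z)) (f1 (y, t, z)) (m + 2) = lin (real (m + 2) * gauge4 y ^ (m + 1) * gr1 y) (real (m + 2) * gauge4 y ^ (m + 1) * gr2 y) z"
      using pow_c1_closed[of "f0 (y, t, z)" "f1 (y, t, z)" "m + 1"] by (simp add: f0_def f1_def lin_def algebra_simps)
    have c2: "pow_c2 (f0 (y, t, z)) (f1 (y, t, z)) (f2 (y, t, z)) (m + 2) = qform (real (m + 2) * gauge4 y ^ (m + 1) * (32 * y$3))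
            (real (m + 2) * gauge4 y ^ (m + 1) * (12 * ((y$1)\<^sup>2 + (y$2)\<^sup>2)) + real (m + 2) * real (m + 1) * gauge4 y ^ m * (gr1 y)\<^sup>2)
            (real (m + 2) * real (m + 1) * gauge4 y ^ m * (gr1 y * gr2 y))
            (real (m + 2) * gauge4 y ^ (m + 1) * (12 * ((y$1)\<^sup>2 + (y$2)\<^sup>2)) + real (m + 2) * real (m + 1) * gauge4 y ^ m * (gr2 y)\<^sup>2) z"
    proof -
      have "pow_c2 x0 x1 x2 (m + 2) = real (m + 2) * x0 ^ (m + 1) * x2 + real (m + 2) * real (m + 1) / 2 * x0 ^ m * x1\<^sup>2" for x0 x1 x2
        using pow_c2_closed[of x0 x1 x2 m] by simp
      moreover define A B where "A = real (m + 2) * gauge4 y ^ (m + 1)" and "B = real (m + 2) * real (m + 1) * gauge4 y ^ m"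
      ultimately have "pow_c2 (f0 (y, t, z)) (f1 (y, t, z)) (f2 (y, t, z)) (m + 2) = A * f2 (y, t, z) + B / 2 * (f1 (y, t, z))\<^sup>2"
        by (simp add: f0_def)
      also have "\<dots> = qform (A * (32 * y$3)) (A * (12 * ((y$1)\<^sup>2 + (y$2)\<^sup>2)) + B * (gr1 y)\<^sup>2)
            (B * (gr1 y * gr2 y)) (A * (12 * ((y$1)\<^sup>2 + (y$2)\<^sup>2)) + B * (gr2 y)\<^sup>2) z"
        unfolding f1_def f2_def lin_def qform_def by (simp add: field_simps power2_eq_square)
      finally show ?thesis by (simp only: A_def B_def)
    qed
    show "\<bar>gauge4 (move y t z) ^ (m + 2) - gauge4 y ^ (m + 2)
        - t * lin (real (m + 2) * gauge4 y ^ (m + 1) * gr1 y) (real (m + 2) * gauge4 y ^ (m + 1) * gr2 y) z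
        - t\<^sup>2 * qform (real (m + 2) * gauge4 y ^ (m + 1) * (32 * y$3))
            (real (m + 2) * gauge4 y ^ (m + 1) * (12 * ((y$1)\<^sup>2 + (y$2)\<^sup>2)) + real (m + 2) * real (m + 1) * gauge4 y ^ m * (gr1 y)\<^sup>2)
            (real (m + 2) * real (m + 1) * gauge4 y ^ m * (gr1 y * gr2 y))
            (real (m + 2) * gauge4 y ^ (m + 1) * (12 * ((y$1)\<^sup>2 + (y$2)\<^sup>2)) + real (m + 2) * real (m + 1) * gauge4 y ^ m * (gr2 y)\<^sup>2) z\<bar>
      \<le> C * t ^ 3"
      using C(2)[OF b, of t] *(3) unfolding mv[symmetric] c1 c2 by (simp add: f0_def)
  qed
qed

text \<open>\<open>pform\<close> is a cubic polynomial, so the expansion in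
  \<open>\<epsilon>\<close> is finite. The coefficient of the first power is its linearisation;
  those of the second and third powers are at least \<open>- 12 * (p - 1) * W ^ 3\<close> and
  \<open>- 4 * (p - 1) * W ^ 3\<close>.\<close>

lemma pform_perturb:
  assumes p: "p > 2" and \<epsilon>: "0 \<le> \<epsilon>" "\<epsilon> \<le> 1"
    and W: "\<bar>a\<bar> \<le> W" "\<bar>b\<bar> \<le> W" "\<bar>m11\<bar> \<le> W" "\<bar>m12\<bar> \<le> W" "\<bar>m22\<bar> \<le> W"
      "\<bar>\<alpha>\<bar> \<le> W" "\<bar>\<beta>\<bar> \<le> W" "\<bar>n11\<bar> \<le> W" "\<bar>n12\<bar> \<le> W" "\<bar>n22\<bar> \<le> W"
  shows "pform p a b m11 m12 m22
      + \<epsilon> * (pform p a b n11 n12 n22 + ((p - 2) * (2 * (m11 * a * \<alpha>) + 2 * (m12 * a * \<beta>) + 2 * (m12 * b * \<alpha>) + 2 * (m22 * b * \<beta>))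
          + 2 * (m11 * a * \<alpha> + m11 * b * \<beta> + m22 * a * \<alpha> + m22 * b * \<beta>)))
      - \<epsilon>\<^sup>2 * (16 * (p - 1) * W ^ 3)
    \<le> pform p (a + \<epsilon> * \<alpha>) (b + \<epsilon> * \<beta>) (m11 + \<epsilon> * n11) (m12 + \<epsilon> * n12) (m22 + \<epsilon> * n22)"
proof -
  define Z where "Z = W * W * W"
  have t: "\<bar>x * y * z\<bar> \<le> Z" if "\<bar>x\<bar> \<le> W" "\<bar>y\<bar> \<le> W" "\<bar>z\<bar> \<le> W" for x y z
    unfolding Z_def by (rule abs_mult_le_bound that)+
  have Z0: "Z \<ge> 0" using t[OF W(1) W(1) W(1)] by linarith
  define S1 where "S1 = m11 * \<alpha> * \<alpha> + 2 * (m12 * \<alpha> * \<beta>) + m22 * \<beta> * \<beta> + 2 * (n11 * a * \<alpha>) + 2 * (n12 * a * \<beta>) + 2 * (n12 * b * \<alpha>) + 2 * (n22 * b * \<beta>)"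
  define S2 where "S2 = m11 * \<alpha> * \<alpha> + m11 * \<beta> * \<beta> + m22 * \<alpha> * \<alpha> + m22 * \<beta> * \<beta>
    + 2 * (n11 * a * \<alpha>) + 2 * (n11 * b * \<beta>) + 2 * (n22 * a * \<alpha>) + 2 * (n22 * b * \<beta>)"
  define S3 where "S3 = n11 * \<alpha> * \<alpha> + 2 * (n12 * \<alpha> * \<beta>) + n22 * \<beta> * \<beta>"
  define S4 where "S4 = n11 * \<alpha> * \<alpha> + n11 * \<beta> * \<beta> + n22 * \<alpha> * \<alpha> + n22 * \<beta> * \<beta>"
  have S: "- S1 \<le> 12 * Z" "- S2 \<le> 12 * Z" "- S3 \<le> 4 * Z" "- S4 \<le> 4 * Z"
    unfolding S1_def S2_def S3_def S4_def
    using t[OF W(3) W(6) W(6)] t[OF W(4) W(6) W(7)] t[OF W(5) W(7) W(7)] t[OF W(8) W(1) W(6)] t[OF W(9) W(1) W(7)]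
      t[OF W(9) W(2) W(6)] t[OF W(10) W(2) W(7)] t[OF W(3) W(7) W(7)] t[OF W(5) W(6) W(6)] t[OF W(8) W(2) W(7)]
      t[OF W(10) W(1) W(6)] t[OF W(8) W(6) W(6)] t[OF W(9) W(6) W(7)] t[OF W(10) W(7) W(7)] t[OF W(8) W(7) W(7)] t[OF W(10) W(6) W(6)]
    unfolding abs_le_iff by linarith+
  define E2 where "E2 = (p - 2) * S1 + S2"
  define E3 where "E3 = (p - 2) * S3 + S4"
  have "(p - 2) * (- S1) \<le> (p - 2) * (12 * Z)" "(p - 2) * (- S3) \<le> (p - 2) * (4 * Z)"
    by (rule mult_left_mono[OF S(1)] mult_left_mono[OF S(3)], use p in simp)+
  then have E: "- E2 \<le> 12 * (p - 1) * Z" "- E3 \<le> 4 * (p - 1) * Z"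
    unfolding E2_def E3_def using S by (auto simp: algebra_simps)
  have "\<epsilon> * (- E3) \<le> \<epsilon> * (4 * (p - 1) * Z)" using E(2) \<epsilon> by (intro mult_left_mono) auto
  also have "\<dots> \<le> 1 * (4 * (p - 1) * Z)" using \<epsilon> p Z0 by (intro mult_right_mono) auto
  finally have "- E2 + \<epsilon> * (- E3) \<le> 16 * (p - 1) * Z" using E(1) by (simp add: algebra_simps)
  then have "\<epsilon>\<^sup>2 * (- E2 + \<epsilon> * (- E3)) \<le> \<epsilon>\<^sup>2 * (16 * (p - 1) * Z)" by (intro mult_left_mono) auto
  moreover have "pform p (a + \<epsilon> * \<alpha>) (b + \<epsilon> * \<beta>) (m11 + \<epsilon> * n11) (m12 + \<epsilon> * n12) (m22 + \<epsilon> * n22)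
    = pform p a b m11 m12 m22
      + \<epsilon> * (pform p a b n11 n12 n22 + ((p - 2) * (2 * (m11 * a * \<alpha>) + 2 * (m12 * a * \<beta>) + 2 * (m12 * b * \<alpha>) + 2 * (m22 * b * \<beta>))
          + 2 * (m11 * a * \<alpha> + m11 * b * \<beta> + m22 * a * \<alpha> + m22 * b * \<beta>)))
      - \<epsilon>\<^sup>2 * (- E2 + \<epsilon> * (- E3))"
    unfolding pform_def E2_def E3_def S1_def S2_def S3_def S4_def by algebra
  moreover have "W ^ 3 = Z" by (simp add: Z_def power3_eq_cube)
  ultimately show ?thesis by simp
qed

text \<open>The perturbation has gradient \<open>e * g\<close> and Hessian \<open>k\<close> times
  the identity plus \<open>d\<close> times the rank-one matrix of \<open>g\<close>. For
  \<open>p > 2\<close> the parts from \<open>k\<close> and from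
  \<open>(a * g1 + b * g2)\<^sup>2\<close> are nonnegative; the Laplacian contributes
  \<open>d * N\<^sup>2 * (a\<^sup>2 + b\<^sup>2)\<close>, whatever the angle between
  \<open>g\<close> and \<open>(a, b)\<close>. Only the change of gradient can be negative, and it is
  linear in \<open>e\<close>.\<close>

lemma linearised_pform_lower:
  assumes p: "p > 2" and B: "\<bar>a\<bar> \<le> B" "\<bar>b\<bar> \<le> B" "\<bar>m11\<bar> \<le> B" "\<bar>m12\<bar> \<le> B" "\<bar>m22\<bar> \<le> B"
    and c0: "c0 \<le> a\<^sup>2 + b\<^sup>2" and nn: "k \<ge> 0" "d \<ge> 0" "e \<ge> 0" "N \<ge> 0" and N: "N\<^sup>2 = g1\<^sup>2 + g2\<^sup>2"
  shows "d * c0 * N\<^sup>2 - e * (8 * (p - 1) * B\<^sup>2 * N)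
    \<le> pform p a b (k + d * g1\<^sup>2) (d * (g1 * g2)) (k + d * g2\<^sup>2)
      + ((p - 2) * (2 * (m11 * a * (e * g1)) + 2 * (m12 * a * (e * g2)) + 2 * (m12 * b * (e * g1)) + 2 * (m22 * b * (e * g2)))
          + 2 * (m11 * a * (e * g1) + m11 * b * (e * g2) + m22 * a * (e * g1) + m22 * b * (e * g2)))"
proof -
  have "\<bar>g1\<bar>\<^sup>2 \<le> N\<^sup>2" "\<bar>g2\<bar>\<^sup>2 \<le> N\<^sup>2" using N by auto
  then have g: "\<bar>g1\<bar> \<le> N" "\<bar>g2\<bar> \<le> N" using nn(4) power2_le_imp_le by blast+
  define Z where "Z = B * B * N"
  have t: "\<bar>x * y * z\<bar> \<le> Z" if "\<bar>x\<bar> \<le> B" "\<bar>y\<bar> \<le> B" "\<bar>z\<bar> \<le> N" for x y z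
    unfolding Z_def by (rule abs_mult_le_bound that)+
  define S1 where "S1 = 2 * (m11 * a * g1) + 2 * (m12 * a * g2) + 2 * (m12 * b * g1) + 2 * (m22 * b * g2)"
  define S2 where "S2 = 2 * (m11 * a * g1) + 2 * (m11 * b * g2) + 2 * (m22 * a * g1) + 2 * (m22 * b * g2)"
  have S: "- S1 \<le> 8 * Z" "- S2 \<le> 8 * Z"
    unfolding S1_def S2_def
    using t[OF B(3) B(1) g(1)] t[OF B(4) B(1) g(2)] t[OF B(4) B(2) g(1)] t[OF B(5) B(2) g(2)] t[OF B(3) B(2) g(2)] t[OF B(5) B(1) g(1)]
    unfolding abs_le_iff by linarith+
  have "(p - 2) * (- S1) \<le> (p - 2) * (8 * Z)" using p S by (intro mult_left_mono) auto
  then have "- ((p - 2) * S1 + S2) \<le> 8 * (p - 1) * Z" using S(2) by (simp add: algebra_simps)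
  then have "e * (- ((p - 2) * S1 + S2)) \<le> e * (8 * (p - 1) * Z)" using nn by (intro mult_left_mono)
  moreover have "(p - 2) * (2 * (m11 * a * (e * g1)) + 2 * (m12 * a * (e * g2)) + 2 * (m12 * b * (e * g1)) + 2 * (m22 * b * (e * g2)))
          + 2 * (m11 * a * (e * g1) + m11 * b * (e * g2) + m22 * a * (e * g1) + m22 * b * (e * g2)) = - (e * (- ((p - 2) * S1 + S2)))"
    unfolding S1_def S2_def by (simp add: algebra_simps)
  moreover have "pform p a b (k + d * g1\<^sup>2) (d * (g1 * g2)) (k + d * g2\<^sup>2)
      = k * p * (a\<^sup>2 + b\<^sup>2) + d * ((p - 2) * (a * g1 + b * g2)\<^sup>2) + d * N\<^sup>2 * (a\<^sup>2 + b\<^sup>2)"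
    unfolding pform_def N by algebra
  moreover have "0 \<le> k * p * (a\<^sup>2 + b\<^sup>2)" "0 \<le> d * ((p - 2) * (a * g1 + b * g2)\<^sup>2)" using nn p by auto
  moreover have "d * N\<^sup>2 * c0 \<le> d * N\<^sup>2 * (a\<^sup>2 + b\<^sup>2)" using c0 nn by (intro mult_left_mono) auto
  moreover have "e * (8 * (p - 1) * B\<^sup>2 * N) = e * (8 * (p - 1) * Z)" "d * c0 * N\<^sup>2 = d * N\<^sup>2 * c0"
    by (simp_all add: Z_def power2_eq_square)
  ultimately show ?thesis by linarith
qed

text \<open>The function \<open>u\<close> enters only through the bounds \<open>c0\<close> and
  \<open>B\<close>, so the same \<open>m\<close> and \<open>\<epsilon>0\<close> serve
  \<open>U\<close> and \<open>- U\<close>.\<close>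

lemma barrier:
  assumes p: "p > 2" and X: "compact X" and c0: "c0 > 0" and B: "B \<ge> 1"
    and q0: "\<And>x. x \<in> X \<Longrightarrow> 1 \<le> heis_mult (heis_inv q0) x $ 1"
  obtains m \<epsilon>0 where "0 < \<epsilon>0" "\<epsilon>0 \<le> 1"
    "\<And>u a b \<tau> m11 m12 m22 x \<epsilon>. x \<in> X \<Longrightarrow> 0 < \<epsilon> \<Longrightarrow> \<epsilon> \<le> \<epsilon>0 \<Longrightarrow> c0 \<le> a\<^sup>2 + b\<^sup>2 \<Longrightarrow>
      \<bar>a\<bar> \<le> B \<Longrightarrow> \<bar>b\<bar> \<le> B \<Longrightarrow> \<bar>\<tau>\<bar> \<le> B \<Longrightarrow> \<bar>m11\<bar> \<le> B \<Longrightarrow> \<bar>m12\<bar> \<le> B \<Longrightarrow> \<bar>m22\<bar> \<le> B \<Longrightarrow>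
      pform p a b m11 m12 m22 = 0 \<Longrightarrow> continuous_on korb (\<lambda>z. u (move x \<epsilon> z)) \<Longrightarrow>
      \<forall>z\<in>korb. \<bar>u (move x \<epsilon> z) - u x - \<epsilon> * lin a b z - \<epsilon>\<^sup>2 * qform \<tau> m11 m12 m22 z\<bar> \<le> B * \<epsilon> ^ 3 \<Longrightarrow>
      0 \<le> integral korb (\<lambda>z. spow p ((u (move x \<epsilon> z) + \<epsilon> * gauge4 (heis_mult (heis_inv q0) (move x \<epsilon> z)) ^ (m + 2)
          - (u x + \<epsilon> * gauge4 (heis_mult (heis_inv q0) x) ^ (m + 2))) / \<epsilon>))"
proof -
  let ?y = "heis_mult (heis_inv q0)"
  define Y where "Y = ?y ` X"
  have cy: "continuous_on S ?y" for S
  proof -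
    have "?y = (\<lambda>x. move (heis_inv q0) 1 x)" by (simp add: fun_eq_iff vec_eq_iff forall_3 move_nth)
    then show ?thesis by (auto intro!: continuous_intros)
  qed
  have Y: "compact Y" unfolding Y_def by (intro compact_continuous_image cy X)
  have Y1: "y$1 \<ge> 1" if "y \<in> Y" for y using that q0 by (auto simp: Y_def)
  have cont: "continuous_on S gauge4" "continuous_on S gr1" "continuous_on S gr2" for S
    unfolding gauge4_def[abs_def] gr1_def[abs_def] gr2_def[abs_def] by (intro continuous_intros)+
  have half: "c0 / 2 > 0" and B1: "B + 1 \<ge> 1" and B0: "B + 1 \<ge> 0" using c0 B by auto
  \<comment> \<open>\<open>c0 / 2\<close> and \<open>B + 1\<close> leave room for the perturbation,
    so \<open>K\<close> is fixed before the barrier is chosen.\<close>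
  obtain K where K: "K > 0"
    "\<And>w a b \<tau> m11 m12 m22 \<epsilon>. continuous_on korb w \<Longrightarrow> 0 < \<epsilon> \<Longrightarrow> \<epsilon> \<le> 1 \<Longrightarrow> c0 / 2 \<le> a\<^sup>2 + b\<^sup>2 \<Longrightarrow>
      \<bar>a\<bar> \<le> B + 1 \<Longrightarrow> \<bar>b\<bar> \<le> B + 1 \<Longrightarrow> \<bar>\<tau>\<bar> \<le> B + 1 \<Longrightarrow> \<bar>m11\<bar> \<le> B + 1 \<Longrightarrow> \<bar>m12\<bar> \<le> B + 1 \<Longrightarrow> \<bar>m22\<bar> \<le> B + 1 \<Longrightarrow>
      \<forall>z\<in>korb. lin a b z + \<epsilon> * qform \<tau> m11 m12 m22 z - \<epsilon>\<^sup>2 * (B + 1) \<le> w z \<Longrightarrow>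
      \<epsilon> * K \<le> pform p a b m11 m12 m22 \<Longrightarrow> 0 \<le> integral korb (\<lambda>z. spow p (w z))"
    by (rule integral_spow_nonneg[OF p half B1 B0 B0]) (rule that, assumption+)
  obtain \<Psi> where \<Psi>: "\<Psi> > 0" "\<forall>y\<in>Y. \<bar>gauge4 y\<bar> \<le> \<Psi>"
    by (rule bounded_on_compact[OF Y order_refl cont(1)])
  \<comment> \<open>The 4 is the lower bound for the gradient length \<open>N\<close> of
    \<open>gauge4\<close> on \<open>Y\<close>, established below.\<close>
  obtain m where m: "(8 * (p - 1) * B\<^sup>2 * \<Psi> + K + 1) / (4 * c0) \<le> real m"
    using real_arch_simple by blast
  obtain Cv where Cv: "Cv \<ge> 0"
    "\<forall>y\<in>Y. \<forall>z\<in>korb. \<forall>t\<in>{0..1}.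
      \<bar>gauge4 (move y t z) ^ (m + 2) - gauge4 y ^ (m + 2)
        - t * lin (real (m + 2) * gauge4 y ^ (m + 1) * gr1 y) (real (m + 2) * gauge4 y ^ (m + 1) * gr2 y) z
        - t\<^sup>2 * qform (real (m + 2) * gauge4 y ^ (m + 1) * (32 * y$3))
            (real (m + 2) * gauge4 y ^ (m + 1) * (12 * ((y$1)\<^sup>2 + (y$2)\<^sup>2)) + real (m + 2) * real (m + 1) * gauge4 y ^ m * (gr1 y)\<^sup>2)
            (real (m + 2) * real (m + 1) * gauge4 y ^ m * (gr1 y * gr2 y))
            (real (m + 2) * gauge4 y ^ (m + 1) * (12 * ((y$1)\<^sup>2 + (y$2)\<^sup>2)) + real (m + 2) * real (m + 1) * gauge4 y ^ m * (gr2 y)\<^sup>2) z\<bar>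
      \<le> Cv * t ^ 3"
    by (rule gauge4_power_taylor[OF Y])
  define e d k where "e = (\<lambda>y. real (m + 2) * gauge4 y ^ (m + 1))"
    and "d = (\<lambda>y. real (m + 2) * real (m + 1) * gauge4 y ^ m)"
    and "k = (\<lambda>y::heis. real (m + 2) * gauge4 y ^ (m + 1) * (12 * ((y$1)\<^sup>2 + (y$2)\<^sup>2)))"
  define va vb vt n11 n12 n22 where "va = (\<lambda>y. e y * gr1 y)" and "vb = (\<lambda>y. e y * gr2 y)"
    and "vt = (\<lambda>y::heis. e y * (32 * y$3))" and "n11 = (\<lambda>y. k y + d y * (gr1 y)\<^sup>2)"
    and "n12 = (\<lambda>y. d y * (gr1 y * gr2 y))" and "n22 = (\<lambda>y. k y + d y * (gr2 y)\<^sup>2)"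
  note defs = va_def vb_def vt_def n11_def n12_def n22_def e_def d_def k_def
  have "continuous_on Y va" "continuous_on Y vb" "continuous_on Y vt" "continuous_on Y n11" "continuous_on Y n12" "continuous_on Y n22"
    unfolding defs by (intro continuous_intros cont)+
  note cn = this
  note bd = bounded_on_compact[OF Y order_refl]
  obtain W1 where W1: "W1 > 0" "\<forall>y\<in>Y. \<bar>va y\<bar> \<le> W1" by (rule bd[OF cn(1)])
  obtain W2 where W2: "W2 > 0" "\<forall>y\<in>Y. \<bar>vb y\<bar> \<le> W2" by (rule bd[OF cn(2)])
  obtain W3 where W3: "W3 > 0" "\<forall>y\<in>Y. \<bar>vt y\<bar> \<le> W3" by (rule bd[OF cn(3)])
  obtain W4 where W4: "W4 > 0" "\<forall>y\<in>Y. \<bar>n11 y\<bar> \<le> W4" by (rule bd[OF cn(4)])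
  obtain W5 where W5: "W5 > 0" "\<forall>y\<in>Y. \<bar>n12 y\<bar> \<le> W5" by (rule bd[OF cn(5)])
  obtain W6 where W6: "W6 > 0" "\<forall>y\<in>Y. \<bar>n22 y\<bar> \<le> W6" by (rule bd[OF cn(6)])
  define W where "W = B + W1 + W2 + W3 + W4 + W5 + W6"
  have W: "W \<ge> 1" "B \<le> W" using W1 W2 W3 W4 W5 W6 B by (simp_all add: W_def)
  have Wb: "\<bar>va y\<bar> \<le> W" "\<bar>vb y\<bar> \<le> W" "\<bar>vt y\<bar> \<le> W" "\<bar>n11 y\<bar> \<le> W" "\<bar>n12 y\<bar> \<le> W" "\<bar>n22 y\<bar> \<le> W" if "y \<in> Y" for y
    using bspec[OF W1(2) that] bspec[OF W2(2) that] bspec[OF W3(2) that] bspec[OF W4(2) that] bspec[OF W5(2) that] bspec[OF W6(2) that]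
      W1(1) W2(1) W3(1) W4(1) W5(1) W6(1) B by (auto simp: W_def)
  \<comment> \<open>The four bounds in turn keep the perturbed coefficients below
    \<open>B + 1\<close>, make the Taylor error of \<open>\<epsilon>\<close> times the barrier at
    most \<open>\<epsilon> ^ 3\<close>, keep the squared gradient above \<open>c0 / 2\<close>, and
    make the quadratic error of \<open>pform_perturb\<close> at most
    \<open>\<epsilon>\<close>.\<close>
  define \<epsilon>0 where "\<epsilon>0 = min (min (1 / W) (1 / (Cv + 1))) (min (c0 / (8 * W\<^sup>2)) (1 / (16 * (p - 1) * W ^ 3)))"
  have \<epsilon>0: "0 < \<epsilon>0" "\<epsilon>0 \<le> 1"
  proof -
    show "0 < \<epsilon>0" using W Cv(1) c0 p by (auto simp: \<epsilon>0_def)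
    have "\<epsilon>0 \<le> 1 / W" by (simp add: \<epsilon>0_def)
    also have "\<dots> \<le> 1" using W by simp
    finally show "\<epsilon>0 \<le> 1" .
  qed
  show ?thesis
  proof (rule that[OF \<epsilon>0, of m])
    fix u a b \<tau> m11 m12 m22 x \<epsilon>
    assume x: "x \<in> X" and \<epsilon>: "0 < \<epsilon>" "\<epsilon> \<le> \<epsilon>0" and ab: "c0 \<le> a\<^sup>2 + b\<^sup>2"
      and bB: "\<bar>a\<bar> \<le> B" "\<bar>b\<bar> \<le> B" "\<bar>\<tau>\<bar> \<le> B" "\<bar>m11\<bar> \<le> B" "\<bar>m12\<bar> \<le> B" "\<bar>m22\<bar> \<le> B"
      and pf: "pform p a b m11 m12 m22 = 0" and cu: "continuous_on korb (\<lambda>z. u (move x \<epsilon> z))"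
      and ju: "\<forall>z\<in>korb. \<bar>u (move x \<epsilon> z) - u x - \<epsilon> * lin a b z - \<epsilon>\<^sup>2 * qform \<tau> m11 m12 m22 z\<bar> \<le> B * \<epsilon> ^ 3"
    define y where "y = ?y x"
    have y: "y \<in> Y" using x by (simp add: y_def Y_def)
    have my: "?y (move x \<epsilon> z) = move y \<epsilon> z" for z
      by (simp add: y_def move_def heis_mult_group)
    have bW: "\<bar>a\<bar> \<le> W" "\<bar>b\<bar> \<le> W" "\<bar>m11\<bar> \<le> W" "\<bar>m12\<bar> \<le> W" "\<bar>m22\<bar> \<le> W" using bB W by linarith+
    have \<epsilon>1: "\<epsilon> \<le> 1" using \<epsilon> \<epsilon>0 by linarith
    have \<epsilon>W: "\<epsilon> * W \<le> 1" "\<epsilon> * (Cv + 1) \<le> 1" "\<epsilon> * (8 * W\<^sup>2) \<le> c0" "\<epsilon> * (16 * (p - 1) * W ^ 3) \<le> 1"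
    proof -
      have "\<epsilon> \<le> 1 / W" "\<epsilon> \<le> 1 / (Cv + 1)" "\<epsilon> \<le> c0 / (8 * W\<^sup>2)" "\<epsilon> \<le> 1 / (16 * (p - 1) * W ^ 3)"
        using \<epsilon>(2) by (auto simp: \<epsilon>0_def)
      moreover have "0 < W" "0 < Cv + 1" "0 < 8 * W\<^sup>2" "0 < 16 * (p - 1) * W ^ 3" using W Cv(1) p by auto
      ultimately show "\<epsilon> * W \<le> 1" "\<epsilon> * (Cv + 1) \<le> 1" "\<epsilon> * (8 * W\<^sup>2) \<le> c0" "\<epsilon> * (16 * (p - 1) * W ^ 3) \<le> 1"
        by (simp_all only: pos_le_divide_eq)
    qed
    have small: "\<bar>r + \<epsilon> * s\<bar> \<le> B + 1" if "\<bar>r\<bar> \<le> B" "\<bar>s\<bar> \<le> W" for r s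
    proof -
      have "\<bar>\<epsilon> * s\<bar> \<le> \<epsilon> * W" using that(2) \<epsilon>(1) by (simp add: abs_mult)
      then show ?thesis using that(1) \<epsilon>W(1) by linarith
    qed
    define w where "w = (\<lambda>z. (u (move x \<epsilon> z) + \<epsilon> * gauge4 (?y (move x \<epsilon> z)) ^ (m + 2)
          - (u x + \<epsilon> * gauge4 (?y x) ^ (m + 2))) / \<epsilon>)"
    have "0 \<le> integral korb (\<lambda>z. spow p (w z))"
    proof (rule K(2))
      have "continuous_on korb (\<lambda>z. gauge4 (move y \<epsilon> z))"
        by (rule continuous_on_compose2[OF cont(1)]) (auto intro!: continuous_intros)
      then show "continuous_on korb w"
        unfolding w_def my using \<epsilon>(1) by (intro continuous_intros cu) auto
      show "0 < \<epsilon>" "\<epsilon> \<le> 1" by fact+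
      show "c0 / 2 \<le> (a + \<epsilon> * va y)\<^sup>2 + (b + \<epsilon> * vb y)\<^sup>2"
      proof -
        have "\<bar>a * va y\<bar> \<le> W * W" "\<bar>b * vb y\<bar> \<le> W * W" by (rule abs_mult_le_bound bW Wb y)+
        then have "- (a * va y + b * vb y) \<le> 2 * W\<^sup>2" unfolding power2_eq_square abs_le_iff by linarith
        then have "\<epsilon> * (- (a * va y + b * vb y)) \<le> \<epsilon> * (2 * W\<^sup>2)" using \<epsilon>(1) by (intro mult_left_mono) auto
        moreover have "(a + \<epsilon> * va y)\<^sup>2 + (b + \<epsilon> * vb y)\<^sup>2
          = a\<^sup>2 + b\<^sup>2 - 2 * (\<epsilon> * (- (a * va y + b * vb y))) + ((\<epsilon> * va y)\<^sup>2 + (\<epsilon> * vb y)\<^sup>2)"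
          by (simp add: power2_eq_square algebra_simps)
        moreover have "0 \<le> (\<epsilon> * va y)\<^sup>2 + (\<epsilon> * vb y)\<^sup>2" by simp
        ultimately have "a\<^sup>2 + b\<^sup>2 - 2 * (\<epsilon> * (2 * W\<^sup>2)) \<le> (a + \<epsilon> * va y)\<^sup>2 + (b + \<epsilon> * vb y)\<^sup>2" by linarith
        moreover have "4 * (\<epsilon> * (2 * W\<^sup>2)) \<le> c0" using \<epsilon>W(3) by (simp add: mult_ac)
        moreover have "c0 / 2 \<le> T" if "n - 2 * h \<le> T" "4 * h \<le> c0" "c0 \<le> n" for n h T :: real
          using that by simp
        ultimately show ?thesis using ab by blast
      qed
      show "\<bar>a + \<epsilon> * va y\<bar> \<le> B + 1" "\<bar>b + \<epsilon> * vb y\<bar> \<le> B + 1" "\<bar>\<tau> + \<epsilon> * vt y\<bar> \<le> B + 1"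
        "\<bar>m11 + \<epsilon> * n11 y\<bar> \<le> B + 1" "\<bar>m12 + \<epsilon> * n12 y\<bar> \<le> B + 1" "\<bar>m22 + \<epsilon> * n22 y\<bar> \<le> B + 1"
        by (rule small bB Wb y)+
      show "\<forall>z\<in>korb. lin (a + \<epsilon> * va y) (b + \<epsilon> * vb y) z
          + \<epsilon> * qform (\<tau> + \<epsilon> * vt y) (m11 + \<epsilon> * n11 y) (m12 + \<epsilon> * n12 y) (m22 + \<epsilon> * n22 y) z - \<epsilon>\<^sup>2 * (B + 1) \<le> w z"
      proof
        fix z assume z: "z \<in> korb"
        \<comment> \<open>The two Taylor errors contribute at most \<open>B * \<epsilon> ^ 3\<close>
          and \<open>\<epsilon> ^ 3\<close>; division by \<open>\<epsilon>\<close> leaves the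
          allowance \<open>\<epsilon>\<^sup>2 * (B + 1)\<close>.\<close>
        define Eu where "Eu = u (move x \<epsilon> z) - u x - \<epsilon> * lin a b z - \<epsilon>\<^sup>2 * qform \<tau> m11 m12 m22 z"
        define Ev where "Ev = gauge4 (move y \<epsilon> z) ^ (m + 2) - gauge4 y ^ (m + 2)
          - \<epsilon> * lin (va y) (vb y) z - \<epsilon>\<^sup>2 * qform (vt y) (n11 y) (n12 y) (n22 y) z"
        have Eu: "- Eu \<le> B * \<epsilon> ^ 3" using bspec[OF ju z] unfolding Eu_def[symmetric] by linarith
        have "\<epsilon> \<in> {0..1}" using \<epsilon>(1) \<epsilon>1 by simp
        from Cv(2)[rule_format, OF y z this] have "\<bar>Ev\<bar> \<le> Cv * \<epsilon> ^ 3"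
          unfolding Ev_def defs .
        then have "\<epsilon> * (- Ev) \<le> \<epsilon> * (Cv * \<epsilon> ^ 3)" using \<epsilon>(1) by (intro mult_left_mono) auto
        also have "\<dots> = \<epsilon> * Cv * \<epsilon> ^ 3" by simp
        also have "\<dots> \<le> 1 * \<epsilon> ^ 3"
          using \<epsilon>W(2) \<epsilon>(1) by (intro mult_right_mono) (auto simp: algebra_simps)
        finally have "- (Eu + \<epsilon> * Ev) \<le> \<epsilon> * (\<epsilon>\<^sup>2 * (B + 1))"
          using Eu by (simp add: algebra_simps power3_eq_cube power2_eq_square)
        moreover have "\<epsilon> * w z = \<epsilon> * (lin (a + \<epsilon> * va y) (b + \<epsilon> * vb y) z
          + \<epsilon> * qform (\<tau> + \<epsilon> * vt y) (m11 + \<epsilon> * n11 y) (m12 + \<epsilon> * n12 y) (m22 + \<epsilon> * n22 y) z) + (Eu + \<epsilon> * Ev)"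
        proof -
          have "\<epsilon> * w z = u (move x \<epsilon> z) + \<epsilon> * gauge4 (move y \<epsilon> z) ^ (m + 2) - (u x + \<epsilon> * gauge4 y ^ (m + 2))"
            unfolding w_def my using \<epsilon>(1) by (simp add: y_def)
          also have "\<dots> = \<epsilon> * lin a b z + \<epsilon>\<^sup>2 * qform \<tau> m11 m12 m22 z
            + \<epsilon> * (\<epsilon> * lin (va y) (vb y) z + \<epsilon>\<^sup>2 * qform (vt y) (n11 y) (n12 y) (n22 y) z) + (Eu + \<epsilon> * Ev)"
            unfolding Eu_def Ev_def by (simp only: algebra_simps)
          also have "\<dots> = \<epsilon> * (lin (a + \<epsilon> * va y) (b + \<epsilon> * vb y) z
          + \<epsilon> * qform (\<tau> + \<epsilon> * vt y) (m11 + \<epsilon> * n11 y) (m12 + \<epsilon> * n12 y) (m22 + \<epsilon> * n22 y) z) + (Eu + \<epsilon> * Ev)"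
            unfolding lin_def qform_def by (simp add: field_simps power2_eq_square)
          finally show ?thesis .
        qed
        ultimately have "\<epsilon> * (lin (a + \<epsilon> * va y) (b + \<epsilon> * vb y) z
          + \<epsilon> * qform (\<tau> + \<epsilon> * vt y) (m11 + \<epsilon> * n11 y) (m12 + \<epsilon> * n12 y) (m22 + \<epsilon> * n22 y) z - \<epsilon>\<^sup>2 * (B + 1)) \<le> \<epsilon> * w z"
          unfolding right_diff_distrib by linarith
        then show "lin (a + \<epsilon> * va y) (b + \<epsilon> * vb y) z
          + \<epsilon> * qform (\<tau> + \<epsilon> * vt y) (m11 + \<epsilon> * n11 y) (m12 + \<epsilon> * n12 y) (m22 + \<epsilon> * n22 y) z - \<epsilon>\<^sup>2 * (B + 1) \<le> w z"
          using \<epsilon>(1) by simp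
      qed
      show "\<epsilon> * K \<le> pform p (a + \<epsilon> * va y) (b + \<epsilon> * vb y) (m11 + \<epsilon> * n11 y) (m12 + \<epsilon> * n12 y) (m22 + \<epsilon> * n22 y)"
      proof -
        define N where "N = sqrt ((gr1 y)\<^sup>2 + (gr2 y)\<^sup>2)"
        have N: "N \<ge> 0" "N\<^sup>2 = (gr1 y)\<^sup>2 + (gr2 y)\<^sup>2" by (simp_all add: N_def)
        define r where "r = (y$1)\<^sup>2 + (y$2)\<^sup>2"
        have r: "r \<ge> 1"
          unfolding r_def using Y1[OF y] by (intro add_increasing2[OF zero_le_power2] one_le_power)
        have g1: "gauge4 y \<ge> 1"
          unfolding gauge4_def r_def[symmetric] using r by (intro add_increasing2 one_le_power) auto
        have "4\<^sup>2 \<le> N\<^sup>2" unfolding N(2) gr_norm r_def[symmetric] using mult_mono[of 1 r 1 "gauge4 y"] r g1 by simp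
        then have N4: "N \<ge> 4" using N(1) by (rule power2_le_imp_le)
        have kde: "k y \<ge> 0" "d y \<ge> 0" "e y \<ge> 0" by (simp_all add: k_def d_def e_def)
        \<comment> \<open>The factor \<open>real (m + 2) * gauge4 y ^ m * N\<close> is at least 1.
          What remains after taking it out grows linearly with \<open>m\<close> and is at least
          \<open>K + 1\<close> by the choice of \<open>m\<close>.\<close>
        have ln: "K + 1 \<le> d y * c0 * N\<^sup>2 - e y * (8 * (p - 1) * B\<^sup>2 * N)"
        proof -
          have "8 * (p - 1) * B\<^sup>2 * gauge4 y \<le> 8 * (p - 1) * B\<^sup>2 * \<Psi>"
            using bspec[OF \<Psi>(2) y] p by (intro mult_left_mono) auto
          moreover have "8 * (p - 1) * B\<^sup>2 * \<Psi> + K + 1 \<le> real m * (4 * c0)"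
            using m c0 by (simp add: pos_divide_le_eq)
          moreover have "real m * (4 * c0) \<le> real (m + 1) * c0 * N"
          proof -
            have "real m * (4 * c0) \<le> real (m + 1) * (N * c0)"
              using N4 c0 by (intro mult_mono) auto
            then show ?thesis by (simp add: mult_ac)
          qed
          ultimately have "K + 1 \<le> real (m + 1) * c0 * N - 8 * (p - 1) * B\<^sup>2 * gauge4 y" by linarith
          moreover have "1 \<le> real (m + 2) * gauge4 y ^ m * N"
          proof -
            have "1 * 1 * 1 \<le> real (m + 2) * gauge4 y ^ m * N"
              using g1 N4 by (intro mult_mono one_le_power) auto
            then show ?thesis by simp
          qed
          ultimately have "1 * (K + 1) \<le> (real (m + 2) * gauge4 y ^ m * N) * (real (m + 1) * c0 * N - 8 * (p - 1) * B\<^sup>2 * gauge4 y)"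
            using K(1) by (intro mult_mono) auto
          also have "\<dots> = d y * c0 * N\<^sup>2 - e y * (8 * (p - 1) * B\<^sup>2 * N)"
            unfolding d_def e_def by (simp add: algebra_simps power2_eq_square)
          finally show ?thesis by simp
        qed
        define L where "L = pform p a b (n11 y) (n12 y) (n22 y)
          + ((p - 2) * (2 * (m11 * a * va y) + 2 * (m12 * a * vb y) + 2 * (m12 * b * va y) + 2 * (m22 * b * vb y))
          + 2 * (m11 * a * va y + m11 * b * vb y + m22 * a * va y + m22 * b * vb y))"
        have "K + 1 \<le> L"
          unfolding L_def n11_def n12_def n22_def va_def vb_def
          by (rule order_trans[OF ln linearised_pform_lower[OF p bB(1,2,4-6) ab kde N]])
        \<comment> \<open>The surplus 1 pays for the quadratic error of
          \<open>pform_perturb\<close>.\<close>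
        then have "\<epsilon> * (K + 1) \<le> \<epsilon> * L" using \<epsilon>(1) by (intro mult_left_mono) auto
        moreover have "0 + \<epsilon> * L - \<epsilon>\<^sup>2 * (16 * (p - 1) * W ^ 3)
          \<le> pform p (a + \<epsilon> * va y) (b + \<epsilon> * vb y) (m11 + \<epsilon> * n11 y) (m12 + \<epsilon> * n12 y) (m22 + \<epsilon> * n22 y)"
          using pform_perturb[OF p less_imp_le[OF \<epsilon>(1)] \<epsilon>1 bW Wb(1,2,4-6)[OF y]] unfolding pf L_def .
        moreover have "\<epsilon>\<^sup>2 * (16 * (p - 1) * W ^ 3) \<le> \<epsilon> * 1"
          using mult_left_mono[OF \<epsilon>W(4), of \<epsilon>] \<epsilon>(1) by (simp add: power2_eq_square mult_ac)
        ultimately show ?thesis by (simp add: algebra_simps)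
      qed
    qed
    then show "0 \<le> integral korb (\<lambda>z. spow p ((u (move x \<epsilon> z) + \<epsilon> * gauge4 (?y (move x \<epsilon> z)) ^ (m + 2)
          - (u x + \<epsilon> * gauge4 (?y x) ^ (m + 2))) / \<epsilon>))"
      by (simp only: w_def)
  qed
qed

text \<open>The volume dominates \<open>kappa 3\<close>, since the third power of
  \<open>\<bar>z$1\<bar>\<close> is at most 1 on the ball.\<close>

lemma integral_korb_1_pos: "integral korb (\<lambda>_. 1 :: real) > 0"
proof -
  have "spow 3 (z$1) * z$1 \<le> 1" if "z \<in> korb" for z
  proof -
    have "\<bar>spow 3 (z$1)\<bar> \<le> 1"
      unfolding abs_spow using korb_bounds(2)[OF that] powr_mono2[of 2 "\<bar>z$1\<bar>" 1] by simp
    from abs_mult_le_bound[OF this korb_bounds(2)[OF that]] show ?thesis by simp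
  qed
  then have "kappa 3 \<le> integral korb (\<lambda>_. 1)"
    unfolding kappa_def by (intro integral_le continuous_on_korb_integrable continuous_intros) auto
  then show ?thesis using kappa_pos[of 3] by simp
qed

section \<open>Boundary strips and conclusion\<close>

lemma heis_dist_commute: "heis_dist x y = heis_dist y x"
proof -
  have "heis_mult (heis_inv y) x = - heis_mult (heis_inv x) y"
    by (simp add: vec_eq_iff forall_3 heis_inv_def field_simps)
  moreover have "heis_gauge (- w) = heis_gauge w" for w by (simp add: heis_gauge_def)
  ultimately show ?thesis by (simp add: heis_dist_def)
qed

text \<open>The infimum in \<open>heis_setdist\<close> need not be attained, so a point of \<Omega>
  is picked at distance below \<open>2 * \<epsilon>\<close>; hence the factor 2.\<close>

lemma extended_domain_subset_moves:
  assumes \<epsilon>: "\<epsilon> > 0" "2 * \<epsilon> \<le> \<delta>" and ne: "\<Omega> \<noteq> {}" and X: "\<Omega> \<subseteq> X"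
  shows "extended_domain \<Omega> \<epsilon> \<subseteq> moves X \<delta>"
proof
  fix x assume x: "x \<in> extended_domain \<Omega> \<epsilon>"
  show "x \<in> moves X \<delta>"
  proof (cases "x \<in> \<Omega>")
    case True
    have "0 \<in> korb" by (simp add: korb_def)
    then show ?thesis using move_in_moves[of x X 0 0 \<delta>] True X \<epsilon> by auto
  next
    case False
    then have "Inf (heis_dist x ` \<Omega>) < 2 * \<epsilon>"
      using x \<epsilon> by (auto simp: extended_domain_def boundary_strip_def heis_setdist_def)
    then obtain y where y: "y \<in> \<Omega>" "heis_dist x y < 2 * \<epsilon>"
      using cInf_lessD[of "heis_dist x ` \<Omega>" "2 * \<epsilon>"] ne by auto
    then have "heis_dist y x \<le> 2 * \<epsilon>" by (simp add: heis_dist_commute)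
    then obtain z where z: "z \<in> korb" "x = move y (2 * \<epsilon>) z"
      using move_of_dist[of "2 * \<epsilon>" y x] \<epsilon> by auto
    then show ?thesis using move_in_moves[of y X z "2 * \<epsilon>" \<delta>] y(1) X \<epsilon> by auto
  qed
qed

lemma bounded_measurable_on_subset:
  assumes "open S" "continuous_on S f" "compact P" "P \<subseteq> S" "E \<subseteq> P"
  shows "bounded_measurable_on E f"
  unfolding bounded_measurable_on_def
proof
  have "bounded (f ` P)"
    using assms by (intro compact_imp_bounded compact_continuous_image) (auto intro: continuous_on_subset)
  then show "bounded (f ` E)" using assms(5) by (meson bounded_subset image_mono)
  have "f \<in> borel_measurable (lebesgue_on S)"
    using assms(1,2) by (intro continuous_imp_measurable_on_sets_lebesgue) auto
  then show "f \<in> borel_measurable (lebesgue_on E)"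
    using assms(4,5) by (intro measurable_restrict_mono[of f lebesgue S borel E]) auto
qed

text \<open>With \<open>s = 4 * (m + 2)\<close> the real power of the gauge is a polynomial, also at
  the centre, where both sides are 0.\<close>

lemma heis_gauge_powr: "heis_gauge x powr (4 * real (m + 2)) = gauge4 x ^ (m + 2)"
proof (cases "gauge4 x = 0")
  case False
  then have "gauge4 x > 0" using gauge4_nonneg[of x] by linarith
  have "heis_gauge x powr (4 * real (m + 2)) = gauge4 x powr (1/4 * (4 * real (m + 2)))"
    unfolding heis_gauge_gauge4 by (rule powr_powr)
  also have "1/4 * (4 * real (m + 2)) = real (m + 2)" by simp
  finally show ?thesis using \<open>gauge4 x > 0\<close> by (simp only: powr_realpow)
qed (simp add: heis_gauge_gauge4)

theorem lemma1p7:
  fixes p :: real and \<Omega> \<Omega>' :: "heis set" and U :: "heis \<Rightarrow> real"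
  assumes "2 < p"
    and "open \<Omega>" and "connected \<Omega>" and "\<Omega> \<noteq> {}" and "bounded \<Omega>"
    and "open \<Omega>'" and "closure \<Omega> \<subseteq> \<Omega>'"
    and "smooth_fun_on \<Omega>' U"
    and "\<forall>x\<in>\<Omega>'. normalized_p_laplacian p U x = 0"
    and "\<forall>x\<in>\<Omega>'. hor_grad U x \<noteq> 0"
  shows "\<exists>\<epsilon>h::real. 0 < \<epsilon>h \<and> \<epsilon>h < 1 \<and>
    (\<forall>\<epsilon>. 0 < \<epsilon> \<and> \<epsilon> < \<epsilon>h \<longrightarrow> extended_domain \<Omega> \<epsilon> \<subseteq> \<Omega>') \<and>
    (\<exists>s::real. s \<ge> 4 \<and> (\<exists>q0::heis.
      let v = (\<lambda>x. heis_gauge (heis_mult (heis_inv q0) x) powr s) in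
      \<forall>\<epsilon>. 0 < \<epsilon> \<and> \<epsilon> < \<epsilon>h \<longrightarrow>
        dpp_subsolution p \<Omega> \<epsilon> (\<lambda>x. U x + \<epsilon> * v x) (\<lambda>x. U x + \<epsilon> * v x) \<and>
        dpp_supersolution p \<Omega> \<epsilon> (\<lambda>x. U x - \<epsilon> * v x) (\<lambda>x. U x - \<epsilon> * v x)))"
proof -
  note p = assms(1) and ne = assms(4) and S = assms(6) and U = assms(8)
  define X where "X = closure \<Omega>"
  have X: "compact X" "X \<subseteq> \<Omega>'" "\<Omega> \<subseteq> X" "X \<noteq> {}"
    using assms closure_subset[of \<Omega>] by (auto simp: X_def compact_closure)
  define a b \<tau> m11 m12 m22 where "a = hor 1 U" and "b = hor 2 U" and "\<tau> = partial 3 U"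
    and "m11 = hor 1 (hor 1 U)" and "m12 = (\<lambda>x. (hor 1 (hor 2 U) x + hor 2 (hor 1 U) x) / 2)" and "m22 = hor 2 (hor 2 U)"
  note defs = a_def b_def \<tau>_def m11_def m12_def m22_def
  have sm: "smooth_fun_on \<Omega>' (hor i U)" "smooth_fun_on \<Omega>' (hor i (hor j U))" "smooth_fun_on \<Omega>' \<tau>" for i j
    unfolding \<tau>_def using S U by (auto intro: smooth_fun_on_hor smooth_fun_on_partial)
  have cont: "continuous_on \<Omega>' a" "continuous_on \<Omega>' b" "continuous_on \<Omega>' \<tau>" "continuous_on \<Omega>' m11" "continuous_on \<Omega>' m12" "continuous_on \<Omega>' m22"
    unfolding defs using sm[THEN smooth_fun_on_continuous] by (auto intro!: continuous_intros simp: \<tau>_def)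
  obtain \<delta> where \<delta>: "0 < \<delta>" "\<delta> \<le> 1" "moves X \<delta> \<subseteq> \<Omega>'" by (rule move_compact_subset[OF X(1) S X(2)])
  obtain C where C: "C > 0" "\<forall>x\<in>X. \<forall>z\<in>korb. \<forall>t\<in>{0..\<delta>}.
      \<bar>U (move x t z) - U x - t * lin (a x) (b x) z - t\<^sup>2 * qform (\<tau> x) (m11 x) (m12 x) (m22 x) z\<bar> \<le> C * t ^ 3"
    unfolding defs by (rule taylor_along_move[OF X(1) S U \<delta>(3,2)])
  note bd = bounded_on_compact[OF X(1,2)]
  obtain B1 where B1: "B1 > 0" "\<forall>y\<in>X. \<bar>a y\<bar> \<le> B1" by (rule bd[OF cont(1)])
  obtain B2 where B2: "B2 > 0" "\<forall>y\<in>X. \<bar>b y\<bar> \<le> B2" by (rule bd[OF cont(2)])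
  obtain B3 where B3: "B3 > 0" "\<forall>y\<in>X. \<bar>\<tau> y\<bar> \<le> B3" by (rule bd[OF cont(3)])
  obtain B4 where B4: "B4 > 0" "\<forall>y\<in>X. \<bar>m11 y\<bar> \<le> B4" by (rule bd[OF cont(4)])
  obtain B5 where B5: "B5 > 0" "\<forall>y\<in>X. \<bar>m12 y\<bar> \<le> B5" by (rule bd[OF cont(5)])
  obtain B6 where B6: "B6 > 0" "\<forall>y\<in>X. \<bar>m22 y\<bar> \<le> B6" by (rule bd[OF cont(6)])
  \<comment> \<open>One bound for the coefficients of \<open>U\<close> on the closure and for its
    Taylor constant, as \<open>barrier\<close> expects.\<close>
  define B where "B = 1 + C + B1 + B2 + B3 + B4 + B5 + B6"
  have B: "B \<ge> 1" "C \<le> B" using C(1) B1(1) B2(1) B3(1) B4(1) B5(1) B6(1) by (simp_all add: B_def)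
  have Bx: "\<bar>a x\<bar> \<le> B" "\<bar>b x\<bar> \<le> B" "\<bar>\<tau> x\<bar> \<le> B" "\<bar>m11 x\<bar> \<le> B" "\<bar>m12 x\<bar> \<le> B" "\<bar>m22 x\<bar> \<le> B" if "x \<in> X" for x
    using bspec[OF B1(2) that] bspec[OF B2(2) that] bspec[OF B3(2) that] bspec[OF B4(2) that] bspec[OF B5(2) that] bspec[OF B6(2) that]
      C(1) B1(1) B2(1) B3(1) B4(1) B5(1) B6(1) by (simp_all add: B_def)
  have harm: "pform p (a x) (b x) (m11 x) (m12 x) (m22 x) = 0" "(a x)\<^sup>2 + (b x)\<^sup>2 > 0" if "x \<in> X" for x
    using p_harmonic_pform[of p U x] that X(2) assms(9,10) unfolding defs by auto
  obtain c0 where c0: "c0 > 0" "\<And>x. x \<in> X \<Longrightarrow> c0 \<le> (a x)\<^sup>2 + (b x)\<^sup>2"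
  proof -
    have "continuous_on X (\<lambda>x. (a x)\<^sup>2 + (b x)\<^sup>2)"
      using cont(1,2) X(2) by (intro continuous_intros) (auto intro: continuous_on_subset)
    then obtain y where "y \<in> X" "\<forall>x\<in>X. (a y)\<^sup>2 + (b y)\<^sup>2 \<le> (a x)\<^sup>2 + (b x)\<^sup>2"
      using continuous_attains_inf[OF X(1,4)] by blast
    then show ?thesis using that harm(2) by blast
  qed
  obtain M where M: "M > 0" "\<And>x. x \<in> X \<Longrightarrow> norm x \<le> M"
    using compact_imp_bounded[OF X(1)] by (auto simp: bounded_pos)
  \<comment> \<open>Left translation by the inverse adds \<open>M + 1\<close> to the first
    coordinate, which is at least \<open>- M\<close> on \<open>X\<close>; so all of \<open>X\<close>
    ends up at horizontal distance at least 1 from the vertical axis.\<close>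
  define q0 :: heis where "q0 = vector [- (M + 1), 0, 0]"
  have q0: "1 \<le> heis_mult (heis_inv q0) x $ 1" if "x \<in> X" for x
    using component_le_norm_cart[of x 1] M(2)[OF that] by (simp add: q0_def heis_inv_def abs_le_iff)
  obtain m \<epsilon>0 where \<epsilon>0: "0 < \<epsilon>0" "\<epsilon>0 \<le> 1" and bar:
    "\<And>u a b \<tau> k l n x \<epsilon>. x \<in> X \<Longrightarrow> 0 < \<epsilon> \<Longrightarrow> \<epsilon> \<le> \<epsilon>0 \<Longrightarrow> c0 \<le> a\<^sup>2 + b\<^sup>2 \<Longrightarrow>
      \<bar>a\<bar> \<le> B \<Longrightarrow> \<bar>b\<bar> \<le> B \<Longrightarrow> \<bar>\<tau>\<bar> \<le> B \<Longrightarrow> \<bar>k\<bar> \<le> B \<Longrightarrow> \<bar>l\<bar> \<le> B \<Longrightarrow> \<bar>n\<bar> \<le> B \<Longrightarrow>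
      pform p a b k l n = 0 \<Longrightarrow> continuous_on korb (\<lambda>z. u (move x \<epsilon> z)) \<Longrightarrow>
      \<forall>z\<in>korb. \<bar>u (move x \<epsilon> z) - u x - \<epsilon> * lin a b z - \<epsilon>\<^sup>2 * qform \<tau> k l n z\<bar> \<le> B * \<epsilon> ^ 3 \<Longrightarrow>
      0 \<le> integral korb (\<lambda>z. spow p ((u (move x \<epsilon> z) + \<epsilon> * gauge4 (heis_mult (heis_inv q0) (move x \<epsilon> z)) ^ (m + 2)
          - (u x + \<epsilon> * gauge4 (heis_mult (heis_inv q0) x) ^ (m + 2))) / \<epsilon>))"
    by (rule barrier[OF p X(1) c0(1) B(1) q0]) (assumption, rule that, assumption+)
  define v where "v = (\<lambda>x. gauge4 (heis_mult (heis_inv q0) x) ^ (m + 2))"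
  have cv: "continuous_on A v" for A
    unfolding v_def gauge4_def heis_mult_nth by (intro continuous_intros) auto
  \<comment> \<open>Half of \<open>\<delta>\<close> accommodates the factor 2 of
    \<open>extended_domain_subset_moves\<close> and also gives
    \<open>\<epsilon>h < 1\<close>.\<close>
  define \<epsilon>h where "\<epsilon>h = min \<epsilon>0 (\<delta> / 2)"
  have \<epsilon>h: "0 < \<epsilon>h" "\<epsilon>h < 1" using \<epsilon>0 \<delta> by (auto simp: \<epsilon>h_def)
  have ext: "extended_domain \<Omega> \<epsilon> \<subseteq> moves X \<delta>" if "0 < \<epsilon>" "\<epsilon> < \<epsilon>h" for \<epsilon>
    using that ne X(3) by (intro extended_domain_subset_moves) (auto simp: \<epsilon>h_def)
  have main: "dpp_subsolution p \<Omega> \<epsilon> (\<lambda>x. U x + \<epsilon> * v x) (\<lambda>x. U x + \<epsilon> * v x)"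
    "dpp_supersolution p \<Omega> \<epsilon> (\<lambda>x. U x - \<epsilon> * v x) (\<lambda>x. U x - \<epsilon> * v x)" if \<epsilon>: "0 < \<epsilon>" "\<epsilon> < \<epsilon>h" for \<epsilon>
  proof -
    have \<epsilon>': "\<epsilon> \<le> \<epsilon>0" "\<epsilon> \<le> \<delta>" using \<epsilon> \<delta>(1) by (auto simp: \<epsilon>h_def)
    have cU: "continuous_on \<Omega>' U" by (rule smooth_fun_on_continuous[OF U])
    have cp: "continuous_on \<Omega>' (\<lambda>x. U x + \<epsilon> * v x)" and cm: "continuous_on \<Omega>' (\<lambda>x. U x - \<epsilon> * v x)"
      by (intro continuous_intros cU cv)+
    have bm: "bounded_measurable_on (extended_domain \<Omega> \<epsilon>) f" if "continuous_on \<Omega>' f" for f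
      by (rule bounded_measurable_on_subset[OF S that compact_moves[OF X(1)] \<delta>(3) ext[OF \<epsilon>]])
    have le: "U x + \<epsilon> * v x \<le> p_mean p (\<lambda>x. U x + \<epsilon> * v x) \<epsilon> x"
      and ge: "p_mean p (\<lambda>x. U x - \<epsilon> * v x) \<epsilon> x \<le> U x - \<epsilon> * v x" if "x \<in> \<Omega>" for x
    proof -
      have x: "x \<in> X" using that X(3) by auto
      have sub: "move x \<epsilon> ` korb \<subseteq> \<Omega>'"
        using move_in_moves[OF x] \<epsilon>(1) \<epsilon>'(2) \<delta>(3) by force
      have jU: "\<bar>U (move x \<epsilon> z) - U x - \<epsilon> * lin (a x) (b x) z - \<epsilon>\<^sup>2 * qform (\<tau> x) (m11 x) (m12 x) (m22 x) z\<bar> \<le> B * \<epsilon> ^ 3"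
        if "z \<in> korb" for z
      proof -
        have "\<bar>U (move x \<epsilon> z) - U x - \<epsilon> * lin (a x) (b x) z - \<epsilon>\<^sup>2 * qform (\<tau> x) (m11 x) (m12 x) (m22 x) z\<bar> \<le> C * \<epsilon> ^ 3"
          using C(2) x that \<epsilon>(1) \<epsilon>'(2) by auto
        also have "\<dots> \<le> B * \<epsilon> ^ 3" using B(2) \<epsilon>(1) by (intro mult_right_mono) auto
        finally show ?thesis .
      qed
      have cUm: "continuous_on korb (\<lambda>z. U (move x \<epsilon> z))"
        using sub by (intro continuous_on_compose2[OF cU] continuous_intros) auto
      have "0 \<le> integral korb (\<lambda>z. spow p ((U (move x \<epsilon> z) + \<epsilon> * v (move x \<epsilon> z) - (U x + \<epsilon> * v x)) / \<epsilon>))"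
        unfolding v_def
        by (rule bar[where u = U, OF x \<epsilon>(1) \<epsilon>'(1) c0(2)[OF x] Bx[OF x] harm(1)[OF x] cUm]) (use jU in auto)
      with p_mean_comparison_korb(1)[OF p \<epsilon>(1) continuous_on_subset[OF cp sub] integral_korb_1_pos]
      show "U x + \<epsilon> * v x \<le> p_mean p (\<lambda>x. U x + \<epsilon> * v x) \<epsilon> x" by blast
      \<comment> \<open>\<open>pform\<close> is odd in all its coefficients jointly, so
        \<open>- U\<close> satisfies the hypotheses with the same bounds. The result for
        \<open>- U + \<epsilon> * v\<close> is then reflected through the oddness of
        \<open>spow\<close>.\<close>
      have "0 \<le> integral korb (\<lambda>z. spow p ((- U (move x \<epsilon> z) + \<epsilon> * v (move x \<epsilon> z) - (- U x + \<epsilon> * v x)) / \<epsilon>))"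
        unfolding v_def
      proof (rule bar[where u = "\<lambda>x. - U x" and a = "- a x" and b = "- b x" and \<tau> = "- \<tau> x"
            and k = "- m11 x" and l = "- m12 x" and n = "- m22 x", OF x \<epsilon>(1) \<epsilon>'(1)])
        have "pform p (- a x) (- b x) (- m11 x) (- m12 x) (- m22 x) = - pform p (a x) (b x) (m11 x) (m12 x) (m22 x)"
          unfolding pform_def by algebra
        then show "pform p (- a x) (- b x) (- m11 x) (- m12 x) (- m22 x) = 0" using harm(1)[OF x] by simp
        show "\<forall>z\<in>korb. \<bar>- U (move x \<epsilon> z) - - U x - \<epsilon> * lin (- a x) (- b x) z
            - \<epsilon>\<^sup>2 * qform (- \<tau> x) (- m11 x) (- m12 x) (- m22 x) z\<bar> \<le> B * \<epsilon> ^ 3"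
        proof
          fix z assume z: "z \<in> korb"
          have "- U (move x \<epsilon> z) - - U x - \<epsilon> * lin (- a x) (- b x) z - \<epsilon>\<^sup>2 * qform (- \<tau> x) (- m11 x) (- m12 x) (- m22 x) z
            = - (U (move x \<epsilon> z) - U x - \<epsilon> * lin (a x) (b x) z - \<epsilon>\<^sup>2 * qform (\<tau> x) (m11 x) (m12 x) (m22 x) z)"
            unfolding lin_def qform_def by (simp add: field_simps)
          then show "\<bar>- U (move x \<epsilon> z) - - U x - \<epsilon> * lin (- a x) (- b x) z
            - \<epsilon>\<^sup>2 * qform (- \<tau> x) (- m11 x) (- m12 x) (- m22 x) z\<bar> \<le> B * \<epsilon> ^ 3"
            using jU[OF z] by (simp only: abs_minus_cancel)
        qed
      qed (use c0(2)[OF x] Bx[OF x] cUm in \<open>auto intro: continuous_on_minus\<close>)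
      also have "(\<lambda>z. spow p ((- U (move x \<epsilon> z) + \<epsilon> * v (move x \<epsilon> z) - (- U x + \<epsilon> * v x)) / \<epsilon>))
        = (\<lambda>z. - spow p ((U (move x \<epsilon> z) - \<epsilon> * v (move x \<epsilon> z) - (U x - \<epsilon> * v x)) / \<epsilon>))"
      proof
        fix z
        have "(- U (move x \<epsilon> z) + \<epsilon> * v (move x \<epsilon> z) - (- U x + \<epsilon> * v x)) / \<epsilon>
          = - ((U (move x \<epsilon> z) - \<epsilon> * v (move x \<epsilon> z) - (U x - \<epsilon> * v x)) / \<epsilon>)"
          by (simp add: diff_divide_distrib add_divide_distrib)
        then show "spow p ((- U (move x \<epsilon> z) + \<epsilon> * v (move x \<epsilon> z) - (- U x + \<epsilon> * v x)) / \<epsilon>)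
          = - spow p ((U (move x \<epsilon> z) - \<epsilon> * v (move x \<epsilon> z) - (U x - \<epsilon> * v x)) / \<epsilon>)"
          by (simp only: spow_minus)
      qed
      finally have "integral korb (\<lambda>z. spow p ((U (move x \<epsilon> z) - \<epsilon> * v (move x \<epsilon> z) - (U x - \<epsilon> * v x)) / \<epsilon>)) \<le> 0"
        by simp
      with p_mean_comparison_korb(2)[OF p \<epsilon>(1) continuous_on_subset[OF cm sub] integral_korb_1_pos]
      show "p_mean p (\<lambda>x. U x - \<epsilon> * v x) \<epsilon> x \<le> U x - \<epsilon> * v x" by blast
    qed
    show "dpp_subsolution p \<Omega> \<epsilon> (\<lambda>x. U x + \<epsilon> * v x) (\<lambda>x. U x + \<epsilon> * v x)"
      unfolding dpp_subsolution_def using bm[OF cp] le by blast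
    show "dpp_supersolution p \<Omega> \<epsilon> (\<lambda>x. U x - \<epsilon> * v x) (\<lambda>x. U x - \<epsilon> * v x)"
      unfolding dpp_supersolution_def using bm[OF cm] ge by blast
  qed
  have v: "(\<lambda>x. heis_gauge (heis_mult (heis_inv q0) x) powr (4 * real (m + 2))) = v"
    unfolding v_def heis_gauge_powr ..
  show ?thesis
  proof (intro exI conjI allI impI)
    show "0 < \<epsilon>h" "\<epsilon>h < 1" by fact+
    show "extended_domain \<Omega> \<epsilon> \<subseteq> \<Omega>'" if "0 < \<epsilon> \<and> \<epsilon> < \<epsilon>h" for \<epsilon> using ext[of \<epsilon>] that \<delta>(3) by auto
    show "4 \<le> 4 * real (m + 2)" by simp
    show "let v = (\<lambda>x. heis_gauge (heis_mult (heis_inv q0) x) powr (4 * real (m + 2))) in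
      \<forall>\<epsilon>. 0 < \<epsilon> \<and> \<epsilon> < \<epsilon>h \<longrightarrow>
        dpp_subsolution p \<Omega> \<epsilon> (\<lambda>x. U x + \<epsilon> * v x) (\<lambda>x. U x + \<epsilon> * v x) \<and>
        dpp_supersolution p \<Omega> \<epsilon> (\<lambda>x. U x - \<epsilon> * v x) (\<lambda>x. U x - \<epsilon> * v x)"
      unfolding v Let_def using main by blast
  qed
qed

end
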